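(* Let $V\in\mathcal{C}^\infty(\mathbb{T}^2,\mathbb{R})$ and let $(\varepsilon_\hbar)_{0<\hbar\le 1}$ be positive numbers with $\hbar^2\ll\varepsilon_\hbar\ll\hbar$, i.e. $\varepsilon_\hbar/\hbar^2\to+\infty$ and $\varepsilon_\hbar/\hbar\to0$ as $\hbar\to0^+$. Let $(\psi_\hbar)_{\hbar\to0^+}$ be a family of functions in $L^2(\mathbb{T}^2)$ with $\|\psi_\hbar\|_{L^2}=1$ satisfying $$\lim_{\delta\to0^+}\limsup_{\hbar\to0^+}\|\mathbf{1}_{[0,\delta]}(-\hbar^2\Delta)\psi_\hbar\|_{L^2}=0,\qquad \lim_{R\to+\infty}\limsup_{\hbar\to0^+}\|\mathbf{1}_{[R,+\infty[}(-\hbar^2\Delta)\psi_\hbar\|_{L^2}=0.$$ Assume that for every $\Lambda\in\mathcal{L}_1$ there is a finite positive Radon measure $\mathbf{F}^0_\Lambda$ on $\mathbb{T}^2\times\mathbb{R}$ such that for every $a\in\mathcal{C}^\infty_c(\mathbb{T}^2\times\mathbb{R})$, $$\lim_{\hbar\to0^+}\Big\langle\psi_\hbar,\operatorname{Op}_\hbar\Big(\mathcal{I}_\Lambda(a)\Big(x,\tfrac{\hbar H_\Lambda(\xi)}{\varepsilon_\hbar}\Big)\Big)\psi_\hbar\Big\rangle=\int_{\mathbb{T}^2\times\mathbb{R}}a\,d\mathbf{F}^0_\Lambda .$$ Let $u_\hbar(t)$ solve $i\hbar\partial_t u_\hbar=-\frac{\hbar^2}{2}\Delta u_\hbar$, $u_\hbar(0)=\psi_\hbar$,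 and $u^\varepsilon_\hbar(t)$ solve $i\hbar\partial_t u^\varepsilon_\hbar=-\frac{\hbar^2}{2}\Delta u^\varepsilon_\hbar+\varepsilon_\hbar V u^\varepsilon_\hbar$, $u^\varepsilon_\hbar(0)=\psi_\hbar$, and set $\tau^c_\hbar=\hbar/\varepsilon_\hbar$. Then for every $t\in\mathbb{R}$, $$\lim_{\hbar\to0^+}\langle u^\varepsilon_\hbar(t\tau^c_\hbar),u_\hbar(t\tau^c_\hbar)\rangle=e^{it\int_{\mathbb{T}^2}V}\Big(1-\sum_{\Lambda\in\mathcal{L}_1}\mathbf{F}^0_\Lambda(\mathbb{T}^2\times\mathbb{R})\Big)+\sum_{\Lambda\in\mathcal{L}_1}\int_{\mathbb{T}^2\times\mathbb{R}}e^{i\int_0^t\mathcal{I}_\Lambda(V)\left(x+s\frac{\eta\vec v_\Lambda}{L_\Lambda}\right)ds}\,\mathbf{F}^0_\Lambda(dx,d\eta).$$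
   Context: $\mathbb{T}^2=\mathbb{R}^2/\mathbb{Z}^2$ with Lebesgue measure; $\langle u,v\rangle=\int_{\mathbb{T}^2}\overline{u}v\,dx$; $e_k(x)=e^{2i\pi k\cdot x}$ for $k\in\mathbb{Z}^2$. For a smooth symbol $a(x,\xi)$, $\mathbb{Z}^2$-periodic in $x$ with bounded derivatives, the standard quantization $\operatorname{Op}_\hbar(a)$ acts on $L^2(\mathbb{T}^2)$ by $\operatorname{Op}_\hbar(a)e_k=a(x,2\pi\hbar k)e_k$ (equivalently $\operatorname{Op}_\hbar(a)u(x)=(2\pi\hbar)^{-2}\iint e^{\frac{i}{\hbar}\langle x-y,\xi\rangle}a(x,\xi)u(y)\,dy\,d\xi$). $\mathcal{L}_1$ is the set of primitive rank-one sublattices $\Lambda$ of $\mathbb{Z}^2$ (i.e. $\Lambda=\mathbb{Z}\vec v_\Lambda$ with $\mathbb{R}\vec v_\Lambda\cap\mathbb{Z}^2=\Lambda$); for each such $\Lambda$ a generator $\vec v_\Lambda$ is fixed, $\vec v_\Lambda^\perp$ is $\vec v_\Lambda$ rotated by $+\pi/2$, $L_\Lambda=\|\vec v_\Lambda\|$, $H_\Lambda(\xi)=\langle\xi,\vec v_\Lambda\rangle/L_\Lambda$. For a function $b$ of $x$ (possibly depending on extra variables), $\mathcal{I}_\Lambda(b)(x,\cdot)=\frac{1}{L_\Lambda}\int_0^{L_\Lambda}b\big(x+t\vec v_\Lambda^\perp/L_\Lambda,\cdot\big)dt$. *)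

theory Defs
  imports "HOL-Analysis.Analysis"
begin

fun dd :: "('a::real_normed_vector \<Rightarrow> 'b::real_normed_vector) \<Rightarrow> 'a list \<Rightarrow> 'a \<Rightarrow> 'b" where
  "dd f [] = f"
| "dd f (v # vs) = (\<lambda>x. vector_derivative (\<lambda>t::real. dd f vs (x + t *\<^sub>R v)) (at 0))"

definition smooth :: "('a::real_normed_vector \<Rightarrow> 'b::real_normed_vector) \<Rightarrow> bool" where
  "smooth f \<longleftrightarrow> (\<forall>vs. continuous_on UNIV (dd f vs) \<and>
      (\<forall>v x. (\<lambda>t::real. dd f vs (x + t *\<^sub>R v)) differentiable (at 0)))"

section \<open>The torus T^2 = R^2 / Z^2, represented on the unit square\<close>

type_synonym pt = "real \<times> real"

definition zshift :: "int \<times> int \<Rightarrow> pt" where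
  "zshift m = (real_of_int (fst m), real_of_int (snd m))"

definition periodic :: "(pt \<Rightarrow> 'b) \<Rightarrow> bool" where
  "periodic f \<longleftrightarrow> (\<forall>x m. f (x + zshift m) = f x)"

definition usq :: "pt set" where
  "usq = cbox (0,0) (1,1)"

definition L2T :: "(pt \<Rightarrow> complex) \<Rightarrow> bool" where
  "L2T f \<longleftrightarrow> f \<in> borel_measurable (lebesgue_on usq) \<and>
      integrable (lebesgue_on usq) (\<lambda>x. (cmod (f x))\<^sup>2)"

definition innerT :: "(pt \<Rightarrow> complex) \<Rightarrow> (pt \<Rightarrow> complex) \<Rightarrow> complex" where
  "innerT u v = (LINT x | lebesgue_on usq. cnj (u x) * v x)"

definition normT :: "(pt \<Rightarrow> complex) \<Rightarrow> real" where
  "normT u = sqrt (LINT x | lebesgue_on usq. (cmod (u x))\<^sup>2)"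

definition ek :: "int \<times> int \<Rightarrow> pt \<Rightarrow> complex" where
  "ek k x = exp (2 * pi * \<i> * complex_of_real (real_of_int (fst k) * fst x + real_of_int (snd k) * snd x))"

definition fc :: "(pt \<Rightarrow> complex) \<Rightarrow> int \<times> int \<Rightarrow> complex" where
  "fc f k = innerT (ek k) f"

definition knorm2 :: "int \<times> int \<Rightarrow> real" where
  "knorm2 k = real_of_int (fst k)^2 + real_of_int (snd k)^2"

text \<open>Norm of 1_A(-h^2 Delta) f ;  -h^2 Delta e_k = 4 pi^2 h^2 |k|^2 e_k.\<close>
definition spec_norm :: "real \<Rightarrow> real set \<Rightarrow> (pt \<Rightarrow> complex) \<Rightarrow> real" where
  "spec_norm h A f = sqrt (\<Sum>\<^sub>\<infinity>k\<in>{k. 4 * pi^2 * h^2 * knorm2 k \<in> A}. (cmod (fc f k))\<^sup>2)"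

text \<open>Quadratic form <f, Op_h(b) f> of the standard quantization, Op_h(b) e_k = b(x, 2 pi h k) e_k,
  written through its matrix coefficients <e_j, Op_h(b) e_k> = hat b_{j-k}(2 pi h k).\<close>
definition sym_fc :: "(pt \<Rightarrow> pt \<Rightarrow> complex) \<Rightarrow> int \<times> int \<Rightarrow> pt \<Rightarrow> complex" where
  "sym_fc b m \<xi> = fc (\<lambda>x. b x \<xi>) m"

definition op_quad :: "real \<Rightarrow> (pt \<Rightarrow> pt \<Rightarrow> complex) \<Rightarrow> (pt \<Rightarrow> complex) \<Rightarrow> complex" where
  "op_quad h b f = (\<Sum>\<^sub>\<infinity>(j,k)\<in>UNIV. cnj (fc f j) * sym_fc b (j - k) ((2 * pi * h) *\<^sub>R zshift k) * fc f k)"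

definition primitive :: "int \<times> int \<Rightarrow> bool" where
  "primitive v \<longleftrightarrow> gcd (fst v) (snd v) = 1"

definition Lv :: "int \<times> int \<Rightarrow> real" where
  "Lv v = norm (zshift v)"

definition vperp :: "int \<times> int \<Rightarrow> int \<times> int" where
  "vperp v = (- snd v, fst v)"

definition Hv :: "int \<times> int \<Rightarrow> pt \<Rightarrow> real" where
  "Hv v \<xi> = (\<xi> \<bullet> zshift v) / Lv v"

definition Iv :: "int \<times> int \<Rightarrow> (pt \<Rightarrow> 'c \<Rightarrow> 'b::{banach, second_countable_topology}) \<Rightarrow> pt \<Rightarrow> 'c \<Rightarrow> 'b" where
  "Iv v b x y = (1 / Lv v) *\<^sub>R (LBINT t=0..Lv v. b (x + (t / Lv v) *\<^sub>R zshift (vperp v)) y)"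

definition Iv0 :: "int \<times> int \<Rightarrow> (pt \<Rightarrow> real) \<Rightarrow> pt \<Rightarrow> real" where
  "Iv0 v V x = (1 / Lv v) * (LBINT t=0..Lv v. V (x + (t / Lv v) *\<^sub>R zshift (vperp v)))"

text \<open>u solves  i h d/dt u = -(h^2/2) Delta u + c V u : u(t) in L^2, continuous in t for the L^2 norm,
  and each Fourier coefficient satisfies the equation tested against e_k.\<close>
definition schr_sol :: "real \<Rightarrow> real \<Rightarrow> (pt \<Rightarrow> real) \<Rightarrow> (real \<Rightarrow> pt \<Rightarrow> complex) \<Rightarrow> bool" where
  "schr_sol h c V u \<longleftrightarrow>
     (\<forall>t. L2T (u t)) \<and>
     (\<forall>t. ((\<lambda>s. normT (\<lambda>x. u s x - u t x)) \<longlongrightarrow> 0) (at t)) \<and>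
     (\<forall>k t. ((\<lambda>s::real. fc (u s) k) has_vector_derivative
          (- \<i> / complex_of_real h) * (complex_of_real (2 * pi^2 * h^2 * knorm2 k) * fc (u t) k
             + complex_of_real c * fc (\<lambda>x. complex_of_real (V x) * u t x) k)) (at t))"

end

theory Submission
  imports Defs
begin

text \<open>
  In the interaction picture, on the time scale h / \<open>\<epsilon>\<close>, the Fourier coefficients of the perturbed
  solution satisfy W' k = \<open>\<Sum>\<close>m. c m * cis (s * \<open>\<theta>\<close> m (k - m)) * W (k - m), where c m is - i T times the
  m-th Fourier coefficient of V and \<open>\<theta>\<close> is T times a difference of eigenvalues of the Laplacian.
  Since the coefficients of V are absolutely summable, the scalar product is, uniformly in h, a sum
  over finite words of frequencies of sesquilinear forms in the initial datum, weighted by iterated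
  oscillatory integrals. The phase of a letter m at k is (h^2 / \<open>\<epsilon>\<close>) 4 \<open>\<pi>\<close>^2 k . m up to an error tending
  to 0, so a word is negligible away from the strips where all of its letters are resonant. Two
  non-parallel letters are both resonant only where h |k| tends to 0, which is excluded by the
  assumption on low frequencies; the same remark bounds the total mass of the measures F by 1.
  A word whose letters all lie on one line converges to an integral against the corresponding
  measure, and resumming these words gives the exponential of the averaged potential, while the
  words whose letters all vanish give the exponential of the mean of V.
\<close>

section \<open>Fourier analysis on the torus\<close>

text \<open>The measures are tested only against compactly supported functions of eta = h H /
  \<epsilon>, so mass may escape to infinity in eta, and a word can be compared with them only if
  its profile in eta vanishes at infinity. One nonzero letter provides this decay through an
  integration by parts. Words of zero letters have no decay, but they are constant and are evaluated
  by the normalization of the datum. Hence the shape of the limit: all mass feels the mean of V, and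
  each measure contributes the difference between its own exponential and that of the mean, which is
  where 1 minus the total mass comes from. Limits are never exchanged with infinite sums of words.
  One finite alphabet and one maximal length serve the quantum evolution for every h and the
  classical exponentials for every direction and every point, with the same bound on the error. The
  bound on the total mass then keeps the sum of the errors over all directions finite. The expansion
  is made for the product with the free solution on the left, which gives factors exp(-i ...); the
  stated limit follows by conjugation.\<close>

abbreviation MT :: "pt measure" where "MT \<equiv> lebesgue_on usq"

section \<open>Lebesgue integration on the unit square\<close>

lemma usq_lebesgue [simp]: "usq \<in> sets lebesgue"
  by (simp add: usq_def)

lemma usq_lmeasurable: "usq \<in> lmeasurable"
  by (simp add: usq_def)

lemma measure_usq: "measure lebesgue usq = 1"
  by (simp add: usq_def content_Pair)

lemma finite_measure_MT: "finite_measure MT"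
  by (rule finite_measure_lebesgue_on[OF usq_lmeasurable])

lemma measure_MT: "measure MT usq = 1"
  by (simp add: measure_restrict_space measure_usq)

lemma LINT_MT_const [simp]: "(LINT x|MT. (c::'b::{banach,second_countable_topology})) = c"
proof -
  interpret finite_measure MT by (rule finite_measure_MT)
  show ?thesis using lebesgue_integral_const[of MT c] by (simp add: measure_MT)
qed

lemma continuous_measurable_MT:
  fixes f :: "pt \<Rightarrow> 'b::euclidean_space"
  assumes "continuous_on usq f" shows "f \<in> borel_measurable MT"
  using continuous_imp_measurable_on_sets_lebesgue[OF assms] by simp

lemma integrable_MT_bounded:
  fixes f :: "pt \<Rightarrow> 'b::euclidean_space"
  assumes "f \<in> borel_measurable MT" "\<And>x. x \<in> usq \<Longrightarrow> norm (f x) \<le> B"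
  shows "integrable MT f"
proof -
  interpret finite_measure MT by (rule finite_measure_MT)
  show ?thesis
    by (rule integrable_const_bound[of _ B]) (use assms in auto)
qed

lemma continuous_integrable_MT:
  fixes f :: "pt \<Rightarrow> 'b::euclidean_space"
  assumes "continuous_on usq f" shows "integrable MT f"
  using continuous_imp_integrable[of "(0,0)" "(1,1)" f] assms by (simp add: usq_def)

text \<open>Both orders are needed because a derivative in one coordinate is integrated first in
  that coordinate.\<close>

lemma LINT_MT_iterated:
  fixes f :: "pt \<Rightarrow> 'b::euclidean_space"
  assumes f: "continuous_on usq f"
  shows "(LINT x|MT. f x) = integral {0..1} (\<lambda>x. integral {0..1} (\<lambda>y. f (x,y)))"
    and "(LINT x|MT. f x) = integral {0..1} (\<lambda>y. integral {0..1} (\<lambda>x. f (x,y)))"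
proof -
  have 1: "(LINT x|MT. f x) = integral (cbox (0,0) (1,1)) f"
    using lebesgue_integral_eq_integral[OF continuous_integrable_MT[OF f]] by (simp add: usq_def)
  then show A: "(LINT x|MT. f x) = integral {0..1} (\<lambda>x. integral {0..1} (\<lambda>y. f (x,y)))"
    using integral_prod_continuous[of 0 0 1 1 f] f by (simp add: usq_def)
  show "(LINT x|MT. f x) = integral {0..1} (\<lambda>y. integral {0..1} (\<lambda>x. f (x,y)))"
    unfolding A using integral_swap_continuous[of 0 0 1 1 "\<lambda>x y. f (x,y)"] f
    by (simp add: usq_def)
qed

lemma periodic_shift_fst: assumes "periodic f" shows "f (1, y) = f (0, y)"
proof -
  have "f ((0, y) + zshift (1, 0)) = f (0, y)" using assms unfolding periodic_def by blast
  then show ?thesis by (simp add: zshift_def)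
qed

lemma periodic_shift_snd: assumes "periodic f" shows "f (x, 1) = f (x, 0)"
proof -
  have "f ((x, 0) + zshift (0, 1)) = f (x, 0)" using assms unfolding periodic_def by blast
  then show ?thesis by (simp add: zshift_def)
qed

text \<open>Integration by parts on the torus: along \<open>v\<close> the fundamental theorem leaves
  only boundary values, and these agree by periodicity.\<close>

lemma integral_deriv_periodic:
  fixes F G :: "pt \<Rightarrow> complex"
  assumes per: "periodic F" and G: "continuous_on UNIV G"
    and d: "\<And>x. ((\<lambda>t::real. F (x + t *\<^sub>R v)) has_vector_derivative G x) (at 0)"
    and v: "v = (1,0) \<or> v = (0,1)"
  shows "(LINT x|MT. G x) = 0"
proof -
  have Gc: "continuous_on usq G" using G continuous_on_subset by blast
  \<comment> \<open>The derivative is given at t = 0 only, but for every base point; moving the base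
    point along \<open>v\<close> yields it at every \<open>s\<close>.\<close>
  have d': "((\<lambda>t::real. F (x + t *\<^sub>R v)) has_vector_derivative G (x + s *\<^sub>R v)) (at s)" for x s
  proof -
    have "((\<lambda>t. F ((x + s *\<^sub>R v) + t *\<^sub>R v)) has_vector_derivative G (x + s *\<^sub>R v)) (at (s - s))"
      using d by simp
    then have "((\<lambda>t. F ((x + s *\<^sub>R v) + t *\<^sub>R v)) \<circ> (\<lambda>t. t - s) has_vector_derivative 1 *\<^sub>R G (x + s *\<^sub>R v)) (at s)"
      by (intro vector_diff_chain_at) (auto intro!: derivative_eq_intros)
    then show ?thesis by (simp add: o_def algebra_simps)
  qed
  from v show ?thesis
  proof
    assume v: "v = (1,0)"
    have "integral {0..1} (\<lambda>x. G (x,y)) = 0" for y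
    proof -
      have "((\<lambda>x. G (x,y)) has_integral F (1,y) - F (0,y)) {0..1}"
        by (rule fundamental_theorem_of_calculus)
          (use d'[of "(0,y)"] v in \<open>auto intro: has_vector_derivative_at_within\<close>)
      then show ?thesis using periodic_shift_fst[OF per] by (simp add: integral_unique)
    qed
    then show ?thesis using LINT_MT_iterated(2)[OF Gc] by simp
  next
    assume v: "v = (0,1)"
    have "integral {0..1} (\<lambda>y. G (x,y)) = 0" for x
    proof -
      have "((\<lambda>y. G (x,y)) has_integral F (x,1) - F (x,0)) {0..1}"
        by (rule fundamental_theorem_of_calculus)
          (use d'[of "(x,0)"] v in \<open>auto intro: has_vector_derivative_at_within\<close>)
      then show ?thesis using periodic_shift_snd[OF per] by (simp add: integral_unique)
    qed
    then show ?thesis using LINT_MT_iterated(1)[OF Gc] by simp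
  qed
qed

section \<open>Characters of the torus\<close>

lemma zshift_add: "zshift (j + k) = zshift j + zshift k"
  by (simp add: zshift_def)

lemma zshift_minus: "zshift (- k) = - zshift k"
  by (simp add: zshift_def)

lemma zshift_0 [simp]: "zshift 0 = 0"
  by (simp add: zshift_def zero_prod_def)

lemma ek_cis: "ek k x = cis (2 * pi * (zshift k \<bullet> x))"
  by (simp add: ek_def cis_conv_exp zshift_def inner_prod_def algebra_simps)

lemma ek_add: "ek (j + k) x = ek j x * ek k x"
  by (simp add: ek_cis zshift_add cis_mult algebra_simps)

lemma ek_minus: "ek (- k) x = cnj (ek k x)"
  by (simp add: ek_cis zshift_minus cis_cnj)

lemma ek_0 [simp]: "ek 0 x = 1"
  by (simp add: ek_cis)

lemma norm_ek [simp]: "cmod (ek k x) = 1"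
  by (simp add: ek_cis)

lemma ek_shift: "ek k (x + y) = ek k x * ek k y"
  by (simp add: ek_cis cis_mult inner_add_right algebra_simps)

lemma continuous_ek [continuous_intros]: "continuous_on A (ek k)"
  unfolding ek_cis by (intro continuous_intros)

lemma ek_zshift [simp]: "ek k (zshift m) = 1"
proof -
  have "zshift k \<bullet> zshift m = real_of_int (fst k * fst m + snd k * snd m)"
    by (simp add: zshift_def inner_prod_def)
  then show ?thesis unfolding ek_cis
    using cis_multiple_2pi[of "zshift k \<bullet> zshift m"] by simp
qed

lemma periodic_ek: "periodic (ek k)"
  by (simp add: periodic_def ek_shift)

lemma ek_has_vector_derivative:
  "((\<lambda>t::real. ek k (x + t *\<^sub>R v)) has_vector_derivative 
     2 * pi * \<i> * complex_of_real (zshift k \<bullet> v) * ek k (x + s *\<^sub>R v)) (at s within A)"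
proof -
  have *: "ek k (x + t *\<^sub>R v) = exp (\<i> * complex_of_real (2 * pi * (zshift k \<bullet> x) + 2 * pi * (zshift k \<bullet> v) * t))" for t
    by (simp add: ek_cis cis_conv_exp inner_add_right algebra_simps)
  let ?f = "\<lambda>z. exp (\<i> * (complex_of_real (2 * pi * (zshift k \<bullet> x)) + complex_of_real (2 * pi * (zshift k \<bullet> v)) * z))"
  have "(?f has_field_derivative 2 * pi * \<i> * complex_of_real (zshift k \<bullet> v) * ?f (complex_of_real s)) (at (complex_of_real s))"
    by (auto intro!: derivative_eq_intros)
  from has_vector_derivative_real_field[OF this, of A] show ?thesis 
    unfolding * by simp
qed

text \<open>A nonzero frequency has a nonzero coordinate; in that direction the character is a
  multiple of its own derivative, whose integral vanishes.\<close>

lemma LINT_ek: "(LINT x|MT. ek k x) = (if k = 0 then 1 else 0)"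
proof (cases "k = 0")
  case False
  then obtain v where v: "v = (1,0) \<or> v = (0,1)" and nz: "zshift k \<bullet> v \<noteq> (0::real)"
    by (cases k) (force simp: zshift_def inner_prod_def zero_prod_def)
  have "(LINT x|MT. 2 * pi * \<i> * complex_of_real (zshift k \<bullet> v) * ek k x) = 0"
    by (rule integral_deriv_periodic[OF periodic_ek _ _ v])
      (use ek_has_vector_derivative[of k _ v 0 UNIV] in \<open>auto intro!: continuous_intros\<close>)
  then show ?thesis using nz False by simp
next
  case True
  then show ?thesis using LINT_MT_const[of "1::complex"] by (simp add: True ek_0[abs_def])
qed

section \<open>The inner product of L2 and Bessel's inequality\<close>

lemma norm_sum_L2: "cmod (\<Sum>k\<in>K. a k * b k) \<le> sqrt (\<Sum>k\<in>K. (cmod (a k))\<^sup>2) * sqrt (\<Sum>k\<in>K. (cmod (b k))\<^sup>2)"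
proof -
  have "cmod (\<Sum>k\<in>K. a k * b k) \<le> (\<Sum>k\<in>K. \<bar>cmod (a k)\<bar> * \<bar>cmod (b k)\<bar>)"
    by (rule sum_norm_le) (simp add: norm_mult)
  also have "\<dots> \<le> L2_set (\<lambda>k. cmod (a k)) K * L2_set (\<lambda>k. cmod (b k)) K"
    by (rule L2_set_mult_ineq)
  finally show ?thesis by (simp add: L2_set_def)
qed

lemma L2T_measurable: "L2T f \<Longrightarrow> f \<in> borel_measurable MT"
  by (simp add: L2T_def)

lemma measurable_cnj [measurable (raw)]:
  "f \<in> borel_measurable M \<Longrightarrow> (\<lambda>x. cnj (f x)) \<in> borel_measurable M"
  by (rule measurable_compose[of f M borel cnj]) 
    (auto intro!: borel_measurable_continuous_onI continuous_intros)

lemma L2T_integrable_mult: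
  assumes "L2T f" "L2T g" shows "integrable MT (\<lambda>x. cnj (f x) * g x)"
proof -
  have [measurable]: "f \<in> borel_measurable MT" "g \<in> borel_measurable MT"
    using assms by (auto simp: L2T_def)
  have "integrable MT (\<lambda>x. (cmod (f x))\<^sup>2 + (cmod (g x))\<^sup>2)"
    using assms by (auto simp: L2T_def)
  then show ?thesis
  proof (rule Bochner_Integration.integrable_bound)
    show "AE x in MT. norm (cnj (f x) * g x) \<le> norm ((cmod (f x))\<^sup>2 + (cmod (g x))\<^sup>2)"
    proof (rule AE_I2)
      fix x
      have "2 * cmod (f x) * cmod (g x) \<le> (cmod (f x))\<^sup>2 + (cmod (g x))\<^sup>2"
        by (rule sum_squares_bound)
      moreover have "0 \<le> cmod (f x) * cmod (g x)" by simp
      ultimately show "norm (cnj (f x) * g x) \<le> norm ((cmod (f x))\<^sup>2 + (cmod (g x))\<^sup>2)"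
        unfolding norm_mult complex_mod_cnj real_norm_def by linarith
    qed
  qed measurable
qed

lemma L2T_add:
  assumes "L2T f" "L2T g" shows "L2T (\<lambda>x. f x + g x)"
proof -
  have [measurable]: "f \<in> borel_measurable MT" "g \<in> borel_measurable MT"
    using assms by (auto simp: L2T_def)
  have "integrable MT (\<lambda>x. 2 * (cmod (f x))\<^sup>2 + 2 * (cmod (g x))\<^sup>2)"
    using assms by (auto simp: L2T_def)
  then have "integrable MT (\<lambda>x. (cmod (f x + g x))\<^sup>2)"
  proof (rule Bochner_Integration.integrable_bound)
    show "AE x in MT. norm ((cmod (f x + g x))\<^sup>2) \<le> norm (2 * (cmod (f x))\<^sup>2 + 2 * (cmod (g x))\<^sup>2)"
    proof (rule AE_I2)
      fix x
      have "(cmod (f x + g x))\<^sup>2 \<le> (cmod (f x) + cmod (g x))\<^sup>2"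
        by (intro power_mono norm_triangle_ineq) simp
      also have "\<dots> \<le> 2 * (cmod (f x))\<^sup>2 + 2 * (cmod (g x))\<^sup>2"
        using sum_squares_bound[of "cmod (f x)" "cmod (g x)"] by (simp add: power2_sum)
      finally show "norm ((cmod (f x + g x))\<^sup>2) \<le> norm (2 * (cmod (f x))\<^sup>2 + 2 * (cmod (g x))\<^sup>2)"
        by simp
    qed
  qed measurable
  then show ?thesis by (simp add: L2T_def)
qed

lemma L2T_bounded_mult:
  assumes g: "L2T g" and f: "f \<in> borel_measurable MT" "\<And>x. x \<in> usq \<Longrightarrow> cmod (f x) \<le> B"
  shows "L2T (\<lambda>x. f x * g x)"
proof -
  have [measurable]: "f \<in> borel_measurable MT" "g \<in> borel_measurable MT"
    using assms by (auto simp: L2T_def)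
  have "integrable MT (\<lambda>x. B\<^sup>2 * (cmod (g x))\<^sup>2)"
    using assms by (auto simp: L2T_def)
  then have "integrable MT (\<lambda>x. (cmod (f x * g x))\<^sup>2)"
  proof (rule Bochner_Integration.integrable_bound)
    show "AE x in MT. norm ((cmod (f x * g x))\<^sup>2) \<le> norm (B\<^sup>2 * (cmod (g x))\<^sup>2)"
    proof (rule AE_I2)
      fix x assume x: "x \<in> space MT"
      then have "(cmod (f x))\<^sup>2 \<le> B\<^sup>2" using f(2)[of x] by (intro power_mono) auto
      then have "(cmod (f x))\<^sup>2 * (cmod (g x))\<^sup>2 \<le> B\<^sup>2 * (cmod (g x))\<^sup>2"
        by (intro mult_right_mono) auto
      then show "norm ((cmod (f x * g x))\<^sup>2) \<le> norm (B\<^sup>2 * (cmod (g x))\<^sup>2)"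
        by (simp add: norm_mult power_mult_distrib)
    qed
  qed measurable
  then show ?thesis by (simp add: L2T_def)
qed

lemma L2T_cmult: "L2T f \<Longrightarrow> L2T (\<lambda>x. c * f x)"
  using L2T_bounded_mult[of f "\<lambda>_. c" "cmod c"] by simp

lemma L2T_diff: "L2T f \<Longrightarrow> L2T g \<Longrightarrow> L2T (\<lambda>x. f x - g x)"
  using L2T_add[of f "\<lambda>x. -1 * g x"] L2T_cmult[of g "-1"] by simp

lemma L2T_bounded:
  assumes "f \<in> borel_measurable MT" "\<And>x. x \<in> usq \<Longrightarrow> cmod (f x) \<le> B" shows "L2T f"
proof -
  have "L2T (\<lambda>x. 1)" by (auto simp: L2T_def intro: integrable_MT_bounded)
  from L2T_bounded_mult[OF this assms] show ?thesis by simp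
qed

lemma L2T_continuous: assumes "continuous_on usq f" shows "L2T f"
proof -
  have "compact (f ` usq)" by (rule compact_continuous_image[OF assms]) (simp add: usq_def)
  then have "bounded (f ` usq)" by (rule compact_imp_bounded)
  then obtain B where "\<And>x. x \<in> usq \<Longrightarrow> cmod (f x) \<le> B"
    unfolding bounded_iff by blast
  then show ?thesis by (intro L2T_bounded continuous_measurable_MT assms)
qed

lemma L2T_ek [simp]: "L2T (ek k)"
  by (intro L2T_continuous continuous_intros)

lemma L2T_sum: "(\<And>i. i \<in> I \<Longrightarrow> L2T (f i)) \<Longrightarrow> L2T (\<lambda>x. \<Sum>i\<in>I. f i x)"
proof (induction I rule: infinite_finite_induct)
  case (insert i I)
  then show ?case by (auto intro!: L2T_add)
qed (use L2T_bounded[of "\<lambda>_. 0" 0] in auto)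

lemma innerT_add_right: "L2T f \<Longrightarrow> L2T g \<Longrightarrow> L2T g' \<Longrightarrow> innerT f (\<lambda>x. g x + g' x) = innerT f g + innerT f g'"
  unfolding innerT_def by (simp add: distrib_left L2T_integrable_mult Bochner_Integration.integral_add)

lemma innerT_cmult_right: "innerT f (\<lambda>x. c * g x) = c * innerT f g"
  unfolding innerT_def by (simp add: mult.left_commute)

lemma innerT_commute: "innerT g f = cnj (innerT f g)"
  unfolding innerT_def by (subst Bochner_Integration.integral_cnj[symmetric]) (simp add: mult.commute)

lemma innerT_add_left: "L2T f \<Longrightarrow> L2T g \<Longrightarrow> L2T g' \<Longrightarrow> innerT (\<lambda>x. g x + g' x) f = innerT g f + innerT g' f"
  by (subst (1 2 3) innerT_commute) (simp add: innerT_add_right)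

lemma innerT_cmult_left: "innerT (\<lambda>x. c * f x) g = cnj c * innerT f g"
  by (subst (1 2) innerT_commute) (simp add: innerT_cmult_right)

lemma innerT_sum_right: 
  "L2T f \<Longrightarrow> (\<And>i. i \<in> I \<Longrightarrow> L2T (g i)) \<Longrightarrow> innerT f (\<lambda>x. \<Sum>i\<in>I. g i x) = (\<Sum>i\<in>I. innerT f (g i))"
proof (induction I rule: infinite_finite_induct)
  case (insert i I)
  then show ?case by (simp add: innerT_add_right L2T_sum)
qed (auto simp: innerT_def)

lemma innerT_self: "innerT f f = complex_of_real (LINT x|MT. (cmod (f x))\<^sup>2)"
proof -
  have "innerT f f = (LINT x|MT. complex_of_real ((cmod (f x))\<^sup>2))"
    unfolding innerT_def by (rule Bochner_Integration.integral_cong) (simp_all add: complex_norm_square mult.commute del: of_real_power)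
  then show ?thesis by (simp del: of_real_power)
qed

lemma normT_sq: "(normT f)\<^sup>2 = (LINT x|MT. (cmod (f x))\<^sup>2)"
  unfolding normT_def by (simp add: integral_nonneg_AE)

lemma innerT_self_normT: "innerT f f = complex_of_real ((normT f)\<^sup>2)"
  by (simp only: innerT_self normT_sq)

lemma normT_nonneg [simp]: "0 \<le> normT f"
  unfolding normT_def by (simp add: integral_nonneg_AE)

lemma innerT_ek: "innerT (ek j) (ek k) = (if j = k then 1 else 0)"
proof -
  have "innerT (ek j) (ek k) = (LINT x|MT. ek (- j + k) x)"
    unfolding innerT_def ek_add ek_minus ..
  then show ?thesis by (auto simp: LINT_ek add_eq_0_iff)
qed

lemma fc_add: "L2T f \<Longrightarrow> L2T g \<Longrightarrow> fc (\<lambda>x. f x + g x) k = fc f k + fc g k"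
  by (simp add: fc_def innerT_add_right)

lemma fc_cmult: "fc (\<lambda>x. c * f x) k = c * fc f k"
  by (simp add: fc_def innerT_cmult_right)

lemma fc_ek: "fc (ek m) k = (if k = m then 1 else 0)"
  by (simp add: fc_def innerT_ek)

lemma fc_ek_mult: "fc (\<lambda>x. ek m x * f x) k = fc f (k - m)"
proof -
  have "cnj (ek k x) * (ek m x * f x) = cnj (ek (k - m) x) * f x" for x
  proof -
    have "ek (k - m) x = ek k x * cnj (ek m x)" by (simp add: ek_add ek_minus diff_conv_add_uminus del: add_uminus_conv_diff)
    then show ?thesis by simp
  qed
  then show ?thesis unfolding fc_def innerT_def by presburger
qed

text \<open>Completing the square. The choice \<open>c = fc f\<close> gives Bessel's inequality; for
  general \<open>c\<close> the last sum is nonnegative, so no polynomial with frequencies in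
  \<open>K\<close> beats the Fourier partial sum, which is the form needed for Parseval's
  identity.\<close>

lemma normT_sq_diff_trig:
  assumes f: "L2T f" and K: "finite K"
  shows "(normT (\<lambda>x. f x - (\<Sum>k\<in>K. c k * ek k x)))\<^sup>2 =
    (normT f)\<^sup>2 - (\<Sum>k\<in>K. (cmod (fc f k))\<^sup>2) + (\<Sum>k\<in>K. (cmod (fc f k - c k))\<^sup>2)"
proof -
  define p where "p = (\<lambda>x. \<Sum>k\<in>K. c k * ek k x)"
  have p: "L2T p" unfolding p_def by (intro L2T_sum L2T_cmult L2T_ek)
  have pp: "innerT (ek j) p = (if j \<in> K then c j else 0)" for j
    unfolding p_def using K by (simp add: innerT_sum_right L2T_cmult innerT_cmult_right innerT_ek if_distrib[of "(*) _"] sum.delta cong: if_cong)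
  have 1: "innerT f p = (\<Sum>k\<in>K. c k * cnj (fc f k))"
    unfolding p_def fc_def innerT_commute[symmetric] using f by (simp add: innerT_sum_right L2T_cmult innerT_cmult_right)
  have 2: "innerT p p = (\<Sum>k\<in>K. c k * cnj (c k))"
  proof -
    have "innerT p (\<lambda>x. \<Sum>k\<in>K. c k * ek k x) = (\<Sum>k\<in>K. c k * cnj (innerT (ek k) p))"
      unfolding innerT_commute[symmetric] using p by (simp add: innerT_sum_right L2T_cmult innerT_cmult_right)
    then show ?thesis by (simp add: pp flip: p_def)
  qed
  have "innerT (\<lambda>x. f x - p x) (\<lambda>x. f x - p x) = innerT f f - innerT f p - cnj (innerT f p) + innerT p p"
  proof -
    have d: "(\<lambda>x. f x - p x) = (\<lambda>x. f x + (-1) * p x)" by auto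
    show ?thesis unfolding d
      using f p by (simp only: innerT_add_right innerT_add_left L2T_cmult L2T_add innerT_cmult_right innerT_cmult_left)
        (simp add: algebra_simps innerT_commute[of p f] del: of_real_power)
  qed
  also have "\<dots> = complex_of_real ((normT f)\<^sup>2 - (\<Sum>k\<in>K. (cmod (fc f k))\<^sup>2) + (\<Sum>k\<in>K. (cmod (fc f k - c k))\<^sup>2))"
    unfolding 1 2 innerT_self_normT[of f]
    by (simp add: complex_norm_square sum_subtractf sum.distrib algebra_simps del: of_real_power)
  finally have "complex_of_real ((normT (\<lambda>x. f x - p x))\<^sup>2) = complex_of_real ((normT f)\<^sup>2 - (\<Sum>k\<in>K. (cmod (fc f k))\<^sup>2) + (\<Sum>k\<in>K. (cmod (fc f k - c k))\<^sup>2))"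
    by (simp only: innerT_self_normT)
  then show ?thesis unfolding p_def by (simp only: of_real_eq_iff)
qed

lemma bessel:
  assumes f: "L2T f" and K: "finite K"
  shows "(\<Sum>k\<in>K. (cmod (fc f k))\<^sup>2) \<le> (normT f)\<^sup>2"
proof -
  have "0 \<le> (normT f)\<^sup>2 - (\<Sum>k\<in>K. (cmod (fc f k))\<^sup>2)"
    using normT_sq_diff_trig[OF assms, of "fc f"] 
      zero_le_power2[of "normT (\<lambda>x. f x - (\<Sum>k\<in>K. fc f k * ek k x))"] by simp
  then show ?thesis by simp
qed

lemma normT_sq_add_le:
  assumes f: "L2T f" and g: "L2T g"
  shows "(normT (\<lambda>x. f x + g x))\<^sup>2 \<le> 2 * (normT f)\<^sup>2 + 2 * (normT g)\<^sup>2"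
proof -
  have i: "integrable MT (\<lambda>x. (cmod (f x))\<^sup>2)" "integrable MT (\<lambda>x. (cmod (g x))\<^sup>2)"
    "integrable MT (\<lambda>x. (cmod (f x + g x))\<^sup>2)"
    using f g L2T_add[OF f g] by (auto simp: L2T_def)
  have "(LINT x|MT. (cmod (f x + g x))\<^sup>2) \<le> (LINT x|MT. 2 * (cmod (f x))\<^sup>2 + 2 * (cmod (g x))\<^sup>2)"
  proof (rule integral_mono)
    fix x
    have "(cmod (f x + g x))\<^sup>2 \<le> (cmod (f x) + cmod (g x))\<^sup>2"
      by (intro power_mono norm_triangle_ineq) simp
    also have "\<dots> \<le> 2 * (cmod (f x))\<^sup>2 + 2 * (cmod (g x))\<^sup>2"
      using sum_squares_bound[of "cmod (f x)" "cmod (g x)"] by (simp add: power2_sum)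
    finally show "(cmod (f x + g x))\<^sup>2 \<le> 2 * (cmod (f x))\<^sup>2 + 2 * (cmod (g x))\<^sup>2" .
  qed (use i in auto)
  then show ?thesis using i by (simp add: normT_sq)
qed

lemma normT_sq_cmult: "(normT (\<lambda>x. c * f x))\<^sup>2 = (cmod c)\<^sup>2 * (normT f)\<^sup>2"
  by (simp add: normT_sq norm_mult power_mult_distrib)

section \<open>Density of trigonometric polynomials in L2\<close>

inductive trig :: "(pt \<Rightarrow> complex) \<Rightarrow> bool" where
  trig_ek: "trig (ek k)"
| trig_add: "trig p \<Longrightarrow> trig q \<Longrightarrow> trig (\<lambda>x. p x + q x)"
| trig_cmult: "trig p \<Longrightarrow> trig (\<lambda>x. c * p x)"

lemma trig_mult:
  assumes "trig p" "trig q" shows "trig (\<lambda>x. p x * q x)"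
  using assms(1)
proof induction
  case (trig_ek k)
  from assms(2) show ?case
  proof induction
    case (trig_ek j)
    have "(\<lambda>x. ek k x * ek j x) = ek (k + j)" by (simp add: ek_add fun_eq_iff)
    then show ?case using trig.trig_ek by simp
  next
    case (trig_add p q)
    then show ?case using trig.trig_add by (simp add: distrib_left)
  next
    case (trig_cmult p c)
    then show ?case using trig.trig_cmult by (simp add: mult.left_commute)
  qed
next
  case (trig_add p q)
  then show ?case using trig.trig_add by (simp add: distrib_right)
next
  case (trig_cmult p c)
  then show ?case using trig.trig_cmult by (simp add: mult.assoc)
qed

lemma trig_const: "trig (\<lambda>x. c)"
  using trig_cmult[OF trig_ek, of c 0] by simp

lemma trig_sum_rep:
  assumes "trig p" shows "\<exists>K c. finite K \<and> p = (\<lambda>x. \<Sum>k\<in>K. c k * ek k x)"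
  using assms
proof induction
  case (trig_ek k)
  show ?case by (rule exI[of _ "{k}"], rule exI[of _ "\<lambda>_. 1"]) auto
next
  case (trig_add p q)
  then obtain K c L d where K: "finite K" "p = (\<lambda>x. \<Sum>k\<in>K. c k * ek k x)"
    and L: "finite L" "q = (\<lambda>x. \<Sum>k\<in>L. d k * ek k x)" by blast
  have "p x + q x = (\<Sum>k\<in>K\<union>L. ((if k \<in> K then c k else 0) + (if k \<in> L then d k else 0)) * ek k x)" for x
  proof -
    have "p x = (\<Sum>k\<in>K\<union>L. (if k \<in> K then c k else 0) * ek k x)"
      unfolding K(2) using K L by (intro sum.mono_neutral_cong_left) auto
    moreover have "q x = (\<Sum>k\<in>K\<union>L. (if k \<in> L then d k else 0) * ek k x)"
      unfolding L(2) using K L by (intro sum.mono_neutral_cong_left) auto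
    ultimately show ?thesis by (simp add: distrib_right sum.distrib)
  qed
  then show ?case using K L by (intro exI[of _ "K\<union>L"] exI) (auto simp: fun_eq_iff)
next
  case (trig_cmult p c)
  then obtain K d where K: "finite K" "p = (\<lambda>x. \<Sum>k\<in>K. d k * ek k x)" by blast
  then show ?case
    by (intro exI[of _ "K"] exI[of _ "\<lambda>k. c * d k"]) (auto simp: sum_distrib_left mult.assoc)
qed

lemma L2T_trig: "trig p \<Longrightarrow> L2T p"
  by (induction rule: trig.induct) (auto intro: L2T_add L2T_cmult)

text \<open>The distance is squared because \<open>normT_sq_add_le\<close>, with its factor 2,
  replaces the triangle inequality, which is derived from Parseval's identity in
  \<open>normT_triangle\<close>. This is the origin of the thresholds \<open>e/4\<close>.\<close>

definition trig_closure :: "(pt \<Rightarrow> complex) \<Rightarrow> bool" where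
  "trig_closure f \<longleftrightarrow> L2T f \<and> (\<forall>e>0. \<exists>p. trig p \<and> (normT (\<lambda>x. f x - p x))\<^sup>2 < e)"

lemma trig_closure_L2T: "trig_closure f \<Longrightarrow> L2T f" by (simp add: trig_closure_def)

lemma normT_sq_zero [simp]: "normT (\<lambda>x. 0) = 0"
  by (simp add: normT_def)

lemma trig_closure_trig: "trig p \<Longrightarrow> trig_closure p"
  unfolding trig_closure_def by (auto intro: L2T_trig exI[of _ p])

lemma trig_closure_approx:
  assumes f: "L2T f" and a: "\<And>e. e > 0 \<Longrightarrow> \<exists>g. trig_closure g \<and> (normT (\<lambda>x. f x - g x))\<^sup>2 < e"
  shows "trig_closure f"
  unfolding trig_closure_def
proof (intro conjI f allI impI)
  fix e :: real assume "e > 0"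
  then obtain g where g: "trig_closure g" "(normT (\<lambda>x. f x - g x))\<^sup>2 < e/4" using a[of "e/4"] by auto
  have e4: "e/4 > 0" using \<open>e > 0\<close> by simp
  then obtain p where p: "trig p" "(normT (\<lambda>x. g x - p x))\<^sup>2 < e/4" 
    using g(1) unfolding trig_closure_def by blast
  have "(normT (\<lambda>x. (f x - g x) + (g x - p x)))\<^sup>2 \<le> 2 * (normT (\<lambda>x. f x - g x))\<^sup>2 + 2 * (normT (\<lambda>x. g x - p x))\<^sup>2"
    by (intro normT_sq_add_le L2T_diff f trig_closure_L2T[OF g(1)] L2T_trig[OF p(1)])
  also have "\<dots> < e" using g(2) p(2) by simp
  finally show "\<exists>p. trig p \<and> (normT (\<lambda>x. f x - p x))\<^sup>2 < e" using p(1) by auto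
qed

lemma trig_closure_add: assumes f: "trig_closure f" and g: "trig_closure g" shows "trig_closure (\<lambda>x. f x + g x)"
  unfolding trig_closure_def
proof (intro conjI L2T_add trig_closure_L2T assms allI impI)
  fix e :: real assume "e > 0"
  then have e: "e/4 > 0" by simp
  obtain p where p: "trig p" "(normT (\<lambda>x. f x - p x))\<^sup>2 < e/4" using f e unfolding trig_closure_def by meson
  obtain q where q: "trig q" "(normT (\<lambda>x. g x - q x))\<^sup>2 < e/4" using g e unfolding trig_closure_def by meson
  have "(normT (\<lambda>x. (f x - p x) + (g x - q x)))\<^sup>2 \<le> 2 * (normT (\<lambda>x. f x - p x))\<^sup>2 + 2 * (normT (\<lambda>x. g x - q x))\<^sup>2"
    by (intro normT_sq_add_le L2T_diff L2T_trig trig_closure_L2T f g p q)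
  also have "\<dots> < e" using p q by simp
  finally have "(normT (\<lambda>x. f x + g x - (p x + q x)))\<^sup>2 < e" by (simp add: algebra_simps)
  then show "\<exists>p. trig p \<and> (normT (\<lambda>x. f x + g x - p x))\<^sup>2 < e" using trig_add[OF p(1) q(1)] by blast
qed

lemma trig_closure_cmult: assumes f: "trig_closure f" shows "trig_closure (\<lambda>x. c * f x)"
  unfolding trig_closure_def
proof (intro conjI L2T_cmult trig_closure_L2T assms allI impI)
  fix e :: real assume "e > 0"
  then have e: "e/((cmod c)\<^sup>2 + 1) > 0" by (simp add: add_nonneg_pos)
  obtain p where p: "trig p" "(normT (\<lambda>x. f x - p x))\<^sup>2 < e/((cmod c)\<^sup>2 + 1)" using f e unfolding trig_closure_def by meson
  have "(normT (\<lambda>x. c * (f x - p x)))\<^sup>2 = (cmod c)\<^sup>2 * (normT (\<lambda>x. f x - p x))\<^sup>2"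
    by (rule normT_sq_cmult)
  also have "\<dots> \<le> ((cmod c)\<^sup>2 + 1) * (normT (\<lambda>x. f x - p x))\<^sup>2" by (intro mult_right_mono) auto
  also have "\<dots> < e"
  proof -
    have "(cmod c)\<^sup>2 + 1 > 0" by (simp add: add_nonneg_pos)
    then show ?thesis using p(2) by (simp only: pos_less_divide_eq mult.commute)
  qed
  finally have "(normT (\<lambda>x. c * f x - c * p x))\<^sup>2 < e" by (simp add: algebra_simps)
  then show "\<exists>p. trig p \<and> (normT (\<lambda>x. c * f x - p x))\<^sup>2 < e" using trig_cmult[OF p(1)] by blast
qed

lemma trig_closure_const: "trig_closure (\<lambda>x. c)" by (intro trig_closure_trig trig_const)

lemma trig_closure_sum: "(\<And>i. i \<in> I \<Longrightarrow> trig_closure (f i)) \<Longrightarrow> trig_closure (\<lambda>x. \<Sum>i\<in>I. f i x)"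
proof (induction I rule: infinite_finite_induct)
  case (insert i I)
  then show ?case by (auto intro!: trig_closure_add)
qed (auto intro: trig_closure_const)

lemma normT_cong_AE:
  assumes [measurable]: "f \<in> borel_measurable MT" "g \<in> borel_measurable MT" and "AE x in MT. f x = g x"
  shows "normT f = normT g"
  unfolding normT_def using assms by (intro arg_cong[of _ _ sqrt] integral_cong_AE) auto

lemma trig_closure_cong_AE:
  assumes g: "trig_closure g" and f: "L2T f" and e: "AE x in MT. f x = g x" shows "trig_closure f"
proof (rule trig_closure_approx[OF f])
  fix e :: real assume "e > 0"
  have "normT (\<lambda>x. f x - g x) = normT (\<lambda>x. 0)"
    using e by (intro normT_cong_AE L2T_measurable L2T_diff f trig_closure_L2T[OF g] trig_closure_L2T[OF trig_closure_const]) auto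
  then show "\<exists>g. trig_closure g \<and> (normT (\<lambda>x. f x - g x))\<^sup>2 < e" using g \<open>e > 0\<close> by (intro exI[of _ g]) simp
qed

text \<open>Dominated convergence: the limit inherits the majorant \<open>w\<close>, so the squared
  differences are at most 4 w^2.\<close>

lemma trig_closure_limit:
  assumes fn: "\<And>n. trig_closure (fn n)" and f: "f \<in> borel_measurable MT"
    and lim: "\<And>x. x \<in> usq \<Longrightarrow> (\<lambda>n. fn n x) \<longlonglongrightarrow> f x"
    and bd: "\<And>n x. x \<in> usq \<Longrightarrow> cmod (fn n x) \<le> w x"
    and w: "integrable MT (\<lambda>x. (w x)\<^sup>2)"
  shows "trig_closure f"
proof -
  note [measurable] = f L2T_measurable[OF trig_closure_L2T[OF fn]]
  have fw: "cmod (f x) \<le> w x" if "x \<in> usq" for x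
    using lim[OF that] bd[OF that] by (intro tendsto_upperbound[OF tendsto_norm]) auto
  have "integrable MT (\<lambda>x. (cmod (f x))\<^sup>2)"
    by (rule Bochner_Integration.integrable_bound[OF w]) (auto intro!: AE_I2 power_mono fw)
  then have L: "L2T f" by (simp add: L2T_def f)
  have "(\<lambda>n. LINT x|MT. (cmod (f x - fn n x))\<^sup>2) \<longlonglongrightarrow> (LINT x|MT. (0::real))"
  proof (rule integral_dominated_convergence[where w="\<lambda>x. 4 * (w x)\<^sup>2"])
    show "AE x in MT. (\<lambda>n. (cmod (f x - fn n x))\<^sup>2) \<longlonglongrightarrow> 0"
    proof (rule AE_I2)
      fix x assume "x \<in> space MT"
      then have "(\<lambda>n. fn n x) \<longlonglongrightarrow> f x" using lim by simp
      from tendsto_diff[OF tendsto_const[of "f x"] this]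
      have "(\<lambda>n. f x - fn n x) \<longlonglongrightarrow> 0" by simp
      from tendsto_power[OF tendsto_norm[OF this], of 2] show "(\<lambda>n. (cmod (f x - fn n x))\<^sup>2) \<longlonglongrightarrow> 0" by simp
    qed
    show "AE x in MT. norm ((cmod (f x - fn n x))\<^sup>2) \<le> 4 * (w x)\<^sup>2" for n
    proof (rule AE_I2)
      fix x assume "x \<in> space MT"
      then have x: "x \<in> usq" by simp
      have "cmod (f x - fn n x) \<le> 2 * w x"
        using norm_triangle_ineq4[of "f x" "fn n x"] fw[OF x] bd[OF x, of n] by simp
      then have "(cmod (f x - fn n x))\<^sup>2 \<le> (2 * w x)\<^sup>2" by (intro power_mono) auto
      then show "norm ((cmod (f x - fn n x))\<^sup>2) \<le> 4 * (w x)\<^sup>2" by (simp add: power_mult_distrib)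
    qed
  qed (use w in \<open>auto intro: integrable_mult_right\<close>)
  then have t: "(\<lambda>n. (normT (\<lambda>x. f x - fn n x))\<^sup>2) \<longlonglongrightarrow> 0" by (simp add: normT_sq)
  show ?thesis
  proof (rule trig_closure_approx[OF L])
    fix e :: real assume "e > 0"
    then have "\<forall>\<^sub>F n in sequentially. (normT (\<lambda>x. f x - fn n x))\<^sup>2 < e"
      using t by (rule order_tendstoD(2)[rotated])
    then show "\<exists>g. trig_closure g \<and> (normT (\<lambda>x. f x - g x))\<^sup>2 < e"
      using fn eventually_happens[of _ sequentially] trivial_limit_sequentially by blast
  qed
qed

text \<open>On the image of this map Stone-Weierstrass needs no boundary condition, and up to a null
  set every Borel subset of the square is the preimage of a Borel set.\<close>

definition circles :: "pt \<Rightarrow> complex \<times> complex" where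
  "circles x = (cis (2 * pi * fst x), cis (2 * pi * snd x))"

lemma circles_ek: "fst (circles x) = ek (1,0) x" "snd (circles x) = ek (0,1) x"
  by (simp_all add: circles_def ek_cis zshift_def inner_prod_def)

lemma continuous_circles: "continuous_on A circles"
  unfolding circles_def by (intro continuous_intros)

lemma trig_cnj: "trig p \<Longrightarrow> trig (\<lambda>x. cnj (p x))"
proof (induction rule: trig.induct)
  case (trig_ek k)
  then show ?case using trig.trig_ek[of "- k"] by (simp add: ek_minus[abs_def])
qed (simp_all add: trig.intros)

lemma trig_Re: assumes "trig p" shows "trig (\<lambda>x. complex_of_real (Re (p x)))"
proof -
  have "trig (\<lambda>x. (1/2) * (p x + cnj (p x)))" by (intro trig_cmult trig_add trig_cnj assms)
  then show ?thesis by (simp add: complex_add_cnj)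
qed

lemma trig_Im: assumes "trig p" shows "trig (\<lambda>x. complex_of_real (Im (p x)))"
proof -
  have "trig (\<lambda>x. complex_of_real (Re ((-\<i>) * p x)))" by (intro trig_Re trig_cmult assms)
  then show ?thesis by simp
qed

text \<open>A real-linear function on pairs of complex numbers depends on four real coordinates; on
  the two circles these are the real and imaginary parts of \<open>ek (1,0)\<close> and
  \<open>ek (0,1)\<close>.\<close>

lemma trig_poly_circles:
  assumes "real_polynomial_function g" shows "trig (\<lambda>x. complex_of_real (g (circles x)))"
  using assms
proof induction
  case (linear h)
  interpret bounded_linear h by fact
  have "h y = Re (fst y) * h (1,0) + Im (fst y) * h (\<i>,0) + Re (snd y) * h (0,1) + Im (snd y) * h (0,\<i>)" for y
  proof -
    have "y = Re (fst y) *\<^sub>R (1,0) + Im (fst y) *\<^sub>R (\<i>,0) + Re (snd y) *\<^sub>R (0,1) + Im (snd y) *\<^sub>R (0,\<i>)"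
      by (simp add: prod_eq_iff complex_eq_iff)
    then have "h y = h (Re (fst y) *\<^sub>R (1,0) + Im (fst y) *\<^sub>R (\<i>,0) + Re (snd y) *\<^sub>R (0,1) + Im (snd y) *\<^sub>R (0,\<i>))" by (rule arg_cong)
    also have "\<dots> = Re (fst y) * h (1,0) + Im (fst y) * h (\<i>,0) + Re (snd y) * h (0,1) + Im (snd y) * h (0,\<i>)"
      unfolding add scaleR real_scaleR_def ..
    finally show ?thesis .
  qed
  note hy = this
  have *: "complex_of_real (h (circles x)) = complex_of_real (h (1,0)) * complex_of_real (Re (ek (1,0) x)) + complex_of_real (h (\<i>,0)) * complex_of_real (Im (ek (1,0) x))
    + complex_of_real (h (0,1)) * complex_of_real (Re (ek (0,1) x)) + complex_of_real (h (0,\<i>)) * complex_of_real (Im (ek (0,1) x))" for x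
    by (subst hy) (simp add: circles_ek mult.commute)
  show ?case unfolding * by (intro trig_add trig_cmult trig_Re trig_Im trig_ek)
next
  case (const c)
  then show ?case by (rule trig_const)
next
  case (add f1 f2)
  then show ?case by (simp add: trig_add)
next
  case (mult f1 f2)
  then show ?case by (simp add: trig_mult)
qed

lemma normT_le_bound:
  assumes "L2T f" "\<And>x. x \<in> usq \<Longrightarrow> cmod (f x) \<le> B"
  shows "(normT f)\<^sup>2 \<le> B\<^sup>2"
proof -
  have "(LINT x|MT. (cmod (f x))\<^sup>2) \<le> (LINT x|MT. B\<^sup>2)"
    using assms by (intro integral_mono) (auto simp: L2T_def intro!: power_mono integrable_MT_bounded)
  then show ?thesis by (simp add: normT_sq measure_MT)
qed

text \<open>Stone-Weierstrass on the compact product of two unit circles; uniform closeness gives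
  closeness in L2 because the square has measure one.\<close>

lemma trig_closure_cont_circles:
  fixes g :: "complex \<times> complex \<Rightarrow> real"
  assumes g: "continuous_on UNIV g" shows "trig_closure (\<lambda>x. complex_of_real (g (circles x)))"
proof -
  have L: "L2T (\<lambda>x. complex_of_real (g (circles x)))"
    by (intro L2T_continuous continuous_intros continuous_on_compose2[OF g continuous_circles]) auto
  show ?thesis
  proof (rule trig_closure_approx[OF L])
    fix e :: real assume e: "e > 0"
    \<comment> \<open>The minimum with 1 gives d^2 \<le> d, so a uniform error \<open>d\<close> has
      square below \<open>e\<close>.\<close>
    define d where "d = min 1 (e/2)"
    have d: "d > 0" "d\<^sup>2 < e" 
    proof -
      show "d > 0" using e by (simp add: d_def)
      then have "d * d \<le> 1 * d" by (intro mult_right_mono) (auto simp: d_def)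
      also have "\<dots> < e" using e by (simp add: d_def min_def)
      finally show "d\<^sup>2 < e" by (simp add: power2_eq_square)
    qed
    obtain p where p: "real_polynomial_function p" "\<And>x. x \<in> sphere 0 1 \<times> sphere 0 1 \<Longrightarrow> \<bar>g x - p x\<bar> < d"
      using Stone_Weierstrass_real_polynomial_function[OF compact_Times[OF compact_sphere compact_sphere] 
          continuous_on_subset[OF g subset_UNIV] d(1)] by blast
    have "(normT (\<lambda>x. complex_of_real (g (circles x)) - complex_of_real (p (circles x))))\<^sup>2 \<le> d\<^sup>2"
    proof (rule normT_le_bound)
      show "L2T (\<lambda>x. complex_of_real (g (circles x)) - complex_of_real (p (circles x)))"
        by (intro L2T_diff L L2T_trig trig_poly_circles p)
      show "cmod (complex_of_real (g (circles x)) - complex_of_real (p (circles x))) \<le> d" for x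
        using p(2)[of "circles x"] by (simp add: circles_def flip: of_real_diff)
    qed
    then show "\<exists>q. trig_closure q \<and> (normT (\<lambda>x. complex_of_real (g (circles x)) - q x))\<^sup>2 < e"
      using d(2) trig_closure_trig[OF trig_poly_circles[OF p(1)]] by (intro exI[of _ "\<lambda>x. complex_of_real (p (circles x))"]) simp
  qed
qed

lemma measurable_circles [measurable]: "circles \<in> borel_measurable MT"
  by (intro continuous_measurable_MT continuous_circles)

lemma trig_closure_closed:
  fixes C :: "(complex \<times> complex) set"
  assumes C: "closed C" shows "trig_closure (\<lambda>x. indicator C (circles x))"
\<comment> \<open>\<open>infdist\<close> to the empty set is 0 by convention, so the approximants
  used below would be 1 everywhere.\<close>
proof (cases "C = {}")
  case True
  then show ?thesis using trig_closure_const[of 0] by simp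
next
  case False
  show ?thesis
  proof (rule trig_closure_limit[where fn="\<lambda>n x. complex_of_real (1 / (1 + real n * infdist (circles x) C))" and w="\<lambda>_. 1"])
    show "trig_closure (\<lambda>x. complex_of_real (1 / (1 + real n * infdist (circles x) C)))" for n
      by (rule trig_closure_cont_circles[of "\<lambda>y. 1 / (1 + real n * infdist y C)"])
        (auto intro!: continuous_intros simp: add_nonneg_eq_0_iff infdist_nonneg)
    show "(\<lambda>x. indicator C (circles x)) \<in> borel_measurable MT" 
      using C by (intro measurable_compose[OF measurable_circles] borel_measurable_indicator) auto
    show "(\<lambda>n. complex_of_real (1 / (1 + real n * infdist (circles x) C))) \<longlonglongrightarrow> indicator C (circles x)" for x
    proof (cases "circles x \<in> C")
      case True
      then show ?thesis by simp
    next
      case n: False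
      then have i: "infdist (circles x) C > 0"
        using C False in_closed_iff_infdist_zero[of C "circles x"] infdist_nonneg[of "circles x" C] by linarith
      have "filterlim (\<lambda>n. 1 + real n * infdist (circles x) C) at_top sequentially"
        using i by (intro filterlim_tendsto_add_at_top[OF tendsto_const] 
          filterlim_at_top_mult_tendsto_pos[OF tendsto_const] filterlim_real_sequentially)
      from tendsto_inverse_0_at_top[OF this] have "(\<lambda>n. 1 / (1 + real n * infdist (circles x) C)) \<longlonglongrightarrow> 0"
        by (simp add: inverse_eq_divide)
      from tendsto_of_real[OF this, where 'a=complex] show ?thesis using n by simp
    qed
    show "cmod (complex_of_real (1 / (1 + real n * infdist (circles x) C))) \<le> 1" for n x
    proof -
      have "real n * infdist (circles x) C \<ge> 0" by (intro mult_nonneg_nonneg infdist_nonneg) auto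
      then show ?thesis unfolding norm_of_real by (simp add: divide_le_eq_1)
    qed
    show "integrable MT (\<lambda>x. 1\<^sup>2 :: real)" by (intro integrable_MT_bounded[of _ 1]) auto
  qed
qed

text \<open>Closed sets generate the Borel sets and are stable under intersection, so the pi-lambda
  theorem leaves complements and disjoint unions; in a disjoint union the partial sums of the
  indicators stay bounded by 1.\<close>

lemma trig_closure_borel_circles:
  fixes B :: "(complex \<times> complex) set"
  assumes B: "B \<in> sets borel" shows "trig_closure (\<lambda>x. indicator B (circles x))"
proof -
  have "Int_stable (Collect closed :: (complex \<times> complex) set set)" by (auto simp: Int_stable_def)
  moreover have "Collect closed \<subseteq> Pow (UNIV :: (complex \<times> complex) set)" by auto
  moreover have "B \<in> sigma_sets UNIV (Collect closed)" using B by (simp add: borel_eq_closed)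
  ultimately show ?thesis
  proof (induction rule: sigma_sets_induct_disjoint)
    case (basic A)
    then show ?case by (simp add: trig_closure_closed)
  next
    case empty
    then show ?case using trig_closure_const[of 0] by simp
  next
    case (compl A)
    have "trig_closure (\<lambda>x. 1 + (-1) * indicator A (circles x))" by (intro trig_closure_add trig_closure_cmult compl.IH trig_closure_const)
    then show ?case by (rule back_subst[of trig_closure]) (auto simp: indicator_def)
  next
    case (union A)
    have bor: "(\<Union>i. A i) \<in> sets borel" 
      using union(2) by (auto simp: borel_eq_closed intro!: sigma_sets.Union)
    show ?case
    proof (rule trig_closure_limit[where fn="\<lambda>n x. \<Sum>i<n. indicator (A i) (circles x)" and w="\<lambda>_. 1"])
      show "trig_closure (\<lambda>x. \<Sum>i<n. indicator (A i) (circles x))" for n by (intro trig_closure_sum union.IH)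
      show "(\<lambda>x. indicator (\<Union>i. A i) (circles x)) \<in> borel_measurable MT"
        by (intro measurable_compose[OF measurable_circles] borel_measurable_indicator bor)
      have *: "(\<lambda>n. (\<Sum>i<n. indicator (A i) y) :: complex) \<longlonglongrightarrow> indicator (\<Union>i. A i) y \<and> cmod (\<Sum>i<n. indicator (A i) y) \<le> 1" for n y
      proof (cases "y \<in> (\<Union>i. A i)")
        case True
        then obtain j where j: "y \<in> A j" by auto
        have e: "indicator (A i) y = (if i = j then 1 else 0 :: complex)" for i
          using union(1) j by (auto simp: disjoint_family_on_def indicator_def)
        have "(\<Sum>i<n. indicator (A i) y) = (if j < n then 1 else 0 :: complex)" for n
          unfolding e by simp
        moreover have "(\<lambda>n. (if j < n then 1 else 0 :: complex)) \<longlonglongrightarrow> 1"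
          by (rule tendsto_eventually) (auto intro: eventually_sequentiallyI[of "Suc j"])
        ultimately show ?thesis using True by simp
      next
        case False
        then show ?thesis by simp
      qed
      show "(\<lambda>n. \<Sum>i<n. indicator (A i) (circles x)) \<longlonglongrightarrow> (indicator (\<Union>i. A i) (circles x) :: complex)" for x using * by blast
      show "cmod (\<Sum>i<n. indicator (A i) (circles x)) \<le> 1" for n x using * by blast
      show "integrable MT (\<lambda>x. 1\<^sup>2 :: real)" by (intro integrable_MT_bounded[of _ 1]) auto
    qed
  qed
qed

lemma measurable_Arg2pi [measurable]: "Arg2pi \<in> borel_measurable borel"
  unfolding borel_measurable_iff_greater using open_Arg2pi2pi_gt by simp

text \<open>\<open>circles\<close> identifies opposite edges of the square, so a point can be
  recovered from its image only off the right and upper edges.\<close>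

lemma AE_MT_interior: "AE x in MT. fst x < 1 \<and> snd x < 1"
proof -
  have "negligible {x::pt. (1,0) \<bullet> x = 1}" by (rule negligible_hyperplane) (simp add: zero_prod_def)
  moreover have "negligible {x::pt. (0,1) \<bullet> x = 1}" by (rule negligible_hyperplane) (simp add: zero_prod_def)
  ultimately have n: "negligible ({x::pt. (1,0) \<bullet> x = 1} \<union> {x::pt. (0,1) \<bullet> x = 1})" by (rule negligible_Un)
  have "AE x in lebesgue. x \<in> usq \<longrightarrow> fst x < 1 \<and> snd x < 1"
    by (rule AE_I'[of "{x::pt. (1,0) \<bullet> x = 1} \<union> {x::pt. (0,1) \<bullet> x = 1}"])
      (use n in \<open>auto simp: negligible_iff_null_sets usq_def inner_prod_def cbox_Pair_eq\<close>)
  then show ?thesis by (subst AE_restrict_space_iff) auto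
qed

lemma trig_closure_indicator:
  assumes E: "E \<in> sets MT" shows "trig_closure (indicator E)"
proof -
  have Em: "indicator E \<in> borel_measurable MT" using E by measurable
  have "E \<in> sets lebesgue" using E by (auto simp: sets_restrict_space)
  then obtain S N N' where S: "E = S \<union> N" "N \<subseteq> N'" "N' \<in> null_sets lborel" "S \<in> sets lborel"
    by (elim sets_completionE)
  \<comment> \<open>A Borel left inverse of \<open>circles\<close> on [0,1)^2. The preimage
    \<open>B\<close> of \<open>S\<close> under it is a Borel set whose indicator, composed with
    \<open>circles\<close>, is that of \<open>S\<close> up to the null edges.\<close>
  define r where "r = (\<lambda>z. (Arg2pi (fst z) / (2*pi), Arg2pi (snd z) / (2 * pi)))"
  have r: "r \<in> borel \<rightarrow>\<^sub>M borel" unfolding r_def borel_prod[symmetric] by measurable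
  define B where "B = r -` S"
  have B: "B \<in> sets borel" unfolding B_def using measurable_sets[OF r, of S] S by simp
  have rq: "r (circles x) = x" if "x \<in> usq" "fst x < 1" "snd x < 1" for x
    using that by (auto simp: r_def circles_def usq_def cbox_Pair_eq cis_conv_exp Arg2pi_exp prod_eq_iff)
  have "AE x in lebesgue. x \<notin> N'" using S(3) by (intro AE_completion AE_not_in) auto
  then have "AE x in MT. x \<notin> N'" by (subst AE_restrict_space_iff) auto
  with AE_MT_interior have "AE x in MT. indicator E x = (indicator B (circles x) :: complex)"
  proof (rule AE_mp[OF AE_conjI], intro AE_I2 impI)
    fix x assume x: "x \<in> space MT" "(fst x < 1 \<and> snd x < 1) \<and> x \<notin> N'"
    then have "r (circles x) = x" by (intro rq) auto
    then show "indicator E x = (indicator B (circles x) :: complex)" using x S(1,2) by (auto simp: indicator_def B_def)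
  qed
  then show ?thesis
    by (intro trig_closure_cong_AE[OF trig_closure_borel_circles[OF B]] L2T_bounded[OF Em, of 1]) (auto simp: indicator_def)
qed

lemma trig_closure_all: assumes f: "L2T f" shows "trig_closure f"
proof -
  obtain s where s: "\<And>i. simple_function MT (s i)" "\<And>x. x \<in> usq \<Longrightarrow> (\<lambda>i. s i x) \<longlonglongrightarrow> f x"
    "\<And>i x. x \<in> usq \<Longrightarrow> dist (s i x) 0 \<le> 2 * dist (f x) 0"
    using borel_measurable_implies_sequence_metric[OF L2T_measurable[OF f], of 0] unfolding space_lebesgue_on by blast
  show ?thesis
  proof (rule trig_closure_limit[where fn=s and w="\<lambda>x. 2 * cmod (f x)"])
    fix n
    have c: "trig_closure (\<lambda>x. \<Sum>y\<in>s n ` space MT. y * indicator (s n -` {y} \<inter> space MT) x)"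
      by (intro trig_closure_sum trig_closure_cmult trig_closure_indicator simple_functionD s)
    have e: "s n x = (\<Sum>y\<in>s n ` space MT. y * indicator (s n -` {y} \<inter> space MT) x)" if "x \<in> usq" for x
    proof -
      have "(\<Sum>y\<in>s n ` space MT. y * indicator (s n -` {y} \<inter> space MT) x) = (\<Sum>y\<in>s n ` space MT. if y = s n x then y else 0)"
        using that by (intro sum.cong) (auto simp: indicator_def)
      also have "\<dots> = s n x" using that simple_functionD(1)[OF s(1), of n] by simp
      finally show ?thesis by simp
    qed
    have L: "L2T (s n)"
    proof -
      have "finite (s n ` usq)" using simple_functionD(1)[OF s(1), of n] by simp
      then obtain B where "\<And>x. x \<in> usq \<Longrightarrow> cmod (s n x) \<le> B" 
        using finite_imp_bounded[of "s n ` usq"] unfolding bounded_iff by blast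
      then show ?thesis by (intro L2T_bounded borel_measurable_simple_function s)
    qed
    show "trig_closure (s n)" 
    proof (rule trig_closure_cong_AE[OF c L], rule AE_I2)
      fix x assume "x \<in> space MT"
      then have "x \<in> usq" by simp
      from e[OF this] show "s n x = (\<Sum>y\<in>s n ` space MT. y * indicator (s n -` {y} \<inter> space MT) x)" .
    qed
  qed (use f s in \<open>auto simp: L2T_def power_mult_distrib\<close>)
qed

section \<open>Parseval's identity\<close>

text \<open>Bessel's inequality is one half. For the other, take a trigonometric polynomial at
  squared distance below \<open>e\<close>: by \<open>normT_sq_diff_trig\<close> the partial sum over
  its frequencies already exceeds the squared norm minus \<open>e\<close>.\<close>

theorem parseval_norm:
  assumes f: "L2T f" shows "((\<lambda>k. (cmod (fc f k))\<^sup>2) has_sum (normT f)\<^sup>2) UNIV"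
proof -
  have s: "(\<lambda>k. (cmod (fc f k))\<^sup>2) summable_on UNIV"
    by (rule nonneg_bounded_partial_sums_imp_summable_on[of _ _ "(normT f)\<^sup>2"])
      (auto intro!: eventually_finite_subsets_at_top_weakI bessel[OF f])
  have "(\<Sum>\<^sub>\<infinity>k. (cmod (fc f k))\<^sup>2) = (normT f)\<^sup>2"
  proof (rule antisym)
    show "(\<Sum>\<^sub>\<infinity>k. (cmod (fc f k))\<^sup>2) \<le> (normT f)\<^sup>2"
      using infsum_le_finite_sums[OF s] bessel[OF f] by auto
    show "(normT f)\<^sup>2 \<le> (\<Sum>\<^sub>\<infinity>k. (cmod (fc f k))\<^sup>2)"
    proof (rule field_le_epsilon)
      fix e :: real assume "e > 0"
      then obtain p where p: "trig p" "(normT (\<lambda>x. f x - p x))\<^sup>2 < e"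
        using trig_closure_all[OF f] unfolding trig_closure_def by blast
      obtain K c where K: "finite K" "p = (\<lambda>x. \<Sum>k\<in>K. c k * ek k x)" using trig_sum_rep[OF p(1)] by blast
      have "(normT f)\<^sup>2 - (\<Sum>k\<in>K. (cmod (fc f k))\<^sup>2) \<le> e"
        using p(2) normT_sq_diff_trig[OF f K(1), of c] sum_nonneg[of K "\<lambda>k. (cmod (fc f k - c k))\<^sup>2"] unfolding K(2) by simp
      moreover have "(\<Sum>k\<in>K. (cmod (fc f k))\<^sup>2) \<le> (\<Sum>\<^sub>\<infinity>k. (cmod (fc f k))\<^sup>2)"
        by (rule finite_sum_le_infsum[OF s K(1)]) auto
      ultimately show "(normT f)\<^sup>2 \<le> (\<Sum>\<^sub>\<infinity>k. (cmod (fc f k))\<^sup>2) + e" by simp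
    qed
  qed
  then show ?thesis using has_sum_infsum[OF s] by simp
qed

theorem parseval:
  assumes f: "L2T f" and g: "L2T g"
  shows "((\<lambda>k. cnj (fc f k) * fc g k) has_sum innerT f g) UNIV"
proof -
  define N where "N = (\<lambda>c. (normT (\<lambda>x. g x + c * f x))\<^sup>2)"
  have p: "((\<lambda>k. complex_of_real ((cmod (fc g k + c * fc f k))\<^sup>2)) has_sum complex_of_real (N c)) UNIV" for c
    using has_sum_of_real[OF parseval_norm[OF L2T_add[OF g L2T_cmult[OF f, of c]]], where 'a=complex] f g 
    by (simp add: N_def fc_add fc_cmult L2T_cmult)
  \<comment> \<open>Polarization, with weights fitted to the conjugation of \<open>x\<close>;
    \<open>f\<close> is multiplied by 1, -1, \<i> and -\<i>.\<close>
  have id1: "(1/4) * ((complex_of_real ((cmod (y + 1 * x))\<^sup>2) + (-1) * complex_of_real ((cmod (y + (-1) * x))\<^sup>2))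
    + (\<i> * complex_of_real ((cmod (y + \<i> * x))\<^sup>2) + (-\<i>) * complex_of_real ((cmod (y + (-\<i>) * x))\<^sup>2))) = cnj x * y" for x y
    by (simp add: complex_norm_square algebra_simps del: of_real_power)
  have "((\<lambda>k. (1/4) * ((complex_of_real ((cmod (fc g k + 1 * fc f k))\<^sup>2) + (-1) * complex_of_real ((cmod (fc g k + (-1) * fc f k))\<^sup>2))
    + (\<i> * complex_of_real ((cmod (fc g k + \<i> * fc f k))\<^sup>2) + (-\<i>) * complex_of_real ((cmod (fc g k + (-\<i>) * fc f k))\<^sup>2))))
    has_sum (1/4) * ((complex_of_real (N 1) + (-1) * complex_of_real (N (-1))) + (\<i> * complex_of_real (N \<i>) + (-\<i>) * complex_of_real (N (-\<i>))))) UNIV"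
    by (intro has_sum_cmult_right has_sum_add p)
  moreover have "(1/4) * ((complex_of_real (N 1) + (-1) * complex_of_real (N (-1))) + (\<i> * complex_of_real (N \<i>) + (-\<i>) * complex_of_real (N (-\<i>)))) = innerT f g"
  proof -
    have "complex_of_real (N c) = innerT g g + c * cnj (innerT f g) + cnj c * innerT f g + c * cnj c * innerT f f" for c
      unfolding N_def innerT_self_normT[symmetric] using f g
      by (simp only: innerT_add_right innerT_add_left L2T_cmult L2T_add innerT_cmult_right innerT_cmult_left)
        (simp add: algebra_simps innerT_commute[of g f])
    then show ?thesis by (simp add: algebra_simps)
  qed
  ultimately show ?thesis unfolding id1 by simp
qed

section \<open>Absolutely summable Fourier series\<close>

text \<open>Meant for operations, such as averaging, that are exact on finite partial sums and whose
  error on the rest is controlled by the tail of a scalar majorant.\<close>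

lemma has_sum_by_tail:
  fixes f :: "'a \<Rightarrow> 'b::real_normed_vector" and a :: "'a \<Rightarrow> real"
  assumes a: "(a has_sum A) UNIV" and b: "\<And>K. finite K \<Longrightarrow> norm (S - sum f K) \<le> C * (A - sum a K)"
  shows "(f has_sum S) UNIV"
proof -
  have "((\<lambda>K. C * (A - sum a K)) \<longlongrightarrow> C * (A - A)) (finite_subsets_at_top UNIV)"
    using a unfolding has_sum_def by (intro tendsto_intros)
  then have l: "((\<lambda>K. C * (A - sum a K)) \<longlongrightarrow> 0) (finite_subsets_at_top UNIV)" by simp
  have "\<forall>\<^sub>F K in finite_subsets_at_top UNIV. norm (sum f K - S) \<le> C * (A - sum a K)"
    using b by (intro eventually_finite_subsets_at_top_weakI) (simp add: norm_minus_commute)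
  from Lim_null_comparison[OF this l] have "((\<lambda>K. sum f K - S) \<longlongrightarrow> 0) (finite_subsets_at_top UNIV)" .
  then show ?thesis unfolding has_sum_def using LIM_zero_cancel by blast
qed

lemma norm_infsum_tail:
  fixes f :: "'a \<Rightarrow> 'b::{banach,second_countable_topology}" and a :: "'a \<Rightarrow> real"
  assumes a: "(a has_sum A) UNIV" and fa: "\<And>k. norm (f k) \<le> a k" and K: "finite K"
  shows "norm (infsum f UNIV - sum f K) \<le> A - sum a K"
proof -
  have as: "(\<lambda>k. norm (f k)) summable_on UNIV"
    using Infinite_Sum.abs_summable_on_comparison_test'[of a UNIV f] a fa by (auto simp: summable_on_def)
  then have fs: "(f has_sum infsum f UNIV) UNIV" by (simp add: abs_summable_summable)
  have "(f has_sum (infsum f UNIV - sum f K)) (UNIV - K)"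
    by (intro has_sum_Diff fs has_sum_finite K) auto
  moreover have "(a has_sum (A - sum a K)) (UNIV - K)"
    by (intro has_sum_Diff a has_sum_finite K) auto
  ultimately show ?thesis using fa norm_infsum_le by (metis)
qed

lemma sum_inverse_square_int_bounded:
  "\<exists>B. \<forall>A::int set. finite A \<longrightarrow> (\<Sum>a\<in>A. 1 / (1 + (real_of_int a)\<^sup>2)) \<le> B"
proof -
  define w where "w = (\<lambda>n::nat. 1 / (1 + (real n)\<^sup>2))"
  have s: "summable w"
  proof (rule summable_comparison_test_ev)
    show "\<forall>\<^sub>F n in sequentially. norm (w n) \<le> inverse (real n ^ 2)"
      by (rule eventually_sequentiallyI[of 1]) (auto simp: w_def inverse_eq_divide intro!: divide_left_mono mult_pos_pos add_pos_nonneg)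
    show "summable (\<lambda>n. inverse (real n ^ 2))" by (rule inverse_power_summable) simp
  qed
  have b: "sum w N \<le> suminf w" if "finite N" for N
    by (rule sum_le_suminf[OF s that]) (auto simp: w_def)
  show ?thesis
  proof (intro exI[of _ "2 * suminf w"] allI impI)
    fix A :: "int set" assume A: "finite A"
    let ?f = "\<lambda>a::int. 1 / (1 + (real_of_int a)\<^sup>2)"
    have "(\<Sum>a\<in>A. ?f a) = (\<Sum>a\<in>{a\<in>A. a \<ge> 0} \<union> {a\<in>A. \<not> a \<ge> 0}. ?f a)"
      by (rule sum.cong) auto
    also have "\<dots> = (\<Sum>a\<in>{a\<in>A. a \<ge> 0}. ?f a) + (\<Sum>a\<in>{a\<in>A. \<not> a \<ge> 0}. ?f a)"
      using A by (intro sum.union_disjoint) auto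
    also have "(\<Sum>a\<in>{a\<in>A. a \<ge> 0}. ?f a) = (\<Sum>n\<in>(\<lambda>a. nat a) ` {a\<in>A. a \<ge> 0}. w n)"
      by (subst sum.reindex) (auto simp: inj_on_def w_def intro!: sum.cong)
    also have "(\<Sum>a\<in>{a\<in>A. \<not> a \<ge> 0}. ?f a) = (\<Sum>n\<in>(\<lambda>a. nat (- a)) ` {a\<in>A. \<not> a \<ge> 0}. w n)"
      by (subst sum.reindex) (auto simp: inj_on_def w_def intro!: sum.cong)
    finally show "(\<Sum>a\<in>A. ?f a) \<le> 2 * suminf w"
      using b[of "(\<lambda>a. nat a) ` {a\<in>A. a \<ge> 0}"] b[of "(\<lambda>a. nat (- a)) ` {a\<in>A. \<not> a \<ge> 0}"] A by simp
  qed
qed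

lemma summable_on_int_pair:
  "(\<lambda>m::int\<times>int. 1 / ((1 + (real_of_int (fst m))\<^sup>2) * (1 + (real_of_int (snd m))\<^sup>2))) summable_on UNIV"
proof -
  obtain B where B: "\<And>A::int set. finite A \<Longrightarrow> (\<Sum>a\<in>A. 1 / (1 + (real_of_int a)\<^sup>2)) \<le> B"
    using sum_inverse_square_int_bounded by blast
  let ?w = "\<lambda>a::int. 1 / (1 + (real_of_int a)\<^sup>2)"
  have "sum (\<lambda>m::int\<times>int. 1 / ((1 + (real_of_int (fst m))\<^sup>2) * (1 + (real_of_int (snd m))\<^sup>2))) K \<le> B * B" if K: "finite K" for K
  proof -
    have "sum (\<lambda>m::int\<times>int. 1 / ((1 + (real_of_int (fst m))\<^sup>2) * (1 + (real_of_int (snd m))\<^sup>2))) K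
      = (\<Sum>m\<in>K. ?w (fst m) * ?w (snd m))" by simp
    also have "\<dots> \<le> (\<Sum>m\<in>fst ` K \<times> snd ` K. ?w (fst m) * ?w (snd m))"
    proof (rule sum_mono2)
      show "K \<subseteq> fst ` K \<times> snd ` K" by (auto simp: image_iff) (metis fst_conv snd_conv)+
    qed (use K in \<open>auto simp: add_nonneg_nonneg\<close>)
    also have "\<dots> = sum ?w (fst ` K) * sum ?w (snd ` K)"
      by (simp add: sum_product sum.cartesian_product split_beta)
    also have "\<dots> \<le> B * B"
      using B[of "{}"] K by (intro mult_mono B sum_nonneg) (auto simp: add_nonneg_nonneg)
    finally show ?thesis .
  qed
  then show ?thesis
    by (intro nonneg_bounded_partial_sums_imp_summable_on[of _ _ "B * B"] eventually_finite_subsets_at_top_weakI)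
      (auto intro!: mult_nonneg_nonneg add_nonneg_nonneg)
qed

lemma norm_fc_le:
  assumes f: "continuous_on usq f" and B: "\<And>x. x \<in> usq \<Longrightarrow> cmod (f x) \<le> B"
  shows "cmod (fc f k) \<le> B"
proof -
  have c: "continuous_on usq (\<lambda>x. cnj (ek k x) * f x)" by (intro continuous_intros f)
  have "cmod (fc f k) \<le> (LINT x|MT. cmod (cnj (ek k x) * f x))"
    unfolding fc_def innerT_def by (rule integral_norm_bound)
  also have "\<dots> \<le> (LINT x|MT. B)"
    using B c by (intro integral_mono integrable_norm continuous_integrable_MT) (auto simp: norm_mult intro: continuous_intros)
  finally show ?thesis by (simp add: measure_MT)
qed

lemma periodic_dd: "periodic f \<Longrightarrow> periodic (dd f vs)"
proof (induction vs)
  case (Cons v vs)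
  then have "dd f vs ((x + zshift m) + t *\<^sub>R v) = dd f vs (x + t *\<^sub>R v)" for x m t
    unfolding periodic_def by (metis add.commute add.left_commute)
  then show ?case by (simp add: periodic_def)
qed simp

lemma continuous_dd: "smooth f \<Longrightarrow> continuous_on A (dd f vs)"
  unfolding smooth_def by (meson continuous_on_subset subset_UNIV)

lemma has_vector_derivative_dd:
  "smooth f \<Longrightarrow> ((\<lambda>t::real. dd f vs (x + t *\<^sub>R v)) has_vector_derivative dd f (v # vs) x) (at 0)"
  unfolding smooth_def dd.simps using vector_derivative_works by blast

text \<open>The conjugate character times \<open>dd V vs\<close> is periodic, so its derivative
  along \<open>v\<close> has zero integral; the derivative falling on the character produces the
  factor.\<close>

lemma fc_dd:
  fixes V :: "pt \<Rightarrow> real"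
  assumes s: "smooth V" and p: "periodic V" and v: "v = (1,0) \<or> v = (0,1)"
  shows "fc (\<lambda>x. complex_of_real (dd V (v # vs) x)) m
    = 2 * pi * \<i> * complex_of_real (zshift m \<bullet> v) * fc (\<lambda>x. complex_of_real (dd V vs x)) m"
proof -
  let ?F = "\<lambda>x. cnj (ek m x) * complex_of_real (dd V vs x)"
  let ?G = "\<lambda>x. cnj (ek m x) * complex_of_real (dd V (v # vs) x) 
    - 2 * pi * \<i> * complex_of_real (zshift m \<bullet> v) * (cnj (ek m x) * complex_of_real (dd V vs x))"
  have c: "continuous_on A (\<lambda>x. complex_of_real (dd V ws x))" for A ws
    by (intro continuous_intros continuous_dd s)
  have "(LINT x|MT. ?G x) = 0"
  proof (rule integral_deriv_periodic[OF _ _ _ v])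
    show "periodic ?F" using periodic_dd[OF p] periodic_ek[of m] by (simp add: periodic_def)
    show "continuous_on UNIV ?G" by (intro continuous_intros c)
    fix x
    have 1: "((\<lambda>t::real. cnj (ek m (x + t *\<^sub>R v))) has_vector_derivative
       cnj (2 * pi * \<i> * complex_of_real (zshift m \<bullet> v) * ek m x)) (at 0)"
      using ek_has_vector_derivative[of m x v 0 UNIV] by (intro has_vector_derivative_cnj) simp
    have 2: "((\<lambda>t::real. complex_of_real (dd V vs (x + t *\<^sub>R v))) has_vector_derivative complex_of_real (dd V (v # vs) x)) (at 0)"
      by (intro has_vector_derivative_of_real has_vector_derivative_dd[OF s, folded has_real_derivative_iff_has_vector_derivative])
    show "((\<lambda>t. ?F (x + t *\<^sub>R v)) has_vector_derivative ?G x) (at 0)"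
      using has_vector_derivative_mult[OF 1 2] by (simp add: algebra_simps)
  qed
  moreover have "(LINT x|MT. ?G x) = (LINT x|MT. cnj (ek m x) * complex_of_real (dd V (v # vs) x))
    - (LINT x|MT. 2 * pi * \<i> * complex_of_real (zshift m \<bullet> v) * (cnj (ek m x) * complex_of_real (dd V vs x)))"
    by (intro Bochner_Integration.integral_diff integrable_mult_right continuous_integrable_MT continuous_intros c)
  ultimately show ?thesis unfolding fc_def innerT_def by simp
qed

lemma dd_bounded:
  fixes V :: "pt \<Rightarrow> real"
  assumes s: "smooth V" shows "\<exists>B. \<forall>m. cmod (fc (\<lambda>x. complex_of_real (dd V vs x)) m) \<le> B"
proof -
  have c: "continuous_on usq (\<lambda>x. complex_of_real (dd V vs x))"
    by (intro continuous_intros continuous_dd s)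
  have "bounded ((\<lambda>x. complex_of_real (dd V vs x)) ` usq)" 
    by (intro compact_imp_bounded compact_continuous_image[OF c]) (simp add: usq_def)
  then obtain B where "\<And>x. x \<in> usq \<Longrightarrow> cmod (complex_of_real (dd V vs x)) \<le> B"
    unfolding bounded_iff by blast
  from norm_fc_le[OF c this] show ?thesis by blast
qed

text \<open>Two derivatives in each coordinate bound the coefficients by a multiple of 1/((1 +
  m1^2)(1 + m2^2)), which is summable as a product.\<close>

lemma smooth_fc_summable:
  fixes V :: "pt \<Rightarrow> real"
  assumes s: "smooth V" and p: "periodic V"
  shows "(\<lambda>m. cmod (fc (\<lambda>x. complex_of_real (V x)) m)) summable_on UNIV"
proof -
  let ?e1 = "(1,0)::pt" and ?e2 = "(0,1)::pt"
  define c where "c = (\<lambda>vs m. cmod (fc (\<lambda>x. complex_of_real (dd V vs x)) m))"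
  have e1: "c (?e1 # ?e1 # vs) m = 4 * pi\<^sup>2 * (real_of_int (fst m))\<^sup>2 * c vs m" for vs m
    unfolding c_def using fc_dd[OF s p, of ?e1 "?e1 # vs" m] fc_dd[OF s p, of ?e1 vs m]
    by (simp add: norm_mult zshift_def power2_eq_square)
  have e2: "c (?e2 # ?e2 # vs) m = 4 * pi\<^sup>2 * (real_of_int (snd m))\<^sup>2 * c vs m" for vs m
    unfolding c_def using fc_dd[OF s p, of ?e2 "?e2 # vs" m] fc_dd[OF s p, of ?e2 vs m]
    by (simp add: norm_mult zshift_def power2_eq_square)
  obtain B where B: "\<And>vs m. c vs m \<le> B vs" using dd_bounded[OF s] unfolding c_def by metis
  define C where "C = B [] + B [?e1,?e1] + B [?e2,?e2] + B [?e1,?e1,?e2,?e2]"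
  have p4: "4 * pi\<^sup>2 \<ge> 1"
    using power_mono[of 2 pi 2] pi_ge_two by simp
  have le: "x \<le> 4 * pi\<^sup>2 * x" if "x \<ge> 0" for x :: real
    using mult_right_mono[OF p4 that] by simp
  have "c [] m \<le> C * (1 / ((1 + (real_of_int (fst m))\<^sup>2) * (1 + (real_of_int (snd m))\<^sup>2)))" for m
  proof -
    let ?a = "(real_of_int (fst m))\<^sup>2" and ?b = "(real_of_int (snd m))\<^sup>2"
    have c0: "c [] m \<ge> 0" by (simp add: c_def)
    have "?a * c [] m \<le> B [?e1,?e1]" using le[of "?a * c [] m"] B[of "[?e1,?e1]" m] e1[of "[]" m] c0 by (simp add: mult.assoc)
    moreover have "?b * c [] m \<le> B [?e2,?e2]" using le[of "?b * c [] m"] B[of "[?e2,?e2]" m] e2[of "[]" m] c0 by (simp add: mult.assoc)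
    moreover have "?a * (?b * c [] m) \<le> B [?e1,?e1,?e2,?e2]"
    proof -
      have "?a * (?b * c [] m) \<le> ?a * (4 * pi\<^sup>2 * (?b * c [] m))"
        using le[of "?b * c [] m"] c0 by (intro mult_left_mono) auto
      also have "\<dots> \<le> 4 * pi\<^sup>2 * (?a * (4 * pi\<^sup>2 * (?b * c [] m)))" using c0 by (intro le) auto
      also have "\<dots> = c [?e1,?e1,?e2,?e2] m" using e1[of "[?e2,?e2]" m] e2[of "[]" m] by (simp add: mult.assoc)
      also have "\<dots> \<le> B [?e1,?e1,?e2,?e2]" by (rule B)
      finally show ?thesis .
    qed
    moreover have "c [] m \<le> B []" by (rule B)
    ultimately have "c [] m * ((1 + ?a) * (1 + ?b)) \<le> C" unfolding C_def by (simp add: algebra_simps)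
    moreover have "(1 + ?a) * (1 + ?b) > 0" by (intro mult_pos_pos add_pos_nonneg) auto
    ultimately show ?thesis by (simp add: pos_le_divide_eq)
  qed
  then have "(\<lambda>m. norm (fc (\<lambda>x. complex_of_real (V x)) m)) summable_on UNIV"
    unfolding c_def dd.simps
    using Infinite_Sum.abs_summable_on_comparison_test'[OF summable_on_cmult_right[OF summable_on_int_pair, of C], of "fc (\<lambda>x. complex_of_real (V x))"] by blast
  then show ?thesis .
qed

lemma usq_representative: "\<exists>y m. y \<in> usq \<and> x = y + zshift m"
proof (intro exI conjI)
  let ?m = "(\<lfloor>fst x\<rfloor>, \<lfloor>snd x\<rfloor>)"
  show "x - zshift ?m \<in> usq"
    unfolding usq_def zshift_def cbox_Pair_eq
    by (cases x) (auto, linarith+)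
qed auto

text \<open>The series converges uniformly to a continuous \<open>g\<close>. Parseval's identity for
  \<open>f\<close> and the uniform tail for \<open>g\<close> show that they coincide in L2, hence on
  the square by continuity, hence everywhere by periodicity.\<close>

lemma fourier_series:
  assumes f: "continuous_on UNIV f" and p: "periodic f" and s: "(\<lambda>m. cmod (fc f m)) summable_on UNIV"
  shows "((\<lambda>m. fc f m * ek m x) has_sum f x) UNIV"
proof -
  obtain A where A: "((\<lambda>m. cmod (fc f m)) has_sum A) UNIV" using s by (auto simp: summable_on_def)
  define g where "g = (\<lambda>x. \<Sum>\<^sub>\<infinity>m. fc f m * ek m x)"
  define sK where "sK = (\<lambda>K x. \<Sum>m\<in>K. fc f m * ek m x)"
  have t: "cmod (g x - sK K x) \<le> A - (\<Sum>m\<in>K. cmod (fc f m))" if "finite K" for K x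
    unfolding g_def sK_def by (rule norm_infsum_tail[OF A _ that]) (simp add: norm_mult)
  have tail: "((\<lambda>K. A - (\<Sum>m\<in>K. cmod (fc f m))) \<longlongrightarrow> A - A) (finite_subsets_at_top UNIV)"
    using A unfolding has_sum_def by (intro tendsto_intros)
  have u: "uniform_limit UNIV sK g (finite_subsets_at_top UNIV)"
    unfolding uniform_limit_iff
  proof (intro allI impI)
    fix e :: real assume "e > 0"
    then have "\<forall>\<^sub>F K in finite_subsets_at_top UNIV. A - (\<Sum>m\<in>K. cmod (fc f m)) < e"
      using order_tendstoD(2)[OF tail, of e] by simp
    moreover have "\<forall>\<^sub>F K in finite_subsets_at_top UNIV. finite (K :: (int\<times>int) set)"
      by (rule eventually_finite_subsets_at_top_weakI) auto
    ultimately show "\<forall>\<^sub>F K in finite_subsets_at_top UNIV. \<forall>x\<in>UNIV. dist (sK K x) (g x) < e"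
    proof eventually_elim
      case (elim K)
      show ?case
      proof
        fix x 
        show "dist (sK K x) (g x) < e" using t[OF elim(2), of x] elim(1) by (simp add: dist_norm norm_minus_commute)
      qed
    qed
  qed
  have gc: "continuous_on UNIV g"
    by (rule uniform_limit_theorem[OF _ u])
      (auto simp: sK_def intro!: continuous_intros always_eventually)
  have Lf: "L2T f" "L2T g" "L2T (sK K)" for K
    using f gc by (auto simp: sK_def intro!: L2T_continuous continuous_intros intro: continuous_on_subset)
  have "((\<lambda>K. (\<Sum>m\<in>K. (cmod (fc f m))\<^sup>2)) \<longlongrightarrow> (normT f)\<^sup>2) (finite_subsets_at_top UNIV)"
    using parseval_norm[OF Lf(1)] by (simp add: has_sum_def)
  then have "((\<lambda>K. 2 * ((normT f)\<^sup>2 - (\<Sum>m\<in>K. (cmod (fc f m))\<^sup>2)) + 2 * (A - (\<Sum>m\<in>K. cmod (fc f m)))\<^sup>2) 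
      \<longlongrightarrow> 2 * ((normT f)\<^sup>2 - (normT f)\<^sup>2) + 2 * (A - A)\<^sup>2) (finite_subsets_at_top UNIV)"
    by (intro tendsto_intros tail)
  moreover {fix K :: "(int\<times>int) set" assume K: "finite K"
  have "(normT (\<lambda>x. f x - g x))\<^sup>2 \<le> 2 * ((normT f)\<^sup>2 - (\<Sum>m\<in>K. (cmod (fc f m))\<^sup>2)) + 2 * (A - (\<Sum>m\<in>K. cmod (fc f m)))\<^sup>2"
  proof -
    have "(normT (\<lambda>x. (f x - sK K x) + (sK K x - g x)))\<^sup>2 \<le> 2 * (normT (\<lambda>x. f x - sK K x))\<^sup>2 + 2 * (normT (\<lambda>x. sK K x - g x))\<^sup>2"
      by (intro normT_sq_add_le L2T_diff Lf)
    moreover have "(normT (\<lambda>x. f x - sK K x))\<^sup>2 = (normT f)\<^sup>2 - (\<Sum>m\<in>K. (cmod (fc f m))\<^sup>2)"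
      using normT_sq_diff_trig[OF Lf(1) K, of "fc f"] unfolding sK_def by simp
    moreover have "(normT (\<lambda>x. sK K x - g x))\<^sup>2 \<le> (A - (\<Sum>m\<in>K. cmod (fc f m)))\<^sup>2"
      using t[OF K] by (intro normT_le_bound L2T_diff Lf) (simp add: norm_minus_commute)
    ultimately show ?thesis by simp
  qed }
  then have "\<forall>\<^sub>F K in finite_subsets_at_top UNIV. (normT (\<lambda>x. f x - g x))\<^sup>2 \<le> 2 * ((normT f)\<^sup>2 - (\<Sum>m\<in>K. (cmod (fc f m))\<^sup>2)) + 2 * (A - (\<Sum>m\<in>K. cmod (fc f m)))\<^sup>2"
    by (intro eventually_finite_subsets_at_top_weakI)
  ultimately have "(normT (\<lambda>x. f x - g x))\<^sup>2 \<le> 2 * ((normT f)\<^sup>2 - (normT f)\<^sup>2) + 2 * (A - A)\<^sup>2"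
    using finite_subsets_at_top_neq_bot by (rule tendsto_lowerbound)
  then have "(normT (\<lambda>x. f x - g x))\<^sup>2 \<le> 0" by simp
  then have "(LINT x|MT. (cmod (f x - g x))\<^sup>2) = 0" 
    using normT_sq[of "\<lambda>x. f x - g x"] zero_le_power2[of "normT (\<lambda>x. f x - g x)"] by linarith
  moreover have cc: "continuous_on usq (\<lambda>x. (cmod (f x - g x))\<^sup>2)"
    using f gc by (intro continuous_intros) (auto intro: continuous_on_subset)
  ultimately have "integral usq (\<lambda>x. (cmod (f x - g x))\<^sup>2) = 0"
    using lebesgue_integral_eq_integral[OF continuous_integrable_MT[OF cc]] by simp
  moreover have "box (0,0) (1,1::real) \<noteq> ({}::pt set)" by (simp add: box_ne_empty Basis_prod_def)
  ultimately have "\<forall>y\<in>usq. (cmod (f y - g y))\<^sup>2 = 0"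
    using integral_cbox_eq_0_iff[of "(0,0)::pt" "(1,1)" "\<lambda>x. (cmod (f x - g x))\<^sup>2"] cc
    unfolding usq_def by simp
  then have fg: "f y = g y" if "y \<in> usq" for y using that by simp
  obtain y m where y: "y \<in> usq" "x = y + zshift m" using usq_representative by blast
  have "f x = f y" using p unfolding y(2) periodic_def by blast
  moreover have "g x = g y" unfolding g_def y(2) by (simp add: ek_shift)
  ultimately have "f x = g x" using fg y by simp
  then show ?thesis unfolding g_def
    using abs_summable_summable[of "\<lambda>m. fc f m * ek m x" UNIV] s by (simp add: norm_mult)
qed

text \<open>Parseval's identity for \<open>u\<close> and the product of \<open>ek k\<close> and
  \<open>V\<close>. As \<open>V\<close> is real, its coefficients at m and -m are conjugate, which
  turns the pairing into a convolution.\<close>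

lemma fc_product:
  fixes V :: "pt \<Rightarrow> real"
  assumes V: "continuous_on usq V" and u: "L2T u"
  shows "((\<lambda>m. fc (\<lambda>x. complex_of_real (V x)) m * fc u (k - m)) has_sum 
    fc (\<lambda>x. complex_of_real (V x) * u x) k) UNIV"
proof -
  let ?V = "\<lambda>x. complex_of_real (V x)"
  have L: "L2T (\<lambda>x. ek k x * ?V x)" by (intro L2T_continuous continuous_intros V)
  have "((\<lambda>j. cnj (fc ?V (j - k)) * fc u j) has_sum innerT (\<lambda>x. ek k x * ?V x) u) UNIV"
    using parseval[OF L u] by (simp add: fc_ek_mult)
  moreover have "innerT (\<lambda>x. ek k x * ?V x) u = fc (\<lambda>x. ?V x * u x) k"
    by (simp add: fc_def innerT_def mult.assoc)
  moreover have "cnj (fc ?V m) = fc ?V (- m)" for m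
    unfolding fc_def innerT_commute[symmetric] by (simp add: innerT_def ek_minus mult.commute)
  ultimately have "((\<lambda>j. fc ?V (k - j) * fc u j) has_sum fc (\<lambda>x. ?V x * u x) k) UNIV" by simp
  then show ?thesis
    by (subst (asm) has_sum_reindex_bij_witness[of UNIV "\<lambda>m. k - m" "\<lambda>m. k - m" UNIV]) auto
qed

section \<open>Averages along a rational direction\<close>

text \<open>Phrased by a determinant, so that the frequency 0 counts as parallel to every
  direction.\<close>

definition par :: "int \<times> int \<Rightarrow> int \<times> int \<Rightarrow> bool" where
  "par v m \<longleftrightarrow> fst v * snd m = snd v * fst m"

lemma inner_zshift_vperp: "zshift m \<bullet> zshift (vperp v) = real_of_int (fst v * snd m - snd v * fst m)"
  by (simp add: zshift_def vperp_def inner_prod_def)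

lemma par_iff_inner: "par v m \<longleftrightarrow> zshift m \<bullet> zshift (vperp v) = 0"
  unfolding inner_zshift_vperp par_def of_int_eq_0_iff by auto

lemma par_primitive:
  assumes v: "primitive v" and p: "par v m"
  obtains n where "m = (n * fst v, n * snd v)"
proof -
  obtain a b where ab: "a * fst v + b * snd v = 1"
    using bezout_int[of "fst v" "snd v"] v unfolding primitive_def by metis
  \<comment> \<open>The Bezout coefficients of \<open>v\<close> define a linear form with value 1 at
    \<open>v\<close>; its value at \<open>m\<close> is the multiple sought.\<close>
  define n where "n = a * fst m + b * snd m"
  have "n * fst v = a * fst v * fst m + b * (fst v * snd m)" by (simp add: n_def algebra_simps)
  also have "\<dots> = (a * fst v + b * snd v) * fst m" using p unfolding par_def by (simp add: algebra_simps)
  finally have 1: "n * fst v = fst m" using ab by simp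
  have "n * snd v = a * (snd v * fst m) + b * snd v * snd m" by (simp add: n_def algebra_simps)
  also have "\<dots> = (a * fst v + b * snd v) * snd m" using p unfolding par_def by (simp add: algebra_simps flip: par_def)
  finally have 2: "n * snd v = snd m" using ab by simp
  show ?thesis using that[of n] 1 2 by (simp add: prod_eq_iff)
qed

lemma primitive_nz: "primitive v \<Longrightarrow> v \<noteq> 0"
  by (auto simp: primitive_def)

lemma zshift_eq_0: "zshift v = 0 \<longleftrightarrow> v = 0"
  by (cases v) (auto simp: zshift_def zero_prod_def)

lemma Lv_pos: "primitive v \<Longrightarrow> Lv v > 0"
  using primitive_nz zshift_eq_0 by (auto simp: Lv_def)

lemma Lv_sq: "(Lv v)\<^sup>2 = zshift v \<bullet> zshift v"
  by (simp add: Lv_def power2_norm_eq_inner)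

lemma interval_integral_continuous:
  fixes f :: "real \<Rightarrow> 'b::euclidean_space"
  assumes "a \<le> b" "continuous_on {a..b} f" shows "(LBINT t=a..b. f t) = integral {a..b} f"
  using assms by (intro interval_integral_eq_integral borel_integrable_atLeastAtMost') auto

text \<open>Whatever \<open>L\<close> is, the point moves by the lattice vector
  \<open>vperp v\<close> over [0,L], so the character returns to its initial value. It is constant
  on the way if \<open>m\<close> is orthogonal to that vector; otherwise it is the derivative of a
  multiple of itself.\<close>

lemma average_ek:
  assumes L: "(L::real) > 0"
  shows "integral {0..L} (\<lambda>t. ek m (x + (t / L) *\<^sub>R zshift (vperp v))) = (if par v m then L * ek m x else 0)"
proof -
  have e: "x + (t / L) *\<^sub>R zshift (vperp v) = x + t *\<^sub>R ((1 / L) *\<^sub>R zshift (vperp v))" for t by simp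
  show ?thesis
  proof (cases "par v m")
    case True
    then have "ek m (x + (t / L) *\<^sub>R zshift (vperp v)) = ek m x" for t
      unfolding ek_shift by (simp add: ek_cis par_iff_inner)
    then show ?thesis using L True by (simp add: scaleR_conv_of_real)
  next
    case False
    let ?v = "(1 / L) *\<^sub>R zshift (vperp v)"
    let ?c = "2 * pi * \<i> * complex_of_real (zshift m \<bullet> ?v)"
    have "((\<lambda>t. ?c * ek m (x + t *\<^sub>R ?v)) has_integral ek m (x + L *\<^sub>R ?v) - ek m (x + 0 *\<^sub>R ?v)) {0..L}"
      using L by (intro fundamental_theorem_of_calculus ek_has_vector_derivative) auto
    moreover have "ek m (x + L *\<^sub>R ?v) = ek m x" using L by (simp add: ek_shift)
    ultimately have "((\<lambda>t. ?c * ek m (x + t *\<^sub>R ?v)) has_integral 0) {0..L}" by simp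
    from integral_unique[OF this] have "?c * integral {0..L} (\<lambda>t. ek m (x + t *\<^sub>R ?v)) = 0" by simp
    moreover have "?c \<noteq> 0" using False L by (simp add: par_iff_inner)
    ultimately show ?thesis using False unfolding e by simp
  qed
qed

text \<open>Averaging is exact on Fourier partial sums, where it keeps precisely the frequencies
  parallel to \<open>v\<close>; the remainder is bounded uniformly by the tail of the
  coefficients.\<close>

lemma Iv0_has_sum:
  fixes V :: "pt \<Rightarrow> real"
  assumes V: "continuous_on UNIV V" and p: "periodic V" 
    and s: "(\<lambda>m. cmod (fc (\<lambda>x. complex_of_real (V x)) m)) summable_on UNIV"
    and v: "primitive v"
  shows "((\<lambda>m. if par v m then fc (\<lambda>x. complex_of_real (V x)) m * ek m x else 0) has_sum complex_of_real (Iv0 v V x)) UNIV"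
proof -
  let ?V = "\<lambda>x. complex_of_real (V x)"
  let ?L = "Lv v"
  let ?y = "\<lambda>t. x + (t / ?L) *\<^sub>R zshift (vperp v)"
  have L: "?L > 0" by (rule Lv_pos[OF v])
  obtain A where A: "((\<lambda>m. cmod (fc ?V m)) has_sum A) UNIV" using s by (auto simp: summable_on_def)
  have Vc: "continuous_on UNIV ?V" by (intro continuous_intros V)
  have Vp: "periodic ?V" using p by (simp add: periodic_def)
  have ci: "continuous_on {0..?L} (\<lambda>t. f (?y t))" if "continuous_on UNIV f" for f :: "pt \<Rightarrow> 'z::topological_space"
    using L by (intro continuous_on_compose2[OF that] continuous_intros) auto
  have I: "complex_of_real (Iv0 v V x) = (1 / ?L) * integral {0..?L} (\<lambda>t. ?V (?y t))"
  proof -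
    have "complex_of_real (Iv0 v V x) = (1 / ?L) * (LBINT t=0..?L. ?V (?y t))"
      unfolding Iv0_def by (simp add: interval_lebesgue_integral_of_real)
    also have "(LBINT t=0..?L. ?V (?y t)) = integral {0..?L} (\<lambda>t. ?V (?y t))"
      using interval_integral_continuous[OF _ ci[OF Vc]] L by (simp add: zero_ereal_def)
    finally show ?thesis .
  qed
  show ?thesis
  proof (rule has_sum_by_tail[OF A, of _ _ 1])
    fix K :: "(int\<times>int) set" assume K: "finite K"
    let ?s = "\<lambda>y. \<Sum>m\<in>K. fc ?V m * ek m y"
    have t: "cmod (?V y - ?s y) \<le> A - (\<Sum>m\<in>K. cmod (fc ?V m))" for y
      using norm_infsum_tail[OF A _ K, of "\<lambda>m. fc ?V m * ek m y"] infsumI[OF fourier_series[OF Vc Vp s, of y]]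
      by (simp add: norm_mult)
    have sc: "continuous_on UNIV ?s" by (intro continuous_intros)
    have "(1 / ?L) * integral {0..?L} (\<lambda>t. ?s (?y t)) = (\<Sum>m\<in>K. if par v m then fc ?V m * ek m x else 0)"
    proof -
      have "integral {0..?L} (\<lambda>t. ?s (?y t)) = (\<Sum>m\<in>K. fc ?V m * integral {0..?L} (\<lambda>t. ek m (?y t)))"
        by (subst integral_sum[OF K]) (auto intro!: integrable_continuous_real ci continuous_intros continuous_ek)
      then show ?thesis using L by (auto simp: average_ek sum_distrib_left intro!: sum.cong)
    qed
    then have "complex_of_real (Iv0 v V x) - (\<Sum>m\<in>K. if par v m then fc ?V m * ek m x else 0)
      = (1 / ?L) * integral {0..?L} (\<lambda>t. ?V (?y t) - ?s (?y t))"
      unfolding I by (subst Henstock_Kurzweil_Integration.integral_diff) 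
        (auto intro!: integrable_continuous_real ci[OF Vc] ci[OF sc] simp: right_diff_distrib)
    also have "cmod \<dots> = (1 / ?L) * cmod (integral {0..?L} (\<lambda>t. ?V (?y t) - ?s (?y t)))"
      using L by (simp add: norm_mult norm_divide)
    also have "\<dots> \<le> (1 / ?L) * ((A - (\<Sum>m\<in>K. cmod (fc ?V m))) * (?L - 0))"
      using L by (intro mult_left_mono integral_bound) (auto intro!: continuous_intros ci[OF Vc] ci[OF sc] t)
    also have "\<dots> = 1 * (A - (\<Sum>m\<in>K. cmod (fc ?V m)))" using L by simp
    finally show "cmod (complex_of_real (Iv0 v V x) - (\<Sum>m\<in>K. if par v m then fc ?V m * ek m x else 0)) \<le> 1 * (A - (\<Sum>m\<in>K. cmod (fc ?V m)))" .
  qed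
qed

text \<open>Symbols of this product form pass unchanged through the averaging, so the hypothesis on
  the measures speaks about them directly.\<close>

lemma Iv_ek:
  assumes v: "primitive v" and p: "par v m"
  shows "Iv v (\<lambda>y \<eta>. ek m y * g \<eta>) x \<eta> = ek m x * g \<eta>"
proof -
  have L: "Lv v > 0" by (rule Lv_pos[OF v])
  have "ek m (x + (t / Lv v) *\<^sub>R zshift (vperp v)) = ek m x" for t
    unfolding ek_shift using p by (simp add: ek_cis par_iff_inner)
  then show ?thesis unfolding Iv_def using L 
    interval_integral_continuous[of 0 "Lv v" "\<lambda>t. ek m x * g \<eta>"] by (simp add: zero_ereal_def)
qed

text \<open>Multiplication by \<open>ek m\<close> sends the frequency \<open>k\<close> to
  \<open>k + m\<close>, so the double sum of matrix coefficients collapses to one shifted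
  diagonal.\<close>

lemma op_quad_ek:
  "op_quad h (\<lambda>x \<xi>. ek m x * G \<xi>) f = (\<Sum>\<^sub>\<infinity>k. cnj (fc f (k + m)) * G ((2 * pi * h) *\<^sub>R zshift k) * fc f k)"
proof -
  have s: "sym_fc (\<lambda>x \<xi>. ek m x * G \<xi>) j \<xi> = (if j = m then G \<xi> else 0)" for j \<xi>
    using fc_cmult[of "G \<xi>" "ek m" j] by (simp add: sym_fc_def fc_ek mult.commute)
  have "op_quad h (\<lambda>x \<xi>. ek m x * G \<xi>) f = (\<Sum>\<^sub>\<infinity>(j,k)\<in>range (\<lambda>k. (k + m, k)). cnj (fc f j) * G ((2 * pi * h) *\<^sub>R zshift k) * fc f k)"
    unfolding op_quad_def s by (rule infsum_cong_neutral) (auto simp: image_iff algebra_simps)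
  also have "\<dots> = (\<Sum>\<^sub>\<infinity>k. cnj (fc f (k + m)) * G ((2 * pi * h) *\<^sub>R zshift k) * fc f k)"
    by (subst infsum_reindex) (auto simp: inj_on_def o_def)
  finally show ?thesis .
qed

section \<open>Oscillatory Dyson expansions\<close>

text \<open>All evolutions are rescaled to [0,1]; the final time enters through the phases and the
  coupling, which treats negative times as well.\<close>

abbreviation deriv01 :: "(real \<Rightarrow> 'b::real_normed_vector) \<Rightarrow> (real \<Rightarrow> 'b) \<Rightarrow> bool" where
  "deriv01 f f' \<equiv> (\<forall>s\<in>{0..1}. (f has_vector_derivative f' s) (at s within {0..1}))"

text \<open>The mean value inequality against a scalar majorant: a bound on a derivative is
  integrated by exhibiting a primitive of the bound.\<close>

lemma deriv01_bound:
  fixes f :: "real \<Rightarrow> 'b::real_normed_vector" and \<phi> :: "real \<Rightarrow> real"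
  assumes f: "deriv01 f f'" and p: "deriv01 \<phi> \<phi>'" and b: "\<And>s. s \<in> {0..1} \<Longrightarrow> norm (f' s) \<le> \<phi>' s"
    and s: "s \<in> {0..1}"
  shows "norm (f s - f 0) \<le> \<phi> s - \<phi> 0"
proof (cases "s = 0")
  case False
  with s have s0: "0 < s" "s \<le> 1" by auto
  have at: "at x within {0..1} = at x" if "0 < x" "x < s" for x
    using that s0 by (intro at_within_Icc_at) auto
  have cf: "continuous_on {0..1} f" "continuous_on {0..1} \<phi>"
    using f p by (auto intro!: continuous_on_vector_derivative)
  show ?thesis
  proof (rule differentiable_bound_general[OF s0(1)])
    show "continuous_on {0..s} f" "continuous_on {0..s} \<phi>"
      using cf s0 by (auto elim: continuous_on_subset)
    show "(f has_vector_derivative f' x) (at x)" if "0 < x" "x < s" for x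
      using f at[OF that] that s0 by (metis atLeastAtMost_iff less_eq_real_def order_trans)
    show "(\<phi> has_vector_derivative \<phi>' x) (at x)" if "0 < x" "x < s" for x
      using p at[OF that] that s0 by (metis atLeastAtMost_iff less_eq_real_def order_trans)
    show "norm (f' x) \<le> \<phi>' x" if "0 < x" "x < s" for x using b[of x] that s0 by auto
  qed
qed simp

section \<open>Iterated oscillatory integrals: stability and decay\<close>

text \<open>A word lists frequencies from the latest to the earliest time, and \<open>\<theta> m k\<close> is the phase of the
  jump from \<open>k\<close> to \<open>k + m\<close>.\<close>

fun osc_int :: "('g::ab_group_add \<Rightarrow> 'g \<Rightarrow> real) \<Rightarrow> 'g list \<Rightarrow> real \<Rightarrow> 'g \<Rightarrow> complex" where
  "osc_int \<theta> [] s k = 1"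
| "osc_int \<theta> (m # w) s k = integral {0..s} (\<lambda>r. cis (r * \<theta> m (k + sum_list w)) * osc_int \<theta> w r k)"

lemma continuous_osc_int: "continuous_on {0..1} (\<lambda>s. osc_int \<theta> w s k)"
proof (induction w)
  case (Cons m w)
  then have "continuous_on {0..1} (\<lambda>r. cis (r * \<theta> m (k + sum_list w)) * osc_int \<theta> w r k)"
    by (intro continuous_intros)
  then show ?case by (auto intro!: indefinite_integral_continuous_1 integrable_continuous_real)
qed simp

lemma deriv01_osc_int:
  "deriv01 (\<lambda>s. osc_int \<theta> (m # w) s k) (\<lambda>s. cis (s * \<theta> m (k + sum_list w)) * osc_int \<theta> w s k)"
proof
  fix s :: real assume s: "s \<in> {0..1}"
  have "continuous_on {0..1} (\<lambda>r. cis (r * \<theta> m (k + sum_list w)) * osc_int \<theta> w r k)"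
    by (intro continuous_intros continuous_osc_int)
  from integral_has_vector_derivative[OF this s]
  show "((\<lambda>s. osc_int \<theta> (m # w) s k) has_vector_derivative cis (s * \<theta> m (k + sum_list w)) * osc_int \<theta> w s k) (at s within {0..1})"
    by simp
qed

lemma osc_int_0 [simp]: "osc_int \<theta> w 0 k = (if w = [] then 1 else 0)"
  by (cases w) auto

lemma deriv01_linear: "deriv01 (\<lambda>s. c * s) (\<lambda>s. c)" for c :: real
  by (auto intro!: derivative_eq_intros)

lemma norm_osc_int_le: "s \<in> {0..1} \<Longrightarrow> cmod (osc_int \<theta> w s k) \<le> 1"
proof (induction w arbitrary: s)
  case (Cons m w)
  have "cmod (osc_int \<theta> (m # w) s k - osc_int \<theta> (m # w) 0 k) \<le> 1 * s - 1 * 0"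
    by (rule deriv01_bound[OF deriv01_osc_int deriv01_linear _ Cons.prems]) (use Cons.IH in \<open>auto simp: norm_mult\<close>)
  then show ?case using Cons.prems by simp
qed simp

text \<open>Each letter is compared at the frequency reached by the letters after it in the list,
  which act earlier in time.\<close>

fun osc_err :: "('g::ab_group_add \<Rightarrow> 'g \<Rightarrow> real) \<Rightarrow> 'g \<Rightarrow> ('g \<Rightarrow> 'g \<Rightarrow> real) \<Rightarrow> 'g \<Rightarrow> 'g list \<Rightarrow> real" where
  "osc_err \<theta> k \<theta>' k' [] = 0"
| "osc_err \<theta> k \<theta>' k' (m # w) = \<bar>\<theta> m (k + sum_list w) - \<theta>' m (k' + sum_list w)\<bar> + osc_err \<theta> k \<theta>' k' w"

lemma norm_cis_diff_le: "cmod (cis a - cis b) \<le> \<bar>a - b\<bar>"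
proof -
  have "cis a - cis b = cis b * (exp (\<i> * complex_of_real (a - b)) - 1)"
    by (simp add: algebra_simps cis_conv_exp flip: exp_add)
  then have "cmod (cis a - cis b) = 2 * \<bar>sin ((a - b) / 2)\<bar>"
    using dist_exp_i_1[of "a - b"] by (simp add: norm_mult)
  also have "\<dots> \<le> \<bar>a - b\<bar>" using abs_sin_x_le_abs_x[of "(a - b) / 2"] by simp
  finally show ?thesis .
qed

text \<open>The integrands differ by a difference of phase factors times a bounded integral, plus a
  phase factor times a difference for the shorter word; times are at most 1, so the letterwise
  errors add up.\<close>

lemma osc_int_diff_le:
  "s \<in> {0..1} \<Longrightarrow> cmod (osc_int \<theta> w s k - osc_int \<theta>' w s k') \<le> osc_err \<theta> k \<theta>' k' w"
proof (induction w arbitrary: s)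
  case (Cons m w)
  let ?a = "\<theta> m (k + sum_list w)" and ?b = "\<theta>' m (k' + sum_list w)" and ?d = "osc_err \<theta> k \<theta>' k' (m # w)"
  have d: "deriv01 (\<lambda>s. osc_int \<theta> (m # w) s k - osc_int \<theta>' (m # w) s k') 
     (\<lambda>s. cis (s * ?a) * osc_int \<theta> w s k - cis (s * ?b) * osc_int \<theta>' w s k')"
    using deriv01_osc_int[of \<theta> m w k] deriv01_osc_int[of \<theta>' m w k'] by (auto intro!: has_vector_derivative_diff)
  have "norm ((osc_int \<theta> (m # w) s k - osc_int \<theta>' (m # w) s k') - (osc_int \<theta> (m # w) 0 k - osc_int \<theta>' (m # w) 0 k')) \<le> ?d * s - ?d * 0"
  proof (rule deriv01_bound[OF d deriv01_linear _ Cons.prems])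
    fix r :: real assume r: "r \<in> {0..1}"
    have "cis (r * ?a) * osc_int \<theta> w r k - cis (r * ?b) * osc_int \<theta>' w r k' =
      (cis (r * ?a) - cis (r * ?b)) * osc_int \<theta> w r k + cis (r * ?b) * (osc_int \<theta> w r k - osc_int \<theta>' w r k')"
      by (simp add: algebra_simps)
    also have "cmod \<dots> \<le> \<bar>r * ?a - r * ?b\<bar> * 1 + 1 * osc_err \<theta> k \<theta>' k' w"
      unfolding norm_mult
    proof (intro order_trans[OF norm_triangle_ineq] add_mono)
      show "cmod ((cis (r * ?a) - cis (r * ?b)) * osc_int \<theta> w r k) \<le> \<bar>r * ?a - r * ?b\<bar> * 1"
        unfolding norm_mult using r by (intro mult_mono norm_cis_diff_le norm_osc_int_le) auto
      show "cmod (cis (r * ?b) * (osc_int \<theta> w r k - osc_int \<theta>' w r k')) \<le> 1 * osc_err \<theta> k \<theta>' k' w"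
        using Cons.IH[OF r] by (simp add: norm_mult)
    qed
    also have "\<bar>r * ?a - r * ?b\<bar> = r * \<bar>?a - ?b\<bar>" using r by (simp add: abs_mult flip: right_diff_distrib)
    also have "r * \<bar>?a - ?b\<bar> \<le> 1 * \<bar>?a - ?b\<bar>" using r by (intro mult_right_mono) auto
    finally show "cmod (cis (r * ?a) * osc_int \<theta> w r k - cis (r * ?b) * osc_int \<theta>' w r k') \<le> ?d" by simp
  qed
  moreover have "?d * s \<le> ?d * 1"
  proof -
    have "osc_err \<theta> k \<theta>' k' w \<ge> 0" for w by (induction w) auto
    then show ?thesis using Cons.prems by (intro mult_left_mono) (auto simp del: osc_err.simps)
  qed
  ultimately show ?case by (simp del: osc_int.simps osc_err.simps)
qed simp

text \<open>One nonzero phase suffices, even if phases of different letters cancel. At the earliest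
  occurrence of \<open>m\<close> one integrates by parts in its own time variable; the later
  integrations run over intervals of length at most 1 and preserve the bound. The constant 3 counts
  two boundary terms and the remaining integral.\<close>

lemma osc_int_decay:
  assumes m: "m \<in> set w" and p: "p m \<noteq> 0" 
  shows "s \<in> {0..1} \<Longrightarrow> cmod (osc_int (\<lambda>m k. p m) w s k) \<le> 3 / \<bar>p m\<bar>"
  using m
proof (induction w arbitrary: s)
  case (Cons m' w)
  let ?\<theta> = "\<lambda>m k. p m"
  have p0: "3 / \<bar>p m\<bar> \<ge> 0" by simp
  show ?case
  proof (cases "m \<in> set w")
    case True
    have "cmod (osc_int ?\<theta> (m' # w) s k - osc_int ?\<theta> (m' # w) 0 k) \<le> (3 / \<bar>p m\<bar>) * s - (3 / \<bar>p m\<bar>) * 0"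
      by (rule deriv01_bound[OF deriv01_osc_int deriv01_linear _ Cons.prems(1)]) (use Cons.IH True in \<open>auto simp: norm_mult\<close>)
    also have "\<dots> \<le> (3 / \<bar>p m\<bar>) * 1" using Cons.prems(1) mult_left_mono[OF _ p0, of s 1] by simp
    finally show ?thesis by simp
  next
    case False
    then have mm: "m' = m" using Cons.prems by simp
    \<comment> \<open>The integral of the tail has a derivative bounded by 1: zero for the empty
      tail, and otherwise a phase factor times a shorter integral.\<close>
    obtain g where g: "deriv01 (\<lambda>s. osc_int ?\<theta> w s k) g" and gb: "\<And>s. s \<in> {0..1} \<Longrightarrow> cmod (g s) \<le> 1"
    proof (cases w)
      case Nil
      then show ?thesis by (intro that[of "\<lambda>_. 0"]) auto
    next
      case c: (Cons a v)
      show ?thesis unfolding c 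
        by (rule that[unfolded c, OF deriv01_osc_int]) (auto simp: norm_mult norm_osc_int_le)
    qed
    let ?E = "\<lambda>s. cis (s * p m) / (\<i> * complex_of_real (p m))"
    \<comment> \<open>Subtracting the boundary term leaves only the part of the derivative that
      falls on the tail.\<close>
    let ?F = "\<lambda>s. osc_int ?\<theta> (m # w) s k - ?E s * osc_int ?\<theta> w s k"
    have E: "deriv01 ?E (\<lambda>s. cis (s * p m))"
    proof
      fix s :: real
      have "((\<lambda>z. exp (\<i> * (z * complex_of_real (p m))) / (\<i> * complex_of_real (p m))) has_field_derivative exp (\<i> * (complex_of_real s * complex_of_real (p m)))) (at (complex_of_real s))"
        using p by (auto intro!: derivative_eq_intros simp: field_simps)
      from has_vector_derivative_real_field[OF this, of "{0..1}"]
      show "(?E has_vector_derivative cis (s * p m)) (at s within {0..1})"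
        by (simp add: cis_conv_exp field_simps)
    qed
    have "deriv01 ?F (\<lambda>s. cis (s * p m) * osc_int ?\<theta> w s k - (?E s * g s + cis (s * p m) * osc_int ?\<theta> w s k))"
    proof
      fix s :: real assume s: "s \<in> {0..1}"
      show "(?F has_vector_derivative cis (s * p m) * osc_int ?\<theta> w s k - (?E s * g s + cis (s * p m) * osc_int ?\<theta> w s k)) (at s within {0..1})"
        by (intro has_vector_derivative_diff has_vector_derivative_mult deriv01_osc_int[THEN bspec] E[THEN bspec] g[THEN bspec] s)
    qed
    then have F: "deriv01 ?F (\<lambda>s. - (?E s * g s))" by simp
    have nE: "cmod (?E s) = 1 / \<bar>p m\<bar>" for s by (simp add: norm_divide norm_mult)
    have "cmod (?F s - ?F 0) \<le> (1 / \<bar>p m\<bar>) * s - (1 / \<bar>p m\<bar>) * 0"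
    proof (rule deriv01_bound[OF F deriv01_linear _ Cons.prems(1)])
      fix r :: real assume "r \<in> {0..1}"
      then have "cmod (?E r) * cmod (g r) \<le> (1 / \<bar>p m\<bar>) * 1" unfolding nE using gb by (intro mult_left_mono) auto
      then show "cmod (- (?E r * g r)) \<le> 1 / \<bar>p m\<bar>" by (simp only: norm_mult norm_minus_cancel mult_1_right)
    qed
    also have "\<dots> \<le> 1 / \<bar>p m\<bar>" using Cons.prems(1) mult_left_mono[of s 1 "1 / \<bar>p m\<bar>"] by simp
    finally have 1: "cmod (?F s - ?F 0) \<le> 1 / \<bar>p m\<bar>" .
    have 2: "cmod (?E r * osc_int ?\<theta> w r k) \<le> 1 / \<bar>p m\<bar>" if "r \<in> {0..1}" for r
      using mult_left_mono[OF norm_osc_int_le[OF that, of ?\<theta> w k], of "1 / \<bar>p m\<bar>"] unfolding norm_mult nE by simp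
    have "osc_int ?\<theta> (m # w) s k = (?F s - ?F 0) + ?E s * osc_int ?\<theta> w s k + (- (?E 0 * osc_int ?\<theta> w 0 k))"
      by (simp del: osc_int.simps)
    also have "cmod \<dots> \<le> 1 / \<bar>p m\<bar> + 1 / \<bar>p m\<bar> + 1 / \<bar>p m\<bar>"
      by (intro order_trans[OF norm_triangle_ineq] add_mono 1 2 Cons.prems(1)) (subst norm_minus_cancel, rule 2, simp)
    finally show ?thesis unfolding mm by simp
  qed
qed simp

section \<open>Finite words and the truncated Dyson series\<close>

text \<open>The strict bound on the length makes \<open>words M 0\<close> empty, so that
  \<open>n\<close> counts Duhamel iterations starting from zero.\<close>

definition words :: "'g set \<Rightarrow> nat \<Rightarrow> 'g list set" where
  "words M n = {w. set w \<subseteq> M \<and> length w < n}"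

lemma finite_words: "finite M \<Longrightarrow> finite (words M n)"
  by (rule finite_subset[OF _ finite_lists_length_le[of M n]]) (auto simp: words_def)

lemma words_0 [simp]: "words M 0 = {}"
  by (simp add: words_def)

lemma words_Suc: "words M (Suc n) = insert [] ((\<lambda>(m, w). m # w) ` (M \<times> words M n))"
proof -
  have "w \<in> words M (Suc n) \<longleftrightarrow> w \<in> insert [] ((\<lambda>(m, w). m # w) ` (M \<times> words M n))" for w
    by (cases w) (auto simp: words_def)
  then show ?thesis by blast
qed

lemma sum_words_Suc:
  assumes "finite M"
  shows "(\<Sum>w\<in>words M (Suc n). f w) = f [] + (\<Sum>m\<in>M. \<Sum>w\<in>words M n. f (m # w))"
proof -
  have "(\<Sum>w\<in>words M (Suc n). f w) = f [] + (\<Sum>w\<in>(\<lambda>(m, w). m # w) ` (M \<times> words M n). f w)"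
    unfolding words_Suc using assms by (subst sum.insert) (auto simp: finite_words)
  also have "(\<Sum>w\<in>(\<lambda>(m, w). m # w) ` (M \<times> words M n). f w) = (\<Sum>m\<in>M. \<Sum>w\<in>words M n. f (m # w))"
    by (subst sum.reindex) (auto simp: inj_on_def o_def split_beta sum.cartesian_product)
  finally show ?thesis .
qed

definition word_coeff :: "('g \<Rightarrow> complex) \<Rightarrow> 'g list \<Rightarrow> complex" where
  "word_coeff c w = prod_list (map c w)"

lemma word_coeff_simps [simp]: "word_coeff c [] = 1" "word_coeff c (m # w) = c m * word_coeff c w"
  by (simp_all add: word_coeff_def)

definition dyson_sum :: "('g::ab_group_add \<Rightarrow> 'g \<Rightarrow> real) \<Rightarrow> ('g \<Rightarrow> complex) \<Rightarrow> 'g set \<Rightarrow> ('g \<Rightarrow> complex) \<Rightarrow> nat \<Rightarrow> real \<Rightarrow> 'g \<Rightarrow> complex" where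
  "dyson_sum \<theta> c M \<psi> n s k = (\<Sum>w\<in>words M n. word_coeff c w * osc_int \<theta> w s (k - sum_list w) * \<psi> (k - sum_list w))"

lemma dyson_sum_0 [simp]: "dyson_sum \<theta> c M \<psi> 0 s k = 0"
  by (simp add: dyson_sum_def)

lemma dyson_sum_at_0: "finite M \<Longrightarrow> dyson_sum \<theta> c M \<psi> (Suc n) 0 k = \<psi> k"
  unfolding dyson_sum_def by (subst sum_words_Suc) auto

text \<open>Differentiation removes the head of a word, its latest letter, and lowers the truncation
  by one: the truncated sums are the Picard iterates of the system with letters in
  \<open>M\<close>.\<close>

lemma deriv01_dyson_sum:
  assumes M: "finite M"
  shows "deriv01 (\<lambda>s. dyson_sum \<theta> c M \<psi> (Suc n) s k) (\<lambda>s. \<Sum>m\<in>M. c m * cis (s * \<theta> m (k - m)) * dyson_sum \<theta> c M \<psi> n s (k - m))"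
proof
  fix s :: real assume s: "s \<in> {0..1}"
  have e: "k - sum_list (m # w) + sum_list w = k - m" "k - sum_list (m # w) = k - m - sum_list w" for m w by (simp_all add: algebra_simps)
  have "((\<lambda>s. \<psi> k + (\<Sum>m\<in>M. \<Sum>w\<in>words M n. c m * word_coeff c w * osc_int \<theta> (m # w) s (k - sum_list (m # w)) * \<psi> (k - sum_list (m # w))))
    has_vector_derivative 0 + (\<Sum>m\<in>M. \<Sum>w\<in>words M n. c m * word_coeff c w * (cis (s * \<theta> m (k - sum_list (m # w) + sum_list w)) * osc_int \<theta> w s (k - sum_list (m # w))) * \<psi> (k - sum_list (m # w)))) (at s within {0..1})"
    using deriv01_osc_int[of \<theta>] s
    by (intro has_vector_derivative_add has_vector_derivative_const has_vector_derivative_sum has_vector_derivative_mult_right has_vector_derivative_mult_left) blast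
  moreover have "0 + (\<Sum>m\<in>M. \<Sum>w\<in>words M n. c m * word_coeff c w * (cis (s * \<theta> m (k - sum_list (m # w) + sum_list w)) * osc_int \<theta> w s (k - sum_list (m # w))) * \<psi> (k - sum_list (m # w)))
    = (\<Sum>m\<in>M. c m * cis (s * \<theta> m (k - m)) * dyson_sum \<theta> c M \<psi> n s (k - m))"
    unfolding e dyson_sum_def by (simp add: sum_distrib_left mult_ac)
  ultimately show "((\<lambda>s. dyson_sum \<theta> c M \<psi> (Suc n) s k) has_vector_derivative (\<Sum>m\<in>M. c m * cis (s * \<theta> m (k - m)) * dyson_sum \<theta> c M \<psi> n s (k - m))) (at s within {0..1})"
    unfolding dyson_sum_def sum_words_Suc[OF M] by simp
qed

text \<open>Only translations and multiplications by phases act on the unknowns, so one expansion serves both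
  the \<open>\<ell>\<close>2 norm (quantum evolution) and the sup norm (classical exponential), each given by its tests.\<close>

definition test_family :: "('g::ab_group_add set \<times> ('g \<Rightarrow> complex)) set \<Rightarrow> bool" where
  "test_family T \<longleftrightarrow> (\<forall>(K,\<phi>)\<in>T. finite K \<and> (\<forall>m \<alpha>. ((\<lambda>k. k - m) ` K, \<lambda>j. cis (\<alpha> j) * \<phi> (j + m)) \<in> T))"

definition test_bound :: "('g set \<times> ('g \<Rightarrow> complex)) set \<Rightarrow> ('g \<Rightarrow> complex) \<Rightarrow> real \<Rightarrow> bool" where
  "test_bound T f B \<longleftrightarrow> (\<forall>(K,\<phi>)\<in>T. cmod (\<Sum>k\<in>K. \<phi> k * f k) \<le> B)"

lemma test_bound_mono: "test_bound T f B \<Longrightarrow> B \<le> B' \<Longrightarrow> test_bound T f B'"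
  unfolding test_bound_def by fastforce

lemma test_bound_zero: "0 \<le> B \<Longrightarrow> test_bound T (\<lambda>k. 0) B"
  unfolding test_bound_def by auto

lemma test_bound_cmult: assumes "test_bound T f B" shows "test_bound T (\<lambda>k. c * f k) (cmod c * B)"
proof -
  have "cmod (\<Sum>k\<in>K. \<phi> k * (c * f k)) = cmod c * cmod (\<Sum>k\<in>K. \<phi> k * f k)" for K \<phi>
    by (simp add: mult.left_commute[of _ c] norm_mult flip: sum_distrib_left)
  then show ?thesis using assms unfolding test_bound_def by (auto intro: mult_left_mono)
qed

lemma test_bound_add: assumes "test_bound T f B" "test_bound T g C" shows "test_bound T (\<lambda>k. f k + g k) (B + C)"
  unfolding test_bound_def
proof safe
  fix K \<phi> assume "(K, \<phi>) \<in> T"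
  then have "cmod (\<Sum>k\<in>K. \<phi> k * f k) \<le> B" "cmod (\<Sum>k\<in>K. \<phi> k * g k) \<le> C" using assms by (auto simp: test_bound_def)
  then show "cmod (\<Sum>k\<in>K. \<phi> k * (f k + g k)) \<le> B + C"
    by (simp add: distrib_left sum.distrib norm_triangle_mono)
qed

text \<open>By duality the translation and the phase are moved onto the test, which stays in the
  family.\<close>

lemma test_bound_shift:
  assumes T: "test_family T" and f: "test_bound T f B"
  shows "test_bound T (\<lambda>k. cis (\<alpha> k) * f (k - m)) B"
  unfolding test_bound_def
proof safe
  fix K \<phi> assume K: "(K, \<phi>) \<in> T"
  then have "((\<lambda>k. k - m) ` K, \<lambda>j. cis (\<alpha> (j + m)) * \<phi> (j + m)) \<in> T" 
    using T unfolding test_family_def by fastforce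
  then have "cmod (\<Sum>j\<in>(\<lambda>k. k - m) ` K. cis (\<alpha> (j + m)) * \<phi> (j + m) * f j) \<le> B"
    using f unfolding test_bound_def by fastforce
  then show "cmod (\<Sum>k\<in>K. \<phi> k * (cis (\<alpha> k) * f (k - m))) \<le> B"
    by (subst (asm) sum.reindex) (auto simp: inj_on_def o_def mult_ac)
qed

lemma has_sum_finite_sum:
  fixes f :: "'i \<Rightarrow> 'c \<Rightarrow> 'b::topological_comm_monoid_add"
  assumes "finite I" "\<And>i. i \<in> I \<Longrightarrow> (f i has_sum S i) X"
  shows "((\<lambda>x. \<Sum>i\<in>I. f i x) has_sum (\<Sum>i\<in>I. S i)) X"
  using assms by (induction I rule: finite_induct) (auto intro!: has_sum_add has_sum_0)

lemma has_sum_minus_diff: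
  fixes f g :: "'c \<Rightarrow> 'b::real_normed_vector"
  assumes "(f has_sum a) X" "(g has_sum b) X" shows "((\<lambda>x. f x - g x) has_sum (a - b)) X"
  using has_sum_add[OF assms(1), of "\<lambda>x. - g x" "- b"] assms(2) by (simp add: has_sum_uminus)

lemma has_sum_if_finite:
  fixes f :: "'c \<Rightarrow> 'b::{topological_space,comm_monoid_add}"
  assumes "finite M" shows "((\<lambda>m. if m \<in> M then f m else 0) has_sum sum f M) UNIV"
proof -
  have "(f has_sum sum f M) M" using assms by (rule has_sum_finite)
  then show ?thesis by (subst has_sum_cong_neutral[of M UNIV f]) auto
qed

text \<open>Minkowski's inequality for infinite sums; since tests have finite support, convergence
  for each \<open>k\<close> separately is enough.\<close>

lemma test_bound_has_sum:
  assumes T: "test_family T" and g: "\<And>k. ((\<lambda>m. g m k) has_sum G k) UNIV" and b: "\<And>m. test_bound T (g m) (b m)"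
    and B: "(b has_sum B) UNIV"
  shows "test_bound T G B"
  unfolding test_bound_def
proof safe
  fix K \<phi> assume K: "(K, \<phi>) \<in> T"
  then have fK: "finite K" using T unfolding test_family_def by auto
  have "((\<lambda>m. \<Sum>k\<in>K. \<phi> k * g m k) has_sum (\<Sum>k\<in>K. \<phi> k * G k)) UNIV"
    by (intro has_sum_finite_sum fK has_sum_cmult_right g)
  moreover have "cmod (\<Sum>k\<in>K. \<phi> k * g m k) \<le> b m" for m using b K unfolding test_bound_def by auto
  ultimately show "cmod (\<Sum>k\<in>K. \<phi> k * G k) \<le> B" by (intro norm_infsum_le[OF _ B])
qed

lemma test_bound_deriv01:
  assumes T: "test_family T" and f: "\<And>k. deriv01 (f k) (f' k)" and p: "deriv01 \<phi> \<phi>'"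
    and b: "\<And>s. s \<in> {0..1} \<Longrightarrow> test_bound T (\<lambda>k. f' k s) (\<phi>' s)"
    and z: "test_bound T (\<lambda>k. f k 0) (\<phi> 0)" and s: "s \<in> {0..1}"
  shows "test_bound T (\<lambda>k. f k s) (\<phi> s)"
  unfolding test_bound_def
proof safe
  fix K \<xi> assume K: "(K, \<xi>) \<in> T"
  then have fK: "finite K" using T unfolding test_family_def by auto
  have "norm ((\<Sum>k\<in>K. \<xi> k * f k s) - (\<Sum>k\<in>K. \<xi> k * f k 0)) \<le> \<phi> s - \<phi> 0"
  proof (rule deriv01_bound[OF _ p _ s, where f="\<lambda>s. \<Sum>k\<in>K. \<xi> k * f k s"])
    show "deriv01 (\<lambda>s. \<Sum>k\<in>K. \<xi> k * f k s) (\<lambda>s. \<Sum>k\<in>K. \<xi> k * f' k s)"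
      using f by (auto intro!: has_vector_derivative_sum has_vector_derivative_mult_right)
    show "norm (\<Sum>k\<in>K. \<xi> k * f' k s) \<le> \<phi>' s" if "s \<in> {0..1}" for s
      using b[OF that] K unfolding test_bound_def by auto
  qed
  moreover have "cmod (\<Sum>k\<in>K. \<xi> k * f k 0) \<le> \<phi> 0" using z K unfolding test_bound_def by auto
  ultimately show "cmod (\<Sum>k\<in>K. \<xi> k * f k s) \<le> \<phi> s"
    using norm_triangle_sub[of "\<Sum>k\<in>K. \<xi> k * f k s" "\<Sum>k\<in>K. \<xi> k * f k 0"] by linarith
qed

lemma deriv01_pow: "deriv01 (\<lambda>s. C * (A * s) ^ Suc n / fact (Suc n)) (\<lambda>s. A * (C * (A * s) ^ n / fact n))" for C A :: real
proof
  fix s :: real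
  have "((\<lambda>s. C * (A * s) ^ Suc n / fact (Suc n)) has_real_derivative A * (C * (A * s) ^ n / fact n)) (at s within {0..1})"
    by (rule derivative_eq_intros refl | simp)+
  then show "((\<lambda>s. C * (A * s) ^ Suc n / fact (Suc n)) has_vector_derivative A * (C * (A * s) ^ n / fact n)) (at s within {0..1})"
    by (simp add: has_real_derivative_iff_has_vector_derivative)
qed

lemma sum_le_has_sum_norm:
  fixes c :: "'a \<Rightarrow> complex"
  assumes "((\<lambda>m. cmod (c m)) has_sum A) UNIV" "finite M" shows "(\<Sum>m\<in>M. cmod (c m)) \<le> A"
  by (rule finite_sum_le_has_sum[OF assms(1)]) (use assms in auto)

lemma test_bound_sum:
  assumes "finite M" "\<And>m. m \<in> M \<Longrightarrow> test_bound T (g m) (b m)" shows "test_bound T (\<lambda>k. \<Sum>m\<in>M. g m k) (\<Sum>m\<in>M. b m)"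
  using assms by (induction M rule: finite_induct) (auto intro!: test_bound_add test_bound_zero)

lemma test_bound_dyson_sum:
  assumes T: "test_family T" and M: "finite M" and A: "(\<Sum>m\<in>M. cmod (c m)) \<le> A" and psi: "test_bound T \<psi> 1" and s: "s \<in> {0..1}"
  shows "test_bound T (dyson_sum \<theta> c M \<psi> n s) (exp A)"
proof -
  have A0: "A \<ge> 0" using A sum_nonneg[of M "\<lambda>m. cmod (c m)"] by simp
  \<comment> \<open>Partial sums of exp (A s): the derivative of \<open>b (Suc n)\<close> is
    \<open>A\<close> times \<open>b n\<close>, the recursion satisfied by the truncated Dyson
    sums.\<close>
  define b where "b = (\<lambda>n s. \<Sum>j<n. (A * s) ^ j / fact j)"
  have b0: "b n s \<ge> 0" if "s \<in> {0..1}" for n s unfolding b_def using A0 that by (intro sum_nonneg) auto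
  have db: "deriv01 (b (Suc n)) (\<lambda>s. A * b n s)" for n
  proof
    fix s :: real assume s: "s \<in> {0..1}"
    have e: "b (Suc n) = (\<lambda>s. 1 + (\<Sum>j<n. 1 * (A * s) ^ Suc j / fact (Suc j)))"
      unfolding b_def sum.lessThan_Suc_shift by simp
    have "((\<lambda>s. 1 + (\<Sum>j<n. 1 * (A * s) ^ Suc j / fact (Suc j))) has_vector_derivative 0 + (\<Sum>j<n. A * (1 * (A * s) ^ j / fact j))) (at s within {0..1})"
      using deriv01_pow[of 1 A] s by (intro has_vector_derivative_add has_vector_derivative_const has_vector_derivative_sum) blast
    then show "(b (Suc n) has_vector_derivative A * b n s) (at s within {0..1})"
      unfolding e by (simp add: b_def sum_distrib_left)
  qed
  have "test_bound T (dyson_sum \<theta> c M \<psi> n s) (b n s)" if "s \<in> {0..1}" for s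
    using that
  proof (induction n arbitrary: s)
    case 0
    then show ?case by (simp add: b_def test_bound_zero)
  next
    case (Suc n)
    show ?case
    proof (rule test_bound_deriv01[OF T deriv01_dyson_sum[OF M] db _ _ Suc.prems])
      fix s :: real assume s: "s \<in> {0..1}"
      have "test_bound T (\<lambda>k. \<Sum>m\<in>M. c m * (cis (s * \<theta> m (k - m)) * dyson_sum \<theta> c M \<psi> n s (k - m))) (\<Sum>m\<in>M. cmod (c m) * b n s)"
        by (intro test_bound_sum M test_bound_cmult test_bound_shift[OF T] Suc.IH s)
      then have "test_bound T (\<lambda>k. \<Sum>m\<in>M. c m * (cis (s * \<theta> m (k - m)) * dyson_sum \<theta> c M \<psi> n s (k - m))) (A * b n s)"
        by (rule test_bound_mono) (simp add: b0[OF s] A mult_right_mono flip: sum_distrib_right)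
      then show "test_bound T (\<lambda>k. \<Sum>m\<in>M. c m * cis (s * \<theta> m (k - m)) * dyson_sum \<theta> c M \<psi> n s (k - m)) (A * b n s)"
        by (simp add: mult.assoc)
    next
      have "b (Suc n) 0 = 1" unfolding b_def by (subst sum.lessThan_Suc_shift) simp
      then show "test_bound T (\<lambda>k. dyson_sum \<theta> c M \<psi> (Suc n) 0 k) (b (Suc n) 0)" using psi M by (simp add: dyson_sum_at_0)
    qed
  qed
  moreover have "b n s \<le> exp A"
  proof -
    have "b n s \<le> (\<Sum>j<n. A ^ j / fact j)"
      unfolding b_def using s A0 by (intro sum_mono divide_right_mono power_mono) (auto intro: mult_left_le)
    also have "\<dots> \<le> exp A"
    proof -
      have "(\<Sum>j<n. A ^ j /\<^sub>R fact j) \<le> (\<Sum>j. A ^ j /\<^sub>R fact j)"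
        using A0 by (intro sum_le_suminf summable_exp_generic) auto
      then show ?thesis unfolding exp_def by (simp add: field_simps)
    qed
    finally show ?thesis .
  qed
  ultimately show ?thesis using s test_bound_mono by blast
qed

section \<open>Remainder of the Dyson series\<close>

text \<open>Two errors propagate: stopping after \<open>n\<close> iterations gives a Taylor
  remainder, and omitting the letters outside \<open>M\<close> acts as a source term.\<close>

lemma dyson_remainder:
  assumes T: "test_family T" and M: "finite M" and c: "((\<lambda>m. cmod (c m)) has_sum A) UNIV" and psi: "test_bound T \<psi> 1"
    and W: "\<And>k. deriv01 (W k) (W' k)" and W0: "\<And>k. W k 0 = \<psi> k"
    and W': "\<And>k s. s \<in> {0..1} \<Longrightarrow> ((\<lambda>m. c m * (cis (s * \<theta> m (k - m)) * W (k - m) s)) has_sum W' k s) UNIV"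
    and C: "\<And>s. s \<in> {0..1} \<Longrightarrow> test_bound T (\<lambda>k. W k s) C" and C0: "C \<ge> 0"
    and s: "s \<in> {0..1}"
  shows "test_bound T (\<lambda>k. W k s - dyson_sum \<theta> c M \<psi> n s k) 
    (C * (A * s) ^ n / fact n + (A - (\<Sum>m\<in>M. cmod (c m))) * exp A * exp ((A + 1) * s))"
proof -
  define \<delta> where "\<delta> = A - (\<Sum>m\<in>M. cmod (c m))"
  have AM: "(\<Sum>m\<in>M. cmod (c m)) \<le> A" by (rule sum_le_has_sum_norm[OF c M])
  have d0: "\<delta> \<ge> 0" using AM by (simp add: \<delta>_def)
  have A0: "A \<ge> 0" using sum_le_has_sum_norm[OF c, of "{}"] by simp
  \<comment> \<open>The exponent carries \<open>A + 1\<close> instead of \<open>A\<close>: the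
    additional term in its derivative absorbs the source \<open>\<delta> * exp A\<close> created by
    the letters outside \<open>M\<close>.\<close>
  define B where "B = (\<lambda>n s. C * (A * s) ^ n / fact n + \<delta> * exp A * exp ((A + 1) * s))"
  have "test_bound T (\<lambda>k. W k s - dyson_sum \<theta> c M \<psi> n s k) (B n s)" if "s \<in> {0..1}" for s
    using that
  proof (induction n arbitrary: s)
    case 0
    have "test_bound T (\<lambda>k. W k s) (B 0 s)" by (rule test_bound_mono[OF C[OF 0]]) (simp add: B_def d0)
    then show ?case by simp
  next
    case (Suc n)
    define \<phi>' where "\<phi>' = (\<lambda>s. A * (C * (A * s) ^ n / fact n) + \<delta> * exp A * ((A + 1) * exp ((A + 1) * s)))"
    show ?case
    proof (rule test_bound_deriv01[OF T _ _ _ _ Suc.prems])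
      show "deriv01 (\<lambda>s. W k s - dyson_sum \<theta> c M \<psi> (Suc n) s k) (\<lambda>s. W' k s - (\<Sum>m\<in>M. c m * cis (s * \<theta> m (k - m)) * dyson_sum \<theta> c M \<psi> n s (k - m)))" for k
        using W deriv01_dyson_sum[OF M, of \<theta> c \<psi> n k] by (auto intro!: has_vector_derivative_diff)
      show "deriv01 (B (Suc n)) \<phi>'"
      proof
        fix s :: real assume s: "s \<in> {0..1}"
        have "((\<lambda>s. \<delta> * exp A * exp ((A + 1) * s)) has_real_derivative \<delta> * exp A * ((A + 1) * exp ((A + 1) * s))) (at s within {0..1})"
          by (auto intro!: derivative_eq_intros)
        then show "(B (Suc n) has_vector_derivative \<phi>' s) (at s within {0..1})"
          unfolding B_def \<phi>'_def using deriv01_pow[of C A n] s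
          by (intro has_vector_derivative_add) (auto simp: has_real_derivative_iff_has_vector_derivative)
      qed
      show "test_bound T (\<lambda>k. W k 0 - dyson_sum \<theta> c M \<psi> (Suc n) 0 k) (B (Suc n) 0)"
        by (simp add: W0 dyson_sum_at_0[OF M] B_def d0 test_bound_zero)
    next
      fix s :: real assume s: "s \<in> {0..1}"
      \<comment> \<open>For a letter in \<open>M\<close> only the difference between
        \<open>W\<close> and the Dyson sum occurs. For the others \<open>W\<close> is that
        difference plus a Dyson sum bounded by \<open>exp A\<close>; \<open>b\<close> records both
        cases.\<close>
      define g where "g = (\<lambda>m k. c m * (cis (s * \<theta> m (k - m)) * W (k - m) s) - (if m \<in> M then c m * (cis (s * \<theta> m (k - m)) * dyson_sum \<theta> c M \<psi> n s (k - m)) else 0))"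
      define b where "b = (\<lambda>m. cmod (c m) * (B n s + exp A) - (if m \<in> M then cmod (c m) * exp A else 0))"
      have "test_bound T (\<lambda>k. W' k s - (\<Sum>m\<in>M. c m * (cis (s * \<theta> m (k - m)) * dyson_sum \<theta> c M \<psi> n s (k - m)))) (A * (B n s + exp A) - (\<Sum>m\<in>M. cmod (c m) * exp A))"
      proof (rule test_bound_has_sum[OF T, of g _ b])
        have "((\<lambda>m. if m \<in> M then c m * (cis (s * \<theta> m (k - m)) * dyson_sum \<theta> c M \<psi> n s (k - m)) else 0) has_sum (\<Sum>m\<in>M. c m * (cis (s * \<theta> m (k - m)) * dyson_sum \<theta> c M \<psi> n s (k - m)))) UNIV" for k
          by (rule has_sum_if_finite[OF M])
        then show "((\<lambda>m. g m k) has_sum W' k s - (\<Sum>m\<in>M. c m * (cis (s * \<theta> m (k - m)) * dyson_sum \<theta> c M \<psi> n s (k - m)))) UNIV" for k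
          unfolding g_def by (intro has_sum_minus_diff W' s)
        have "((\<lambda>m. if m \<in> M then cmod (c m) * exp A else 0) has_sum (\<Sum>m\<in>M. cmod (c m) * exp A)) UNIV"
          by (rule has_sum_if_finite[OF M])
        then show "(b has_sum A * (B n s + exp A) - (\<Sum>m\<in>M. cmod (c m) * exp A)) UNIV"
          unfolding b_def by (intro has_sum_minus_diff has_sum_cmult_left c)
        show "test_bound T (g m) (b m)" for m
        proof -
          have 1: "test_bound T (\<lambda>k. c m * (cis (s * \<theta> m (k - m)) * (W (k - m) s - dyson_sum \<theta> c M \<psi> n s (k - m)))) (cmod (c m) * B n s)"
            by (intro test_bound_cmult test_bound_shift[OF T, of "\<lambda>k. W k s - dyson_sum \<theta> c M \<psi> n s k"] Suc.IH s)
          show ?thesis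
          proof (cases "m \<in> M")
            case True
            then show ?thesis using 1 by (simp add: g_def b_def algebra_simps)
          next
            case False
            have "test_bound T (\<lambda>k. c m * (cis (s * \<theta> m (k - m)) * dyson_sum \<theta> c M \<psi> n s (k - m))) (cmod (c m) * exp A)"
              by (intro test_bound_cmult test_bound_shift[OF T] test_bound_dyson_sum T M AM psi s)
            from test_bound_add[OF 1 this] show ?thesis using False by (simp add: g_def b_def algebra_simps)
          qed
        qed
      qed
      moreover have "A * (B n s + exp A) - (\<Sum>m\<in>M. cmod (c m) * exp A) \<le> \<phi>' s"
      proof -
        have "\<delta> * exp A * 1 \<le> \<delta> * exp A * exp ((A + 1) * s)" using s A0 d0 by (intro mult_left_mono) auto
        then show ?thesis unfolding B_def \<phi>'_def by (simp add: algebra_simps \<delta>_def sum_distrib_left)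
      qed
      ultimately show "test_bound T (\<lambda>k. W' k s - (\<Sum>m\<in>M. c m * cis (s * \<theta> m (k - m)) * dyson_sum \<theta> c M \<psi> n s (k - m))) (\<phi>' s)"
        unfolding mult.assoc by (rule test_bound_mono)
    qed
  qed
  then show ?thesis using s unfolding B_def \<delta>_def by blast
qed

lemma power_over_fact_tendsto_0: "(\<lambda>n. x ^ n / fact n) \<longlonglongrightarrow> 0" for x :: real
proof -
  have "(\<lambda>n. x ^ n /\<^sub>R fact n) \<longlonglongrightarrow> 0" by (rule summable_LIMSEQ_zero[OF summable_exp_generic])
  then show ?thesis by (simp add: field_simps)
qed

text \<open>\<open>exp A\<close> bounds every Dyson sum, and the other term is what remains of the
  remainder for empty \<open>M\<close> as \<open>n\<close> grows: an a priori bound on the solution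
  in terms of \<open>A\<close> alone.\<close>

definition dyson_const :: "real \<Rightarrow> real" where "dyson_const A = exp A + A * exp A * exp (A + 1)"

text \<open>The remainder estimate is used twice: with empty \<open>M\<close> it upgrades the
  unspecified bound to \<open>dyson_const A\<close>, and with this bound it is applied to the given
  \<open>M\<close>.\<close>

theorem dyson:
  assumes T: "test_family T" and M: "finite M" and c: "((\<lambda>m. cmod (c m)) has_sum A) UNIV" and psi: "test_bound T \<psi> 1"
    and W: "\<And>k. deriv01 (W k) (W' k)" and W0: "\<And>k. W k 0 = \<psi> k"
    and W': "\<And>k s. s \<in> {0..1} \<Longrightarrow> ((\<lambda>m. c m * (cis (s * \<theta> m (k - m)) * W (k - m) s)) has_sum W' k s) UNIV"
    and C: "\<exists>C. \<forall>s\<in>{0..1}. test_bound T (\<lambda>k. W k s) C" 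
  shows "test_bound T (\<lambda>k. W k 1 - dyson_sum \<theta> c M \<psi> n 1 k) 
    (dyson_const A * A ^ n / fact n + (A - (\<Sum>m\<in>M. cmod (c m))) * exp A * exp (A + 1))"
proof -
  have A0: "A \<ge> 0" using sum_le_has_sum_norm[OF c, of "{}"] by simp
  obtain C where C: "\<And>s. s \<in> {0..1} \<Longrightarrow> test_bound T (\<lambda>k. W k s) C" "C \<ge> 0"
  proof -
    from C obtain C where "\<forall>s\<in>{0..1}. test_bound T (\<lambda>k. W k s) C" by blast
    then show ?thesis by (intro that[of "max C 0"]) (auto intro: test_bound_mono[of _ _ C])
  qed
  \<comment> \<open>\<open>C\<close> may depend on \<open>W\<close> (hence on h); it disappears as the length of the words tends to infinity.\<close>
  have unif: "test_bound T (\<lambda>k. W k s) (dyson_const A)" if s: "s \<in> {0..1}" for s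
    unfolding test_bound_def
  proof safe
    fix K \<xi> assume K: "(K, \<xi>) \<in> T"
    have "cmod (\<Sum>k\<in>K. \<xi> k * W k s) \<le> dyson_const A + C * ((A * s) ^ n / fact n)" for n
    proof -
      have "test_bound T (\<lambda>k. dyson_sum \<theta> c {} \<psi> n s k + (W k s - dyson_sum \<theta> c {} \<psi> n s k)) 
        (exp A + (C * (A * s) ^ n / fact n + (A - (\<Sum>m\<in>{}. cmod (c m))) * exp A * exp ((A + 1) * s)))"
        by (intro test_bound_add test_bound_dyson_sum dyson_remainder[OF T _ c psi W W0 W' C] T psi s) (use A0 in auto)
      moreover have "A * exp A * exp ((A + 1) * s) \<le> A * exp A * exp (A + 1)"
        using s A0 by (intro mult_left_mono) (auto intro: mult_left_le)
      ultimately show ?thesis using K unfolding test_bound_def dyson_const_def by fastforce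
    qed
    moreover have "(\<lambda>n. dyson_const A + C * ((A * s) ^ n / fact n)) \<longlonglongrightarrow> dyson_const A + C * 0"
      by (intro tendsto_intros power_over_fact_tendsto_0)
    ultimately show "cmod (\<Sum>k\<in>K. \<xi> k * W k s) \<le> dyson_const A"
      using tendsto_lowerbound[of "\<lambda>n. dyson_const A + C * ((A * s) ^ n / fact n)" _ sequentially] by (simp add: always_eventually)
  qed
  have "dyson_const A \<ge> 0" using A0 by (simp add: dyson_const_def)
  from dyson_remainder[OF T M c psi W W0 W' unif this, of 1 n] show ?thesis by simp
qed

section \<open>Smooth symbols and test functions\<close>

text \<open>The polynomial factor makes this family closed under differentiation.\<close>

definition flat :: "real poly \<Rightarrow> real \<Rightarrow> real" where
  "flat p x = (if x > 0 then poly p (1 / x) * exp (- (1 / x)) else 0)"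

lemma poly_div_exp_tendsto_0: "((\<lambda>y. poly p y / exp y) \<longlongrightarrow> (0::real)) at_top"
proof -
  have "((\<lambda>y. \<Sum>i\<le>degree p. coeff p i * (y ^ i / exp y)) \<longlongrightarrow> (\<Sum>i\<le>degree p. coeff p i * 0)) at_top"
    by (intro tendsto_intros tendsto_power_div_exp_0)
  then show ?thesis by (simp add: poly_altdef sum_divide_distrib)
qed

lemma flat_tendsto_0: "(flat p \<longlongrightarrow> 0) (at 0)"
proof -
  have "((\<lambda>y. poly p y / exp y) \<longlongrightarrow> 0) at_top" by (rule poly_div_exp_tendsto_0)
  then have "((\<lambda>x. poly p (inverse x) / exp (inverse x)) \<longlongrightarrow> 0) (at_right 0)"
    by (rule filterlim_compose[OF _ filterlim_inverse_at_top_right])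
  then have "(flat p \<longlongrightarrow> 0) (at_right 0)"
    by (rule Lim_transform_eventually)
      (auto simp: eventually_at_right_less flat_def exp_minus field_simps eventually_at_filter intro!: always_eventually)
  moreover have "(flat p \<longlongrightarrow> 0) (at_left 0)"
    by (rule tendsto_eventually) (auto simp: flat_def eventually_at_filter intro!: always_eventually)
  ultimately show ?thesis by (simp add: filterlim_at_split)
qed

text \<open>With y = 1/x the derivative of p(y) exp(-y) is y^2 (p - p')(y) exp(-y), and
  \<open>[:0,0,1:]\<close> is y^2. At 0 the difference quotient is \<open>flat\<close> for the
  polynomial y p(y), which tends to 0.\<close>

lemma flat_has_derivative:
  "(flat p has_real_derivative flat ([:0,0,1:] * (p - pderiv p)) x) (at x)"
proof -
  consider "x > 0" | "x < 0" | "x = 0" by linarith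
  then show ?thesis
  proof cases
    case 1
    have "((\<lambda>x. poly p (1 / x) * exp (- (1 / x))) has_real_derivative flat ([:0,0,1:] * (p - pderiv p)) x) (at x)"
      using 1 by (auto intro!: derivative_eq_intros poly_DERIV[THEN DERIV_chain2] simp: flat_def field_simps power2_eq_square)
    then show ?thesis
      by (rule DERIV_cong_ev[THEN iffD2, rotated 3])
        (use 1 in \<open>auto simp: flat_def intro: eventually_mono[OF eventually_gt_at_top[of 0, THEN filter_leD[rotated]]] eventually_nhds_in_open[of "{0<..}", THEN eventually_mono]\<close>)
  next
    case 2
    have "((\<lambda>x. 0) has_real_derivative flat ([:0,0,1:] * (p - pderiv p)) x) (at x)"
      using 2 by (simp add: flat_def)
    then show ?thesis
      by (rule DERIV_cong_ev[THEN iffD2, rotated 3])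
        (use 2 in \<open>auto simp: flat_def intro: eventually_nhds_in_open[of "{..<0}", THEN eventually_mono]\<close>)
  next
    case 3
    have e: "flat (pCons 0 p) = (\<lambda>h. flat p h / h)" by (auto simp: flat_def fun_eq_iff)
    have "((\<lambda>h. (flat p (0 + h) - flat p 0) / h) \<longlongrightarrow> 0) (at 0)"
      using flat_tendsto_0[of "pCons 0 p"] unfolding e by (simp add: flat_def[of p 0])
    then show ?thesis unfolding 3 by (simp add: DERIV_def flat_def[of _ 0])
  qed
qed

section \<open>Smooth functions generated by explicit operations\<close>

text \<open>The class is closed under differentiation, so derivatives of all orders are reached by
  induction; it contains the polynomials and bumps needed for approximation.\<close>

inductive smooth_fun :: "(real \<Rightarrow> complex) \<Rightarrow> bool" where
  smooth_fun_flat: "smooth_fun (\<lambda>x. complex_of_real (flat p (a * x + b)))"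
| smooth_fun_const: "smooth_fun (\<lambda>x. c)"
| smooth_fun_id: "smooth_fun (\<lambda>x. complex_of_real x)"
| smooth_fun_add: "smooth_fun f \<Longrightarrow> smooth_fun g \<Longrightarrow> smooth_fun (\<lambda>x. f x + g x)"
| smooth_fun_mult: "smooth_fun f \<Longrightarrow> smooth_fun g \<Longrightarrow> smooth_fun (\<lambda>x. f x * g x)"

lemma smooth_fun_derivative: "smooth_fun g \<Longrightarrow> \<exists>g'. smooth_fun g' \<and> (\<forall>x. (g has_vector_derivative g' x) (at x))"
proof (induction rule: smooth_fun.induct)
  case (smooth_fun_flat p a b)
  let ?q = "[:0,0,1:] * (p - pderiv p)"
  have "((\<lambda>x. flat p (a * x + b)) has_real_derivative flat ?q (a * x + b) * a) (at x)" for x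
    by (rule DERIV_chain2[OF flat_has_derivative]) (auto intro!: derivative_eq_intros)
  then have "((\<lambda>x. complex_of_real (flat p (a * x + b))) has_vector_derivative complex_of_real (flat ?q (a * x + b) * a)) (at x)" for x
    by (rule has_vector_derivative_of_real)
  moreover have "smooth_fun (\<lambda>x. complex_of_real (flat ?q (a * x + b)) * complex_of_real a)"
    by (intro smooth_fun.intros)
  ultimately show ?case by (intro exI[of _ "\<lambda>x. complex_of_real (flat ?q (a * x + b)) * complex_of_real a"]) simp
next
  case (smooth_fun_const c)
  then show ?case by (intro exI[of _ "\<lambda>x. 0"]) (auto intro: smooth_fun.intros)
next
  case smooth_fun_id
  have "((\<lambda>x. complex_of_real x) has_vector_derivative complex_of_real 1) (at x)" for x
    by (rule has_vector_derivative_of_real) (rule DERIV_ident)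
  then show ?case by (intro exI[of _ "\<lambda>x. 1"]) (auto intro: smooth_fun.intros)
next
  case (smooth_fun_add f g)
  then obtain f' g' where "smooth_fun f'" "smooth_fun g'" "\<And>x. (f has_vector_derivative f' x) (at x)" "\<And>x. (g has_vector_derivative g' x) (at x)" by blast
  then show ?case
    by (intro exI[of _ "\<lambda>x. f' x + g' x"]) (auto intro: smooth_fun.intros has_vector_derivative_add)
next
  case (smooth_fun_mult f g)
  then obtain f' g' where "smooth_fun f'" "smooth_fun g'" "\<And>x. (f has_vector_derivative f' x) (at x)" "\<And>x. (g has_vector_derivative g' x) (at x)" by blast
  then show ?case using smooth_fun_mult
    by (intro exI[of _ "\<lambda>x. f x * g' x + f' x * g x"]) (auto intro: smooth_fun.intros has_vector_derivative_mult)
qed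

lemma smooth_fun_continuous: assumes "smooth_fun g" shows "continuous_on A g"
proof -
  obtain g' where "\<And>x. (g has_vector_derivative g' x) (at x)" using smooth_fun_derivative[OF assms] by blast
  then have "continuous_on UNIV g" by (intro continuous_on_vector_derivative) auto
  then show ?thesis by (rule continuous_on_subset) auto
qed

lemma smooth_fun_polynomial: "real_polynomial_function p \<Longrightarrow> smooth_fun (\<lambda>x. complex_of_real (p x))"
proof (induction rule: real_polynomial_function.induct)
  case (linear f)
  then interpret bounded_linear f by simp
  have "f x = x * f 1" for x using scaleR[of x 1] by simp
  then have "(\<lambda>x. complex_of_real (f x)) = (\<lambda>x. complex_of_real x * complex_of_real (f 1))"
    by (metis of_real_mult)
  then show ?case by (simp add: smooth_fun.intros)
qed (auto intro: smooth_fun.intros)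

inductive smooth_sym :: "(pt \<times> real \<Rightarrow> complex) \<Rightarrow> bool" where
  smooth_sym_ek: "smooth_sym (\<lambda>z. ek m (fst z))"
| smooth_sym_smooth_fun: "smooth_fun g \<Longrightarrow> smooth_sym (\<lambda>z. g (snd z))"
| smooth_sym_add: "smooth_sym f \<Longrightarrow> smooth_sym g \<Longrightarrow> smooth_sym (\<lambda>z. f z + g z)"
| smooth_sym_mult: "smooth_sym f \<Longrightarrow> smooth_sym g \<Longrightarrow> smooth_sym (\<lambda>z. f z * g z)"

lemma smooth_sym_const: "smooth_sym (\<lambda>z. c)"
  using smooth_sym_smooth_fun[OF smooth_fun_const] by simp

lemma smooth_sym_continuous: "smooth_sym f \<Longrightarrow> continuous_on A f"
proof (induction rule: smooth_sym.induct)
  case (smooth_sym_ek m)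
  show ?case by (rule continuous_on_compose2[OF continuous_ek[of UNIV]]) (auto intro!: continuous_intros)
next
  case (smooth_sym_smooth_fun g)
  show ?case by (rule continuous_on_compose2[OF smooth_fun_continuous[OF smooth_sym_smooth_fun, of UNIV]]) (auto intro!: continuous_intros)
qed (auto intro!: continuous_intros)

lemma smooth_sym_derivative:
  "smooth_sym f \<Longrightarrow> \<exists>f'. smooth_sym f' \<and> (\<forall>x. ((\<lambda>t::real. f (x + t *\<^sub>R v)) has_vector_derivative f' x) (at 0))"
proof (induction rule: smooth_sym.induct)
  case (smooth_sym_ek m)
  let ?c = "2 * pi * \<i> * complex_of_real (zshift m \<bullet> fst v)"
  have "((\<lambda>t::real. ek m (fst (x + t *\<^sub>R v))) has_vector_derivative ?c * ek m (fst x)) (at 0)" for x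
    using ek_has_vector_derivative[of m "fst x" "fst v" 0 UNIV] by simp
  then show ?case by (intro exI[of _ "\<lambda>z. ?c * ek m (fst z)"]) (auto intro: smooth_sym.intros smooth_sym_const)
next
  case (smooth_sym_smooth_fun g)
  obtain g' where g': "smooth_fun g'" "\<And>x. (g has_vector_derivative g' x) (at x)" using smooth_fun_derivative[OF smooth_sym_smooth_fun] by blast
  have "((\<lambda>t::real. g (snd (x + t *\<^sub>R v))) has_vector_derivative complex_of_real (snd v) * g' (snd x)) (at 0)" for x
  proof -
    have "(g \<circ> (\<lambda>t. snd x + t * snd v) has_vector_derivative snd v *\<^sub>R g' (snd x + 0 * snd v)) (at 0)"
      by (intro vector_diff_chain_at g') (auto intro!: derivative_eq_intros simp: has_real_derivative_iff_has_vector_derivative[symmetric])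
    then show ?thesis by (simp add: o_def scaleR_conv_of_real)
  qed
  then show ?case
    by (intro exI[of _ "\<lambda>z. complex_of_real (snd v) * g' (snd z)"]) (use smooth_sym_mult[OF smooth_sym_const smooth_sym.smooth_sym_smooth_fun[OF g'(1)]] in auto)
next
  case (smooth_sym_add f g)
  then obtain f' g' where "smooth_sym f'" "smooth_sym g'" "\<And>x. ((\<lambda>t::real. f (x + t *\<^sub>R v)) has_vector_derivative f' x) (at 0)" 
    "\<And>x. ((\<lambda>t::real. g (x + t *\<^sub>R v)) has_vector_derivative g' x) (at 0)" by blast
  then show ?case
    by (intro exI[of _ "\<lambda>x. f' x + g' x"]) (auto intro: smooth_sym.intros has_vector_derivative_add)
next
  case (smooth_sym_mult f g)
  then obtain f' g' where "smooth_sym f'" "smooth_sym g'" and f': "\<And>x. ((\<lambda>t::real. f (x + t *\<^sub>R v)) has_vector_derivative f' x) (at 0)" 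
    and g': "\<And>x. ((\<lambda>t::real. g (x + t *\<^sub>R v)) has_vector_derivative g' x) (at 0)" by blast
  moreover have "((\<lambda>t::real. f (x + t *\<^sub>R v) * g (x + t *\<^sub>R v)) has_vector_derivative f x * g' x + f' x * g x) (at 0)" for x
    using has_vector_derivative_mult[OF f' g', of x x] by simp
  ultimately show ?case using smooth_sym_mult
    by (intro exI[of _ "\<lambda>x. f x * g' x + f' x * g x"]) (auto intro: smooth_sym.intros)
qed

lemma smooth_sym_dd: "smooth_sym f \<Longrightarrow> smooth_sym (dd f vs)"
proof (induction vs)
  case (Cons v vs)
  then obtain f' where f': "smooth_sym f'" "\<And>x. ((\<lambda>t::real. dd f vs (x + t *\<^sub>R v)) has_vector_derivative f' x) (at 0)"
    using smooth_sym_derivative by blast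
  have "dd f (v # vs) = f'" using f'(2) by (auto simp: vector_derivative_at)
  then show ?case using f' by simp
qed simp

lemma smooth_sym_smooth: assumes "smooth_sym f" shows "smooth f"
  unfolding smooth_def
proof (intro allI conjI)
  fix vs
  show "continuous_on UNIV (dd f vs)" by (intro smooth_sym_continuous smooth_sym_dd assms)
  show "(\<lambda>t::real. dd f vs (x + t *\<^sub>R v)) differentiable at 0" for v x
    using smooth_sym_derivative[OF smooth_sym_dd[OF assms], of vs v] by (meson differentiableI_vector)
qed

section \<open>Approximation by smooth functions with compact support\<close>

definition bump :: "real \<Rightarrow> real \<Rightarrow> real" where
  "bump R x = flat 1 (x + R) * flat 1 (R - x)"

lemma flat_1_bounds: "0 \<le> flat 1 x" "flat 1 x \<le> 1" "0 < x \<Longrightarrow> 0 < flat 1 x"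
  by (auto simp: flat_def)

lemma bump_bounds: "0 \<le> bump R x" "bump R x \<le> 1" "\<bar>x\<bar> < R \<Longrightarrow> 0 < bump R x" "R \<le> \<bar>x\<bar> \<Longrightarrow> bump R x = 0"
  unfolding bump_def using flat_1_bounds
  by (auto intro!: mult_nonneg_nonneg mult_le_one mult_pos_pos simp: flat_def split: if_splits)

lemma smooth_fun_bump: "smooth_fun (\<lambda>x. complex_of_real (bump R x))"
proof -
  have "smooth_fun (\<lambda>x. complex_of_real (flat 1 (1 * x + R)) * complex_of_real (flat 1 ((-1) * x + R)))"
    by (intro smooth_fun.intros)
  then show ?thesis by (simp add: bump_def)
qed

lemma continuous_bump: "continuous_on A (bump R)"
  using continuous_on_Re[OF smooth_fun_continuous[OF smooth_fun_bump]] by simp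

definition vanishing :: "(real \<Rightarrow> complex) \<Rightarrow> bool" where
  "vanishing g \<longleftrightarrow> continuous_on UNIV g \<and> (\<forall>e>0. \<exists>R. \<forall>x. R \<le> \<bar>x\<bar> \<longrightarrow> cmod (g x) \<le> e)"

text \<open>A polynomial times a bump is smooth with compact support, but the bump is nowhere equal
  to 1. The polynomial therefore approximates the truncated function divided by the bump, and
  multiplying back costs nothing as the bump is at most 1.\<close>

lemma vanishing_approx:
  assumes g: "vanishing g" and e: "e > 0"
  shows "\<exists>f. smooth_fun f \<and> (\<exists>R. \<forall>x. R < \<bar>x\<bar> \<longrightarrow> f x = 0) \<and> (\<forall>x. cmod (g x - f x) \<le> e)"
proof -
  obtain R0 where R0: "\<And>x. R0 \<le> \<bar>x\<bar> \<Longrightarrow> cmod (g x) \<le> e / 2" 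
    using g e unfolding vanishing_def by (meson half_gt_zero)
  define R where "R = \<bar>R0\<bar>"
  have R: "R \<ge> 0" "\<And>x. R \<le> \<bar>x\<bar> \<Longrightarrow> cmod (g x) \<le> e / 2" using R0 by (auto simp: R_def)
  define \<tau> where "\<tau> = (\<lambda>x::real. max 0 (min 1 (R + 1 - \<bar>x\<bar>)))"
  \<comment> \<open>Agrees with the bump wherever \<open>\<tau>\<close> is nonzero and is positive
    everywhere, as the second term takes over before the bump vanishes; this makes \<open>H\<close>
    continuous on the whole line.\<close>
  define d where "d = (\<lambda>x. bump (R + 2) x + max 0 (\<bar>x\<bar> - (R + 1)))"
  have d: "d x > 0" for x
    using bump_bounds(1)[of "R + 2" x] bump_bounds(3)[of x "R + 2"] unfolding d_def by (cases "\<bar>x\<bar> < R + 2") (auto intro: add_pos_nonneg add_nonneg_pos)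
  have gc: "continuous_on UNIV g" using g by (simp add: vanishing_def)
  define H where "H = (\<lambda>x. complex_of_real (\<tau> x) * g x / complex_of_real (d x))"
  have Hc: "continuous_on A H" for A
  proof -
    have "continuous_on A d" unfolding d_def by (intro continuous_intros continuous_bump)
    moreover have "continuous_on A \<tau>" unfolding \<tau>_def by (intro continuous_intros)
    moreover have "complex_of_real (d x) \<noteq> 0" for x using d[of x] by simp
    ultimately show ?thesis unfolding H_def
      by (intro continuous_intros continuous_on_subset[OF gc]) auto
  qed
  have Hb: "H x * complex_of_real (bump (R + 2) x) = complex_of_real (\<tau> x) * g x" for x
  proof (cases "\<bar>x\<bar> < R + 1")
    case True
    then have "d x = bump (R + 2) x" by (simp add: d_def)
    then show ?thesis using d[of x] by (simp add: H_def)
  next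
    case False
    then have "\<tau> x = 0" by (simp add: \<tau>_def)
    then show ?thesis by (simp add: H_def)
  qed
  have e4: "e / 4 > 0" using e by simp
  obtain p where p: "real_polynomial_function p" "\<And>x. x \<in> {-(R+2)..R+2} \<Longrightarrow> \<bar>Re (H x) - p x\<bar> < e / 4"
    using Stone_Weierstrass_real_polynomial_function[OF compact_Icc continuous_on_Re[OF Hc] e4] by blast
  obtain q where q: "real_polynomial_function q" "\<And>x. x \<in> {-(R+2)..R+2} \<Longrightarrow> \<bar>Im (H x) - q x\<bar> < e / 4"
    using Stone_Weierstrass_real_polynomial_function[OF compact_Icc continuous_on_Im[OF Hc] e4] by blast
  define P where "P = (\<lambda>x. complex_of_real (p x) + \<i> * complex_of_real (q x))"
  have HP: "cmod (H x - P x) \<le> e / 2" if "x \<in> {-(R+2)..R+2}" for x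
    using cmod_le[of "H x - P x"] p(2)[OF that] q(2)[OF that] by (simp add: P_def)
  define f where "f = (\<lambda>x. P x * complex_of_real (bump (R + 2) x))"
  show ?thesis
  proof (intro exI[of _ f] conjI allI)
    show "smooth_fun f" unfolding f_def P_def by (intro smooth_fun.intros smooth_fun_polynomial smooth_fun_bump p q)
    show "\<exists>R. \<forall>x. R < \<bar>x\<bar> \<longrightarrow> f x = 0" by (rule exI[of _ "R + 2"]) (auto simp: f_def bump_bounds)
    fix x
    have 1: "cmod (g x - complex_of_real (\<tau> x) * g x) \<le> e / 2"
    proof (cases "\<bar>x\<bar> \<le> R")
      case True
      then have "\<tau> x = 1" by (simp add: \<tau>_def)
      then show ?thesis using e by simp
    next
      case False
      have "cmod (g x - complex_of_real (\<tau> x) * g x) = cmod (complex_of_real (1 - \<tau> x) * g x)" by (simp add: algebra_simps)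
      also have "\<dots> = (1 - \<tau> x) * cmod (g x)" unfolding norm_mult norm_of_real by (simp add: \<tau>_def)
      also have "\<dots> \<le> 1 * cmod (g x)" by (intro mult_right_mono) (auto simp: \<tau>_def)
      finally show ?thesis using R(2)[of x] False by simp
    qed
    have 2: "cmod (complex_of_real (\<tau> x) * g x - f x) \<le> e / 2"
    proof (cases "\<bar>x\<bar> < R + 2")
      case True
      have "cmod ((H x - P x) * complex_of_real (bump (R + 2) x)) \<le> (e / 2) * 1"
        unfolding norm_mult using HP[of x, unfolded atLeastAtMost_iff] True bump_bounds(1,2)[of "R + 2" x] e
        by (intro mult_mono) (auto simp: abs_less_iff)
      then show ?thesis by (simp add: f_def left_diff_distrib flip: Hb)
    next
      case False
      then have "\<tau> x = 0" "bump (R + 2) x = 0" by (auto simp: \<tau>_def bump_bounds)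
      then show ?thesis using e by (simp add: f_def)
    qed
    show "cmod (g x - f x) \<le> e"
      using norm_triangle_ineq[of "g x - complex_of_real (\<tau> x) * g x" "complex_of_real (\<tau> x) * g x - f x"] 1 2 by simp
  qed
qed

section \<open>Quadratic forms along a shifted diagonal\<close>

text \<open>The quadratic form at \<open>f\<close> of the Fourier multiplier \<open>a\<close>
  followed by multiplication with \<open>ek m\<close>.\<close>

definition shift_form :: "(pt \<Rightarrow> complex) \<Rightarrow> int \<times> int \<Rightarrow> (int \<times> int \<Rightarrow> complex) \<Rightarrow> complex" where
  "shift_form f m a = (\<Sum>\<^sub>\<infinity>k. cnj (fc f (k + m)) * a k * fc f k)"

text \<open>Cauchy-Schwarz, in which only the shifted factor is bounded by the full norm; keeping
  the mass of \<open>f\<close> on \<open>K\<close> makes the contribution of low frequencies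
  small.\<close>

lemma shift_form_partial:
  assumes f: "L2T f" "normT f = 1" and b: "\<And>k. cmod (a k) \<le> b" and K: "finite K"
  shows "(\<Sum>k\<in>K. cmod (cnj (fc f (k + m)) * a k * fc f k)) \<le> b * sqrt (\<Sum>k\<in>K. (cmod (fc f k))\<^sup>2)"
proof -
  have b0: "b \<ge> 0" using b[of 0] norm_ge_zero order_trans by blast
  have "(\<Sum>k\<in>K. cmod (cnj (fc f (k + m)) * a k * fc f k)) \<le> (\<Sum>k\<in>K. b * (\<bar>cmod (fc f (k + m))\<bar> * \<bar>cmod (fc f k)\<bar>))"
    unfolding norm_mult
    by (intro sum_mono) (simp add: mult_right_mono mult.left_commute[of _ "cmod (a _)"] mult.assoc b)
  also have "\<dots> = b * (\<Sum>k\<in>K. \<bar>cmod (fc f (k + m))\<bar> * \<bar>cmod (fc f k)\<bar>)" by (simp add: sum_distrib_left)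
  also have "\<dots> \<le> b * (1 * sqrt (\<Sum>k\<in>K. (cmod (fc f k))\<^sup>2))"
  proof (rule mult_left_mono[OF _ b0])
    have "(\<Sum>k\<in>K. (cmod (fc f (k + m)))\<^sup>2) = (\<Sum>j\<in>(\<lambda>k. k + m) ` K. (cmod (fc f j))\<^sup>2)"
      by (subst sum.reindex) (auto simp: inj_on_def)
    also have "\<dots> \<le> (normT f)\<^sup>2" using K by (intro bessel f) auto
    finally have "L2_set (\<lambda>k. cmod (fc f (k + m))) K \<le> 1" using f by (simp add: L2_set_def)
    then have "L2_set (\<lambda>k. cmod (fc f (k + m))) K * L2_set (\<lambda>k. cmod (fc f k)) K \<le> 1 * L2_set (\<lambda>k. cmod (fc f k)) K"
      by (intro mult_right_mono) (auto simp: L2_set_nonneg)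
    then show "(\<Sum>k\<in>K. \<bar>cmod (fc f (k + m))\<bar> * \<bar>cmod (fc f k)\<bar>) \<le> 1 * sqrt (\<Sum>k\<in>K. (cmod (fc f k))\<^sup>2)"
      using L2_set_mult_ineq[of "\<lambda>k. cmod (fc f (k + m))" "\<lambda>k. cmod (fc f k)" K] by (simp add: L2_set_def)
  qed
  finally show ?thesis by simp
qed

lemma fc_sum_le_1: "L2T f \<Longrightarrow> normT f = 1 \<Longrightarrow> finite K \<Longrightarrow> sqrt (\<Sum>k\<in>K. (cmod (fc f k))\<^sup>2) \<le> 1"
  using bessel[of f K] by simp

lemma shift_form_summable:
  assumes f: "L2T f" "normT f = 1" and b: "\<And>k. cmod (a k) \<le> b"
  shows "(\<lambda>k. norm (cnj (fc f (k + m)) * a k * fc f k)) summable_on UNIV"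
proof (rule nonneg_bounded_partial_sums_imp_summable_on[of _ _ b])
  have b0: "b \<ge> 0" using b[of 0] norm_ge_zero order_trans by blast
  show "\<forall>\<^sub>F K in finite_subsets_at_top UNIV. (\<Sum>k\<in>K. norm (cnj (fc f (k + m)) * a k * fc f k)) \<le> b"
  proof (rule eventually_finite_subsets_at_top_weakI)
    fix K :: "(int\<times>int) set" assume K: "finite K"
    show "(\<Sum>k\<in>K. norm (cnj (fc f (k + m)) * a k * fc f k)) \<le> b"
      using shift_form_partial[where a=a and b=b and m=m, OF f b K] mult_left_mono[OF fc_sum_le_1[OF f K] b0] by simp
  qed
qed simp

lemma shift_form_diff:
  assumes f: "L2T f" "normT f = 1" and "\<And>k. cmod (a k) \<le> b" "\<And>k. cmod (a' k) \<le> b'"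
  shows "shift_form f m (\<lambda>k. a k - a' k) = shift_form f m a - shift_form f m a'"
proof -
  have "((\<lambda>k. cnj (fc f (k + m)) * a k * fc f k - cnj (fc f (k + m)) * a' k * fc f k) has_sum (shift_form f m a - shift_form f m a')) UNIV"
    unfolding shift_form_def
    by (intro has_sum_minus_diff has_sum_infsum abs_summable_summable[OF shift_form_summable[OF f, of a b m]] 
        abs_summable_summable[OF shift_form_summable[OF f, of a' b' m]] assms)
  then show ?thesis unfolding shift_form_def by (simp add: algebra_simps infsumI)
qed

lemma shift_form_norm_le:
  assumes f: "L2T f" "normT f = 1" and x: "\<And>k. cmod (x k) \<le> b" 
    and B: "\<And>K. finite K \<Longrightarrow> (\<Sum>k\<in>K. cmod (cnj (fc f (k + m)) * x k * fc f k)) \<le> B"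
  shows "cmod (shift_form f m x) \<le> B"
proof -
  have "cmod (shift_form f m x) \<le> (\<Sum>\<^sub>\<infinity>k. cmod (cnj (fc f (k + m)) * x k * fc f k))"
    unfolding shift_form_def by (rule norm_infsum_bound[OF shift_form_summable[OF f x]])
  also have "\<dots> \<le> B" by (rule infsum_le_finite_sums[OF shift_form_summable[OF f x]]) (simp_all add: B)
  finally show ?thesis .
qed

lemma shift_form_bound:
  assumes f: "L2T f" "normT f = 1" and a: "\<And>k. cmod (a k) \<le> \<alpha> + (if k \<in> low_freq then \<beta> else 0)"
    and ab: "\<alpha> \<ge> 0" "\<beta> \<ge> 0"
  shows "cmod (shift_form f m a) \<le> \<alpha> + \<beta> * sqrt (\<Sum>\<^sub>\<infinity>k\<in>low_freq. (cmod (fc f k))\<^sup>2)"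
proof -
  \<comment> \<open>Radial truncation at modulus \<open>\<alpha>\<close>. The remainder
    \<open>a2\<close> is supported in \<open>low_freq\<close>, so only the mass of \<open>f\<close>
    there enters its contribution.\<close>
  define a1 where "a1 = (\<lambda>k. if cmod (a k) \<le> \<alpha> then a k else complex_of_real \<alpha> * sgn (a k))"
  define a2 where "a2 = (\<lambda>k. a k - a1 k)"
  have a1: "cmod (a1 k) \<le> \<alpha>" for k using ab by (auto simp: a1_def norm_mult norm_sgn)
  have a2: "cmod (a2 k) \<le> (if k \<in> low_freq then \<beta> else 0)" for k
  proof (cases "cmod (a k) \<le> \<alpha>")
    case True
    then show ?thesis using ab by (simp add: a2_def a1_def)
  next
    case False
    then have "a k \<noteq> 0" using ab by auto
    have "a2 k = complex_of_real (cmod (a k) - \<alpha>) * sgn (a k)"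
      using False \<open>a k \<noteq> 0\<close> by (simp add: a2_def a1_def left_diff_distrib sgn_eq diff_divide_distrib)
    then have "cmod (a2 k) = \<bar>cmod (a k) - \<alpha>\<bar>" using \<open>a k \<noteq> 0\<close> by (simp add: norm_mult norm_sgn del: of_real_diff)
    then show ?thesis using a[of k] False by auto
  qed
  have a2b: "cmod (a2 k) \<le> \<beta>" for k using a2[of k] ab by (auto split: if_splits)
  have sB: "(\<lambda>k. (cmod (fc f k))\<^sup>2) summable_on low_freq"
    using summable_on_subset_banach[of _ UNIV low_freq] parseval_norm[OF f(1)] by (auto simp: summable_on_def)
  have "a = (\<lambda>k. a2 k - (- a1 k))" by (simp add: a2_def)
  then have "shift_form f m a = shift_form f m a2 - shift_form f m (\<lambda>k. - a1 k)"
    using shift_form_diff[OF f a2b, of "\<lambda>k. - a1 k" \<alpha>] a1 by simp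
  then have "cmod (shift_form f m a) \<le> cmod (shift_form f m (\<lambda>k. - a1 k)) + cmod (shift_form f m a2)"
    using norm_triangle_ineq4[of "shift_form f m a2" "shift_form f m (\<lambda>k. - a1 k)"] by simp
  also have "cmod (shift_form f m (\<lambda>k. - a1 k)) \<le> \<alpha>"
  proof (rule shift_form_norm_le[OF f])
    show a1': "cmod (- a1 k) \<le> \<alpha>" for k using a1 by simp
    fix K :: "(int\<times>int) set" assume K: "finite K"
    show "(\<Sum>k\<in>K. cmod (cnj (fc f (k + m)) * - a1 k * fc f k)) \<le> \<alpha>"
      using shift_form_partial[where a="\<lambda>k. - a1 k" and m=m, OF f a1' K] mult_left_mono[OF fc_sum_le_1[OF f K] ab(1)] by simp
  qed
  also have "cmod (shift_form f m a2) \<le> \<beta> * sqrt (\<Sum>\<^sub>\<infinity>k\<in>low_freq. (cmod (fc f k))\<^sup>2)"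
  proof (rule shift_form_norm_le[OF f], rule a2b)
    fix K :: "(int\<times>int) set" assume K: "finite K"
    have "(\<Sum>k\<in>K. cmod (cnj (fc f (k + m)) * a2 k * fc f k)) = (\<Sum>k\<in>K \<inter> low_freq. cmod (cnj (fc f (k + m)) * a2 k * fc f k))"
    proof (rule sum.mono_neutral_right[OF K])
      show "\<forall>k\<in>K - K \<inter> low_freq. cmod (cnj (fc f (k + m)) * a2 k * fc f k) = 0"
      proof
        fix k assume "k \<in> K - K \<inter> low_freq"
        then show "cmod (cnj (fc f (k + m)) * a2 k * fc f k) = 0" using a2[of k] by simp
      qed
    qed auto
    also have "\<dots> \<le> \<beta> * sqrt (\<Sum>k\<in>K \<inter> low_freq. (cmod (fc f k))\<^sup>2)" using K by (intro shift_form_partial f a2b) auto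
    also have "\<dots> \<le> \<beta> * sqrt (\<Sum>\<^sub>\<infinity>k\<in>low_freq. (cmod (fc f k))\<^sup>2)"
      using K ab(2) by (intro mult_left_mono iffD2[OF real_sqrt_le_iff] finite_sum_le_infsum[OF sB]) auto
    finally show "(\<Sum>k\<in>K. cmod (cnj (fc f (k + m)) * a2 k * fc f k)) \<le> \<beta> * sqrt (\<Sum>\<^sub>\<infinity>k\<in>low_freq. (cmod (fc f k))\<^sup>2)" .
  qed
  finally show ?thesis by simp
qed

section \<open>Limits of the words of the Dyson expansion\<close>

lemma knorm2_inner: "knorm2 k = zshift k \<bullet> zshift k"
  by (simp add: knorm2_def zshift_def inner_prod_def power2_eq_square)

lemma norm_zshift: "norm (zshift k) = sqrt (knorm2 k)"
  by (simp add: knorm2_inner norm_eq_sqrt_inner)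

text \<open>Cramer's rule recovers both coordinates of \<open>k\<close> from its products with
  \<open>m\<close> and \<open>m'\<close>; the determinant \<open>D\<close> is nonzero.\<close>

lemma nonpar_bound:
  assumes n: "\<not> par m m'"
  obtains c where "c > 0" "\<And>k. c * norm (zshift k) \<le> max \<bar>zshift k \<bullet> zshift m\<bar> \<bar>zshift k \<bullet> zshift m'\<bar>"
proof -
  obtain m1 m2 where m: "m = (m1, m2)" by (cases m)
  obtain n1 n2 where m': "m' = (n1, n2)" by (cases m')
  define D where "D = real_of_int (m1 * n2 - m2 * n1)"
  have D: "D \<noteq> 0" using n unfolding D_def of_int_eq_0_iff by (simp add: par_def m m')
  define N where "N = 1 + (\<bar>real_of_int m1\<bar> + \<bar>real_of_int m2\<bar> + \<bar>real_of_int n1\<bar> + \<bar>real_of_int n2\<bar>)"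
  have N: "N > 0" by (simp add: N_def)
  show ?thesis
  proof (rule that[of "\<bar>D\<bar> / N"])
    show "\<bar>D\<bar> / N > 0" using D N by simp
    fix k :: "int \<times> int"
    obtain k1 k2 where k: "k = (k1, k2)" by (cases k)
    define a b where "a = zshift k \<bullet> zshift m" and "b = zshift k \<bullet> zshift m'"
    define M where "M = max \<bar>a\<bar> \<bar>b\<bar>"
    have M: "\<bar>a\<bar> \<le> M" "\<bar>b\<bar> \<le> M" "M \<ge> 0" by (auto simp: M_def)
    have a: "a = real_of_int k1 * m1 + real_of_int k2 * m2" and b: "b = real_of_int k1 * n1 + real_of_int k2 * n2"
      by (simp_all add: a_def b_def k m m' zshift_def inner_prod_def)
    have 1: "real_of_int k1 * D = a * n2 - b * m2" "real_of_int k2 * D = b * m1 - a * n1"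
      by (simp_all add: a b D_def algebra_simps)
    have "\<bar>real_of_int k1\<bar> * \<bar>D\<bar> \<le> \<bar>a\<bar> * \<bar>real_of_int n2\<bar> + \<bar>b\<bar> * \<bar>real_of_int m2\<bar>"
      unfolding abs_mult[symmetric] 1 by linarith
    also have "\<dots> \<le> M * \<bar>real_of_int n2\<bar> + M * \<bar>real_of_int m2\<bar>" using M by (intro add_mono mult_right_mono) auto
    finally have 2: "\<bar>real_of_int k1\<bar> * \<bar>D\<bar> \<le> M * \<bar>real_of_int n2\<bar> + M * \<bar>real_of_int m2\<bar>" .
    have "\<bar>real_of_int k2\<bar> * \<bar>D\<bar> \<le> \<bar>b\<bar> * \<bar>real_of_int m1\<bar> + \<bar>a\<bar> * \<bar>real_of_int n1\<bar>"
      unfolding abs_mult[symmetric] 1 by linarith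
    also have "\<dots> \<le> M * \<bar>real_of_int m1\<bar> + M * \<bar>real_of_int n1\<bar>" using M by (intro add_mono mult_right_mono) auto
    finally have 3: "\<bar>real_of_int k2\<bar> * \<bar>D\<bar> \<le> M * \<bar>real_of_int m1\<bar> + M * \<bar>real_of_int n1\<bar>" .
    have "norm (zshift k) \<le> \<bar>real_of_int k1\<bar> + \<bar>real_of_int k2\<bar>"
      using norm_Pair_le[of "real_of_int k1" "real_of_int k2"] by (simp add: zshift_def k)
    then have "norm (zshift k) * \<bar>D\<bar> \<le> (\<bar>real_of_int k1\<bar> + \<bar>real_of_int k2\<bar>) * \<bar>D\<bar>" by (rule mult_right_mono) simp
    also have "\<dots> \<le> M * N" using 2 3 M(3) by (simp add: N_def algebra_simps)
    finally show "\<bar>D\<bar> / N * norm (zshift k) \<le> max \<bar>zshift k \<bullet> zshift m\<bar> \<bar>zshift k \<bullet> zshift m'\<bar>"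
      using N by (simp add: M_def a_def b_def field_simps)
  qed
qed

section \<open>Words with phases independent of the position\<close>

text \<open>When the phases ignore the current frequency the starting point is immaterial, hence the
  0.\<close>

definition osc_lin :: "(int \<times> int) list \<Rightarrow> (int \<times> int \<Rightarrow> real) \<Rightarrow> complex" where
  "osc_lin w p = osc_int (\<lambda>m k. p m) w 1 0"

lemma osc_int_osc_lin: "osc_int (\<lambda>m k. p m) w 1 k = osc_lin w p"
proof -
  have "osc_err (\<lambda>m k. p m) k (\<lambda>m k. p m) k' w = 0" for k k' :: "int \<times> int" by (induction w) auto
  then show ?thesis using osc_int_diff_le[of 1 "\<lambda>m k. p m" w k "\<lambda>m k. p m" 0] by (simp add: osc_lin_def)
qed

lemma norm_osc_lin_le: "cmod (osc_lin w p) \<le> 1"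
  unfolding osc_lin_def by (rule norm_osc_int_le) simp

lemma osc_lin_decay: "m \<in> set w \<Longrightarrow> p m \<noteq> 0 \<Longrightarrow> cmod (osc_lin w p) \<le> 3 / \<bar>p m\<bar>"
  unfolding osc_lin_def by (rule osc_int_decay) auto

lemma osc_lin_cong: "(\<And>m. m \<in> set w \<Longrightarrow> p m = q m) \<Longrightarrow> osc_lin w p = osc_lin w q"
proof -
  assume a: "\<And>m. m \<in> set w \<Longrightarrow> p m = q m"
  have "osc_err (\<lambda>m k. p m) (0::int\<times>int) (\<lambda>m k. q m) 0 w = 0" using a by (induction w) auto
  then show ?thesis using osc_int_diff_le[of 1 "\<lambda>m k. p m" w 0 "\<lambda>m k. q m" 0] by (simp add: osc_lin_def)
qed

lemma osc_lin_linear_lipschitz: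
  "cmod (osc_lin w (\<lambda>m. x * p m) - osc_lin w (\<lambda>m. y * p m)) \<le> \<bar>x - y\<bar> * (\<Sum>m\<leftarrow>w. \<bar>p m\<bar>)"
proof -
  have "osc_err (\<lambda>m k. x * p m) (0::int\<times>int) (\<lambda>m k. y * p m) 0 w = \<bar>x - y\<bar> * (\<Sum>m\<leftarrow>w. \<bar>p m\<bar>)"
    by (induction w) (auto simp: algebra_simps abs_mult[symmetric])
  then show ?thesis using osc_int_diff_le[of 1 "\<lambda>m k. x * p m" w 0 "\<lambda>m k. y * p m" 0] by (simp add: osc_lin_def)
qed

lemma vanishing_osc_lin:
  assumes m: "m \<in> set w" "p m \<noteq> 0"
  shows "vanishing (\<lambda>x. osc_lin w (\<lambda>m. x * p m))"
  unfolding vanishing_def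
proof (intro conjI allI impI)
  define C where "C = (\<Sum>m\<leftarrow>w. \<bar>p m\<bar>)"
  have C: "C \<ge> 0" unfolding C_def by (intro sum_list_nonneg) auto
  have "C-lipschitz_on UNIV (\<lambda>x. osc_lin w (\<lambda>m. x * p m))"
    by (rule lipschitz_onI) (use osc_lin_linear_lipschitz[of w _ p] C in \<open>auto simp: dist_norm C_def mult.commute\<close>)
  then show "continuous_on UNIV (\<lambda>x. osc_lin w (\<lambda>m. x * p m))" by (rule lipschitz_on_continuous_on)
  fix e :: real assume e: "e > 0"
  show "\<exists>R. \<forall>x. R \<le> \<bar>x\<bar> \<longrightarrow> cmod (osc_lin w (\<lambda>m. x * p m)) \<le> e"
  proof (intro exI[of _ "3 / (e * \<bar>p m\<bar>)"] allI impI)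
    fix x :: real assume x: "3 / (e * \<bar>p m\<bar>) \<le> \<bar>x\<bar>"
    have "3 / (e * \<bar>p m\<bar>) > 0" using e m by simp
    then have x0: "x \<noteq> 0" using x by auto
    have "cmod (osc_lin w (\<lambda>m. x * p m)) \<le> 3 / \<bar>x * p m\<bar>"
      by (rule osc_lin_decay[OF m(1)]) (use m x0 in auto)
    also have "\<dots> \<le> e" using x e m x0 by (simp add: abs_mult field_simps)
    finally show "cmod (osc_lin w (\<lambda>m. x * p m)) \<le> e" .
  qed
qed

text \<open>What the phases contain beyond the linear ones at the starting frequency, divided by the
  small factor: the drift due to the earlier letters and the quadratic term of the letter
  itself.\<close>

fun word_err :: "real \<Rightarrow> (int \<times> int) list \<Rightarrow> real" where
  "word_err T [] = 0"
| "word_err T (m # w) = \<bar>T * (2 * pi\<^sup>2) * (2 * (zshift (sum_list w) \<bullet> zshift m) + knorm2 m)\<bar> + word_err T w"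

text \<open>The eigenvalue 2 pi^2 h^2 |k|^2 divided by h and multiplied by the time t h/\<epsilon>
  gives t (h^2/\<epsilon>) 2 pi^2 |k|^2; the parameter \<open>T\<close> stands for t
  h^2/\<epsilon>.\<close>

definition quantum_phase :: "real \<Rightarrow> int \<times> int \<Rightarrow> int \<times> int \<Rightarrow> real" where
  "quantum_phase T m k = T * (2 * pi\<^sup>2) * (knorm2 (k + m) - knorm2 k)"

text \<open>The phase of a letter without its quadratic part, which is negligible because \<open>h\<^sup>2 / \<epsilon> h\<close> tends to 0.\<close>

definition linear_phase :: "real \<Rightarrow> int \<times> int \<Rightarrow> int \<times> int \<Rightarrow> real" where
  "linear_phase T k m = T * (4 * pi\<^sup>2) * (zshift k \<bullet> zshift m)"

lemma knorm2_add: "knorm2 (k + m) - knorm2 k = 2 * (zshift k \<bullet> zshift m) + knorm2 m"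
  by (simp add: knorm2_inner zshift_add inner_add_left inner_add_right inner_commute)

text \<open>The difference of the phases does not involve \<open>k\<close>, so the replacement is
  uniform over all frequencies.\<close>

lemma osc_int_quantum_phase_osc_lin:
  assumes "\<kappa> \<ge> 0"
  shows "cmod (osc_int (quantum_phase (T * \<kappa>)) w 1 k - osc_lin w (linear_phase (T * \<kappa>) k)) \<le> \<kappa> * word_err T w"
proof -
  have d: "quantum_phase (T * \<kappa>) m (k + sum_list w) - linear_phase (T * \<kappa>) k m = \<kappa> * (T * (2 * pi\<^sup>2) * (2 * (zshift (sum_list w) \<bullet> zshift m) + knorm2 m))" for m w
    unfolding quantum_phase_def linear_phase_def knorm2_add by (simp add: zshift_add inner_add_left algebra_simps)
  have "osc_err (quantum_phase (T * \<kappa>)) k (\<lambda>m k'. linear_phase (T * \<kappa>) k m) 0 w = \<kappa> * word_err T w"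
  proof (induction w)
    case (Cons m w)
    have "\<bar>\<kappa> * X\<bar> = \<kappa> * \<bar>X\<bar>" for X using assms by (simp add: abs_mult)
    then show ?case unfolding osc_err.simps word_err.simps d Cons.IH ring_distribs(1)[of \<kappa> "\<bar>_\<bar>"] by presburger
  qed simp
  then show ?thesis using osc_int_diff_le[of 1 "quantum_phase (T * \<kappa>)" w k "\<lambda>m k'. linear_phase (T * \<kappa>) k m" 0] by (simp add: osc_lin_def)
qed

definition plateau :: "real \<Rightarrow> real \<Rightarrow> real" where
  "plateau R x = max 0 (min 1 (R + 1 - \<bar>x\<bar>))"

lemma vanishing_plateau: "vanishing (\<lambda>x. complex_of_real (plateau R x))"
  unfolding vanishing_def
proof (intro conjI allI impI)
  show "continuous_on UNIV (\<lambda>x. complex_of_real (plateau R x))"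
    unfolding plateau_def by (intro continuous_intros)
  show "\<exists>R'. \<forall>x. R' \<le> \<bar>x\<bar> \<longrightarrow> cmod (complex_of_real (plateau R x)) \<le> e" if "e > 0" for e :: real
    using that by (intro exI[of _ "R + 1"]) (auto simp: plateau_def)
qed

section \<open>Semiclassical families and the control of low frequencies\<close>

locale semiclassical =
  fixes \<epsilon> :: "real \<Rightarrow> real" and \<psi> :: "real \<Rightarrow> pt \<Rightarrow> complex" and S :: "(int \<times> int) set"
    and F :: "int \<times> int \<Rightarrow> (pt \<times> real) measure"
  assumes eps_pos: "\<forall>h. 0 < h \<and> h \<le> 1 \<longrightarrow> 0 < \<epsilon> h"
    and eps_big: "filterlim (\<lambda>h. \<epsilon> h / h\<^sup>2) at_top (at_right 0)"
    and eps_small: "((\<lambda>h. \<epsilon> h / h) \<longlongrightarrow> 0) (at_right 0)"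
    and psi_L2: "\<forall>h. 0 < h \<and> h \<le> 1 \<longrightarrow> L2T (\<psi> h) \<and> normT (\<psi> h) = 1"
    and psi_low: "((\<lambda>\<delta>. Limsup (at_right 0) (\<lambda>h. ereal (spec_norm h {0..\<delta>} (\<psi> h)))) \<longlongrightarrow> 0) (at_right 0)"
    and S_prim: "\<forall>v\<in>S. primitive v"
    and S_choice: "\<forall>v. primitive v \<longrightarrow> (v \<in> S \<longleftrightarrow> - v \<notin> S)"
    and F_borel: "\<forall>v\<in>S. sets (F v) = sets borel"
    and F_finite: "\<forall>v\<in>S. finite_measure (F v)"
    and F_lim: "\<forall>v\<in>S. \<forall>a :: pt \<times> real \<Rightarrow> complex.
        smooth a \<and> (\<forall>x m \<eta>. a (x + zshift m, \<eta>) = a (x, \<eta>)) \<and>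
        (\<exists>R. \<forall>x \<eta>. R < \<bar>\<eta>\<bar> \<longrightarrow> a (x, \<eta>) = 0) \<longrightarrow>
        ((\<lambda>h. op_quad h (\<lambda>x \<xi>. Iv v (\<lambda>y \<eta>. a (y, \<eta>)) x (h * Hv v \<xi> / \<epsilon> h)) (\<psi> h))
           \<longlongrightarrow> integral\<^sup>L (F v) a) (at_right 0)"
begin

definition kap :: "real \<Rightarrow> real" where "kap h = h\<^sup>2 / \<epsilon> h"

definition eta :: "real \<Rightarrow> int \<times> int \<Rightarrow> int \<times> int \<Rightarrow> real" where
  "eta h v k = h * Hv v ((2 * pi * h) *\<^sub>R zshift k) / \<epsilon> h"

lemma eta_eq: "eta h v k = 2 * pi * kap h * (zshift k \<bullet> zshift v) / Lv v"
  by (simp add: eta_def kap_def Hv_def power2_eq_square mult_ac)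

lemma ev_h: "\<forall>\<^sub>F h in at_right 0. 0 < h \<and> h \<le> (1::real)"
  using eventually_at_right_less[of 0] eventually_at_right_field[of "\<lambda>h. h \<le> 1" 0]
  by (intro eventually_conj) (auto simp: eventually_at_right_field intro!: exI[of _ 1])

lemma psiL: "0 < h \<Longrightarrow> h \<le> 1 \<Longrightarrow> L2T (\<psi> h)" "0 < h \<Longrightarrow> h \<le> 1 \<Longrightarrow> normT (\<psi> h) = 1"
  using psi_L2 by auto

lemma kap_pos: "0 < h \<Longrightarrow> h \<le> 1 \<Longrightarrow> kap h > 0"
  using eps_pos by (simp add: kap_def)

lemma kap_tendsto: "(kap \<longlongrightarrow> 0) (at_right 0)"
  using tendsto_inverse_0_at_top[OF eps_big] by (simp add: kap_def[abs_def])

lemma h_eps_at_top: "filterlim (\<lambda>h. h / \<epsilon> h) at_top (at_right 0)"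
proof -
  have "\<forall>\<^sub>F h in at_right 0. 0 < \<epsilon> h / h" using ev_h by eventually_elim (use eps_pos in auto)
  from filterlim_inverse_at_top[OF eps_small this] show ?thesis by simp
qed

definition low_freq :: "real \<Rightarrow> real \<Rightarrow> (int \<times> int) set" where
  "low_freq \<delta> h = {k. 4 * pi^2 * h^2 * knorm2 k \<in> {0..\<delta>}}"

text \<open>Turns the iterated limit into a cutoff \<open>\<delta>\<close> chosen before
  \<open>h\<close>.\<close>

lemma low: 
  assumes "e > 0"
  obtains \<delta> where "\<delta> > 0" "\<forall>\<^sub>F h in at_right 0. sqrt (\<Sum>\<^sub>\<infinity>k\<in>low_freq \<delta> h. (cmod (fc (\<psi> h) k))\<^sup>2) < e"
proof -
  have "\<forall>\<^sub>F \<delta> in at_right 0. Limsup (at_right 0) (\<lambda>h. ereal (spec_norm h {0..\<delta>} (\<psi> h))) < ereal e"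
    by (rule order_tendstoD(2)[OF psi_low]) (use assms in auto)
  then have "\<forall>\<^sub>F \<delta> in at_right (0::real). 0 < \<delta> \<and> Limsup (at_right 0) (\<lambda>h. ereal (spec_norm h {0..\<delta>} (\<psi> h))) < ereal e"
    using eventually_at_right_less[of 0] by eventually_elim auto
  then obtain \<delta> where d: "\<delta> > 0" "Limsup (at_right 0) (\<lambda>h. ereal (spec_norm h {0..\<delta>} (\<psi> h))) < ereal e"
    using eventually_happens[of _ "at_right (0::real)"] by (auto simp: trivial_limit_at_right_real)
  from Limsup_lessD[OF d(2)] have "\<forall>\<^sub>F h in at_right 0. spec_norm h {0..\<delta>} (\<psi> h) < e" by simp
  then show ?thesis using that[OF d(1)] by (simp add: spec_norm_def low_freq_def)
qed

lemma not_low_freq: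
  assumes "k \<notin> low_freq \<delta> h" "h > 0" "\<delta> > 0"
  shows "norm (zshift k) > sqrt \<delta> / (2 * pi * h)"
proof -
  have "4 * pi^2 * h^2 * knorm2 k \<ge> 0" by (simp add: knorm2_def)
  then have "\<delta> < (2 * pi * h * norm (zshift k))\<^sup>2" using assms(1) by (simp add: low_freq_def norm_zshift power_mult_distrib knorm2_def)
  then have "sqrt \<delta> < 2 * pi * h * norm (zshift k)" using assms
    by (metis abs_of_nonneg norm_ge_zero pi_ge_zero less_imp_le mult_nonneg_nonneg real_sqrt_abs real_sqrt_less_iff zero_le_numeral)
  then show ?thesis using assms by (simp add: field_simps)
qed

text \<open>A criterion for negligible words: the multiplier only has to become small above each
  fixed cutoff \<open>\<delta>\<close>, since the mass below a suitable cutoff is itself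
  small.\<close>

lemma shift_form_tendsto_0:
  assumes b: "\<And>h k. 0 < h \<Longrightarrow> h \<le> 1 \<Longrightarrow> cmod (a h k) \<le> B"
    and g: "\<And>e \<delta>. e > 0 \<Longrightarrow> \<delta> > 0 \<Longrightarrow> \<forall>\<^sub>F h in at_right 0. \<forall>k. k \<notin> low_freq \<delta> h \<longrightarrow> cmod (a h k) \<le> e"
  shows "((\<lambda>h. shift_form (\<psi> h) m (a h)) \<longlongrightarrow> 0) (at_right 0)"
proof (rule tendstoI)
  fix e :: real assume e: "e > 0"
  define B' where "B' = max B 1"
  have B': "B' > 0" "B \<le> B'" by (auto simp: B'_def)
  have e': "e / (2 * B') > 0" using e B' by simp
  obtain \<delta> where \<delta>: "\<delta> > 0" "\<forall>\<^sub>F h in at_right 0. sqrt (\<Sum>\<^sub>\<infinity>k\<in>low_freq \<delta> h. (cmod (fc (\<psi> h) k))\<^sup>2) < e / (2 * B')"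
    using low[OF e'] by blast
  have e2: "e / 2 > 0" using e by simp
  show "\<forall>\<^sub>F h in at_right 0. dist (shift_form (\<psi> h) m (a h)) 0 < e"
    using \<delta>(2) g[OF e2 \<delta>(1)] ev_h
  proof eventually_elim
    case (elim h)
    then have h: "0 < h" "h \<le> 1" by auto
    have "cmod (shift_form (\<psi> h) m (a h)) \<le> e / 2 + B' * sqrt (\<Sum>\<^sub>\<infinity>k\<in>low_freq \<delta> h. (cmod (fc (\<psi> h) k))\<^sup>2)"
    proof (rule shift_form_bound[OF psiL[OF h]])
      fix k
      show "cmod (a h k) \<le> e / 2 + (if k \<in> low_freq \<delta> h then B' else 0)"
        using elim(2)[rule_format, of k] b[OF h, of k] e B'(2) by (cases "k \<in> low_freq \<delta> h") simp_all
    qed (use e B' in auto)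
    also have "B' * sqrt (\<Sum>\<^sub>\<infinity>k\<in>low_freq \<delta> h. (cmod (fc (\<psi> h) k))\<^sup>2) < B' * (e / (2 * B'))"
      using elim(1) B'(1) by (rule mult_strict_left_mono)
    finally show ?case using B'(1) by simp
  qed
qed

lemma F_measurable:
  assumes v: "v \<in> S" and f: "continuous_on UNIV f" shows "f \<in> borel_measurable (F v)"
proof -
  have "sets (F v) = sets borel" using F_borel v by blast
  then have "measurable (F v) borel = measurable borel borel" by (intro measurable_cong_sets refl)
  then show ?thesis using borel_measurable_continuous_onI[OF f] by blast
qed

text \<open>Extends the convergence from smooth compactly supported profiles to all continuous ones
  vanishing at infinity. Both sides are continuous for uniform convergence: the form by
  normalization of the datum, the integral because the measure is finite.\<close>

lemma shift_form_vanishing_limit: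
  assumes g: "vanishing g" and v: "v \<in> S" and m: "par v m"
  shows "((\<lambda>h. shift_form (\<psi> h) m (\<lambda>k. g (eta h v k))) \<longlongrightarrow> (LINT z|F v. ek m (fst z) * g (snd z))) (at_right 0)"
proof -
  interpret finite_measure "F v" using F_finite v by blast
  have pv: "primitive v" using S_prim v by blast
  note meas = F_measurable[OF v]
  have gc: "continuous_on UNIV g" using g by (simp add: vanishing_def)
  have ec: "continuous_on UNIV (\<lambda>z::pt\<times>real. ek m (fst z))"
    by (rule continuous_on_compose2[OF continuous_ek[of UNIV]]) (auto intro!: continuous_intros)
  have cc: "continuous_on UNIV (\<lambda>z::pt\<times>real. ek m (fst z) * f (snd z))" if "continuous_on UNIV f" for f
    by (intro continuous_intros ec continuous_on_compose2[OF that]) auto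
  show ?thesis
  proof (rule tendstoI)
    fix e :: real assume e: "e > 0"
    \<comment> \<open>The 2 makes \<open>M\<close> exceed the mass plus 1: replacing
      \<open>g\<close> costs \<open>d\<close> in the form and \<open>d\<close> times the mass in the
      integral, together strictly less than \<open>e / 2\<close>.\<close>
    define M where "M = measure (F v) (space (F v)) + 2"
    have M: "M > 0" "measure (F v) (space (F v)) + 1 < M" by (simp_all add: M_def add_nonneg_pos)
    define d where "d = e / (2 * M)"
    have d: "d > 0" "d * M \<le> e / 2" using e M by (simp_all add: d_def)
    obtain f where f: "smooth_fun f" "\<exists>R. \<forall>x. R < \<bar>x\<bar> \<longrightarrow> f x = 0" "\<And>x. cmod (g x - f x) \<le> d"
      using vanishing_approx[OF g d(1)] by blast
    let ?a = "\<lambda>z::pt\<times>real. ek m (fst z) * f (snd z)"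
    have "smooth ?a" by (intro smooth_sym_smooth smooth_sym.intros f)
    moreover have "\<forall>x n \<eta>. ?a (x + zshift n, \<eta>) = ?a (x, \<eta>)" by (simp add: ek_shift)
    moreover have "\<exists>R. \<forall>x \<eta>. R < \<bar>\<eta>\<bar> \<longrightarrow> ?a (x, \<eta>) = 0" using f(2) by auto
    ultimately have "((\<lambda>h. op_quad h (\<lambda>x \<xi>. Iv v (\<lambda>y \<eta>. ?a (y, \<eta>)) x (h * Hv v \<xi> / \<epsilon> h)) (\<psi> h)) \<longlongrightarrow> integral\<^sup>L (F v) ?a) (at_right 0)"
      using F_lim[rule_format, OF v, of ?a] by blast
    moreover have "op_quad h (\<lambda>x \<xi>. Iv v (\<lambda>y \<eta>. ?a (y, \<eta>)) x (h * Hv v \<xi> / \<epsilon> h)) (\<psi> h) = shift_form (\<psi> h) m (\<lambda>k. f (eta h v k))" for h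
      by (simp add: Iv_ek[OF pv m] op_quad_ek shift_form_def eta_def)
    ultimately have lim: "((\<lambda>h. shift_form (\<psi> h) m (\<lambda>k. f (eta h v k))) \<longlongrightarrow> integral\<^sup>L (F v) ?a) (at_right 0)" by simp
    have fc: "continuous_on UNIV f" by (rule smooth_fun_continuous[OF f(1)])
    obtain Bf where Bf: "\<And>x. cmod (f x) \<le> Bf"
    proof -
      obtain R where R: "\<And>x. R < \<bar>x\<bar> \<Longrightarrow> f x = 0" using f(2) by blast
      have "bounded (f ` {-R..R})" by (intro compact_imp_bounded compact_continuous_image smooth_fun_continuous f) auto
      then obtain B where "\<And>x. x \<in> {-R..R} \<Longrightarrow> cmod (f x) \<le> B" unfolding bounded_iff by blast
      have "cmod (f x) \<le> max B 0" for x
      proof (cases "R < \<bar>x\<bar>")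
        case False
        then have "x \<in> {-R..R}" unfolding atLeastAtMost_iff by linarith
        then show ?thesis using \<open>\<And>x. x \<in> {-R..R} \<Longrightarrow> cmod (f x) \<le> B\<close>[of x] by simp
      qed (simp add: R)
      then show ?thesis using that by blast
    qed
    have Bg: "cmod (g x) \<le> Bf + d" for x
      using Bf[of x] f(3)[of x] norm_triangle_ineq[of "f x" "g x - f x"] by simp
    have int: "integrable (F v) (\<lambda>z. ek m (fst z) * u (snd z))" if "continuous_on UNIV u" "\<And>x. cmod (u x) \<le> b" for u b
      by (rule integrable_const_bound[of _ b]) (auto simp: norm_mult that intro!: meas cc)
    have diffint: "cmod ((LINT z|F v. ek m (fst z) * g (snd z)) - integral\<^sup>L (F v) ?a) \<le> d * measure (F v) (space (F v))"
    proof -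
      have "(LINT z|F v. ek m (fst z) * g (snd z)) - integral\<^sup>L (F v) ?a = (LINT z|F v. ek m (fst z) * g (snd z) - ?a z)"
        by (rule Bochner_Integration.integral_diff[symmetric]) (rule int[OF gc Bg], rule int[OF fc Bf])
      also have "cmod \<dots> \<le> (LINT z|F v. cmod (ek m (fst z) * g (snd z) - ?a z))" by (rule integral_norm_bound)
      also have "\<dots> \<le> (LINT z|F v. d)"
      proof (rule integral_mono)
        show "integrable (F v) (\<lambda>z. cmod (ek m (fst z) * g (snd z) - ?a z))"
          by (intro integrable_norm Bochner_Integration.integrable_diff int[OF gc Bg] int[OF fc Bf])
        show "cmod (ek m (fst z) * g (snd z) - ?a z) \<le> d" for z
          using f(3)[of "snd z"] by (simp add: norm_mult flip: right_diff_distrib)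
      qed simp
      finally show ?thesis by (simp add: mult.commute)
    qed
    show "\<forall>\<^sub>F h in at_right 0. dist (shift_form (\<psi> h) m (\<lambda>k. g (eta h v k))) (LINT z|F v. ek m (fst z) * g (snd z)) < e"
      using tendstoD[OF lim half_gt_zero[OF e]] ev_h
    proof eventually_elim
      case (elim h)
      then have h: "0 < h" "h \<le> 1" and l: "cmod (shift_form (\<psi> h) m (\<lambda>k. f (eta h v k)) - integral\<^sup>L (F v) ?a) < e / 2" 
        using e by (auto simp: dist_norm)
      have "cmod (shift_form (\<psi> h) m (\<lambda>k. g (eta h v k) - f (eta h v k))) \<le> d + 0 * sqrt (\<Sum>\<^sub>\<infinity>k\<in>{}. (cmod (fc (\<psi> h) k))\<^sup>2)"
        using d(1) by (intro shift_form_bound[OF psiL[OF h]]) (auto simp: f)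
      moreover have "shift_form (\<psi> h) m (\<lambda>k. g (eta h v k) - f (eta h v k)) = shift_form (\<psi> h) m (\<lambda>k. g (eta h v k)) - shift_form (\<psi> h) m (\<lambda>k. f (eta h v k))"
        by (rule shift_form_diff[OF psiL[OF h]]) (rule Bg, rule Bf)
      ultimately have 1: "cmod (shift_form (\<psi> h) m (\<lambda>k. g (eta h v k)) - shift_form (\<psi> h) m (\<lambda>k. f (eta h v k))) \<le> d" by simp
      have "cmod (shift_form (\<psi> h) m (\<lambda>k. g (eta h v k)) - (LINT z|F v. ek m (fst z) * g (snd z))) \<le> d + e / 2 + d * measure (F v) (space (F v)) - 0"
        using norm_triangle_ineq[of "shift_form (\<psi> h) m (\<lambda>k. g (eta h v k)) - shift_form (\<psi> h) m (\<lambda>k. f (eta h v k))" "shift_form (\<psi> h) m (\<lambda>k. f (eta h v k)) - integral\<^sup>L (F v) ?a"]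
          norm_triangle_ineq4[of "shift_form (\<psi> h) m (\<lambda>k. g (eta h v k)) - integral\<^sup>L (F v) ?a" "(LINT z|F v. ek m (fst z) * g (snd z)) - integral\<^sup>L (F v) ?a"]
          1 l diffint by simp
      also have "\<dots> < e"
      proof -
        have "d * (measure (F v) (space (F v)) + 1) < d * M" using M(2) d(1) by (intro mult_strict_left_mono)
        then show ?thesis using d(2) by (simp add: algebra_simps)
      qed
      finally show ?case by (simp add: dist_norm)
    qed
  qed
qed

section \<open>The mass carried by the rational directions\<close>

lemma S_par_unique:
  assumes "v \<in> S" "v' \<in> S" "par v v'" shows "v = v'"
proof -
  have p: "primitive v" "primitive v'" using assms S_prim by auto
  obtain n where n: "v' = (n * fst v, n * snd v)" using par_primitive[OF p(1) assms(3)] .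
  have "gcd (n * fst v) (n * snd v) = 1" using p(2) n by (simp add: primitive_def)
  then have "\<bar>n\<bar> = 1" using p(1) by (simp add: primitive_def gcd_mult_distrib_int[symmetric])
  then have "v' = v \<or> v' = - v" using n by (auto simp: abs_if prod_eq_iff split: if_splits)
  then show ?thesis using S_choice[rule_format, OF p(1)] assms by auto
qed

text \<open>Above a fixed low-frequency cutoff and for small \<open>h\<close>, at most one of the
  cutoffs \<open>plateau R (eta h v k)\<close> is nonzero, so their sum is at most 1; below it the
  sum is at most the number of directions, against a small mass of the datum. Then \<open>h\<close>
  tends to 0, and afterwards \<open>R\<close> to infinity.\<close>

lemma mass_finite:
  assumes S': "finite S'" "S' \<subseteq> S" shows "(\<Sum>v\<in>S'. measure (F v) UNIV) \<le> 1"
proof -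
  have sp: "space (F v) = UNIV" if "v \<in> S" for v
    using F_borel that sets_eq_imp_space_eq[of "F v" borel] by simp
  have R: "(\<Sum>v\<in>S'. (LINT z|F v. plateau R (snd z))) \<le> 1" if R: "R \<ge> 0" for R
  proof (rule field_le_epsilon)
    fix e :: real assume e: "e > 0"
    \<comment> \<open>Bounds the sum of the cutoffs at low frequencies and is positive even if
      \<open>S'\<close> is empty.\<close>
    define N where "N = real (card S') + 1"
    have N: "N > 0" by (simp add: N_def)
    have e': "e / N > 0" using e N by simp
    obtain \<delta> where \<delta>: "\<delta> > 0" "\<forall>\<^sub>F h in at_right 0. sqrt (\<Sum>\<^sub>\<infinity>k\<in>low_freq \<delta> h. (cmod (fc (\<psi> h) k))\<^sup>2) < e / N"
      using low[OF e'] by blast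
    have pair: "\<forall>\<^sub>F h in at_right 0. \<forall>k. k \<notin> low_freq \<delta> h \<longrightarrow> v \<noteq> v' \<longrightarrow> plateau R (eta h v k) = 0 \<or> plateau R (eta h v' k) = 0"
      if v: "v \<in> S'" "v' \<in> S'" for v v'
    proof (cases "v = v'")
      case False
      then have "\<not> par v v'" using S_par_unique v S' by blast
      then obtain c where c: "c > 0" "\<And>k. c * norm (zshift k) \<le> max \<bar>zshift k \<bullet> zshift v\<bar> \<bar>zshift k \<bullet> zshift v'\<bar>"
        using nonpar_bound by blast
      have "primitive v" "primitive v'" using v S' S_prim by blast+
      then have L: "Lv v > 0" "Lv v' > 0" by (auto intro!: Lv_pos)
      define L where "L = max (Lv v) (Lv v')"
      have LL: "L > 0" "Lv v \<le> L" "Lv v' \<le> L" using L by (auto simp: L_def)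
      have "\<forall>\<^sub>F h in at_right 0. h / \<epsilon> h > (R + 1) * L / (c * sqrt \<delta>)"
        using h_eps_at_top by (simp add: filterlim_at_top_dense)
      then show ?thesis using ev_h
      proof eventually_elim
        case (elim h)
        then have h: "0 < h" "h \<le> 1" by auto
        have ep: "\<epsilon> h > 0" using eps_pos h by auto
        show ?case
        \<comment> \<open>Two nonzero cutoffs bound the products of \<open>k\<close> with both
          directions, hence \<open>kap h\<close> times the norm of \<open>k\<close>, by
          \<open>nonpar_bound\<close>. Above the low frequencies that product is at least of order
          \<open>h / \<epsilon> h\<close>, which exceeds the bound by the choice of
          \<open>h\<close>.\<close>
        proof (intro allI impI, rule ccontr)
          fix k assume k: "k \<notin> low_freq \<delta> h" and nz: "\<not> (plateau R (eta h v k) = 0 \<or> plateau R (eta h v' k) = 0)"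
          have *: "2 * pi * kap h * \<bar>zshift k \<bullet> zshift u\<bar> < (R + 1) * L" if "plateau R (eta h u k) \<noteq> 0" "Lv u \<le> L" "Lv u > 0" for u
          proof -
            have "\<bar>eta h u k\<bar> < R + 1" using that(1) by (auto simp: plateau_def max_def min_def split: if_splits)
            moreover have "\<bar>eta h u k\<bar> = 2 * pi * kap h * \<bar>zshift k \<bullet> zshift u\<bar> / Lv u"
              unfolding eta_eq using kap_pos[OF h] that(3) by (simp add: abs_mult)
            ultimately have "2 * pi * kap h * \<bar>zshift k \<bullet> zshift u\<bar> < (R + 1) * Lv u"
              using that(3) by (simp add: field_simps)
            also have "\<dots> \<le> (R + 1) * L" using R that(2) by (intro mult_left_mono) auto
            finally show ?thesis .
          qed
          have "2 * pi * kap h * max \<bar>zshift k \<bullet> zshift v\<bar> \<bar>zshift k \<bullet> zshift v'\<bar> < (R + 1) * L"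
            using *[of v] *[of v'] nz LL L by (auto simp: max_def)
          moreover have "2 * pi * kap h * (c * norm (zshift k)) \<le> 2 * pi * kap h * max \<bar>zshift k \<bullet> zshift v\<bar> \<bar>zshift k \<bullet> zshift v'\<bar>"
            using kap_pos[OF h] by (intro mult_left_mono c) auto
          moreover have "2 * pi * kap h * (c * (sqrt \<delta> / (2 * pi * h))) < 2 * pi * kap h * (c * norm (zshift k))"
            using kap_pos[OF h] c(1) not_low_freq[OF k h(1) \<delta>(1)] by (intro mult_strict_left_mono) auto
          moreover have "2 * pi * kap h * (c * (sqrt \<delta> / (2 * pi * h))) = (h / \<epsilon> h) * (c * sqrt \<delta>)"
            using h ep by (simp add: kap_def field_simps power2_eq_square)
          ultimately have "(h / \<epsilon> h) * (c * sqrt \<delta>) < (R + 1) * L" by linarith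
          moreover have "(h / \<epsilon> h) * (c * sqrt \<delta>) > (R + 1) * L"
            using elim(1) c(1) \<delta>(1) by (simp add: pos_divide_less_eq)
          ultimately show False by simp
        qed
      qed
    qed simp
    have "\<forall>\<^sub>F h in at_right 0. \<forall>v\<in>S'. \<forall>v'\<in>S'. \<forall>k. k \<notin> low_freq \<delta> h \<longrightarrow> v \<noteq> v' \<longrightarrow> plateau R (eta h v k) = 0 \<or> plateau R (eta h v' k) = 0"
      by (intro eventually_ball_finite S' ballI pair)
    then have ev: "\<forall>\<^sub>F h in at_right 0. cmod (\<Sum>v\<in>S'. shift_form (\<psi> h) 0 (\<lambda>k. complex_of_real (plateau R (eta h v k)))) \<le> 1 + e"
      using \<delta>(2) ev_h
    proof eventually_elim
      case (elim h)
      then have h: "0 < h" "h \<le> 1" by auto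
      have t01: "0 \<le> plateau R x" "plateau R x \<le> 1" for x by (auto simp: plateau_def)
      have "cmod (shift_form (\<psi> h) 0 (\<lambda>k. \<Sum>v\<in>S'. complex_of_real (plateau R (eta h v k)))) \<le> 1 + N * sqrt (\<Sum>\<^sub>\<infinity>k\<in>low_freq \<delta> h. (cmod (fc (\<psi> h) k))\<^sup>2)"
      proof (rule shift_form_bound[OF psiL[OF h]])
        fix k
        have n: "cmod (\<Sum>v\<in>S'. complex_of_real (plateau R (eta h v k))) = (\<Sum>v\<in>S'. plateau R (eta h v k))"
          unfolding of_real_sum[symmetric] norm_of_real using t01 by (simp add: sum_nonneg)
        show "cmod (\<Sum>v\<in>S'. complex_of_real (plateau R (eta h v k))) \<le> 1 + (if k \<in> low_freq \<delta> h then N else 0)"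
        proof (cases "k \<in> low_freq \<delta> h")
          case True
          have "(\<Sum>v\<in>S'. plateau R (eta h v k)) \<le> (\<Sum>v\<in>S'. 1)" using t01 by (intro sum_mono) auto
          then show ?thesis unfolding n using True by (simp add: N_def)
        next
          case False
          have "(\<Sum>v\<in>S'. plateau R (eta h v k)) \<le> 1"
          proof (cases "\<exists>u\<in>S'. plateau R (eta h u k) \<noteq> 0")
            case True
            then obtain u where u: "u \<in> S'" "plateau R (eta h u k) \<noteq> 0" by blast
            have "(\<Sum>v\<in>S'. plateau R (eta h v k)) = (\<Sum>v\<in>{u}. plateau R (eta h v k))"
            proof (rule sum.mono_neutral_right[OF S'(1)])
              show "\<forall>v\<in>S' - {u}. plateau R (eta h v k) = 0" using elim(1) u \<open>k \<notin> low_freq \<delta> h\<close> by blast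
            qed (use u in auto)
            then show ?thesis using t01 by simp
          next
            case False
            then show ?thesis by simp
          qed
          then show ?thesis unfolding n using False by simp
        qed
      qed (use N in auto)
      moreover have "N * sqrt (\<Sum>\<^sub>\<infinity>k\<in>low_freq \<delta> h. (cmod (fc (\<psi> h) k))\<^sup>2) \<le> N * (e / N)"
        using elim(2) N by (intro mult_left_mono) auto
      moreover have "shift_form (\<psi> h) 0 (\<lambda>k. \<Sum>v\<in>S'. complex_of_real (plateau R (eta h v k))) = (\<Sum>v\<in>S'. shift_form (\<psi> h) 0 (\<lambda>k. complex_of_real (plateau R (eta h v k))))"
      proof -
        have "((\<lambda>k. \<Sum>v\<in>S'. cnj (fc (\<psi> h) (k + 0)) * complex_of_real (plateau R (eta h v k)) * fc (\<psi> h) k) has_sum (\<Sum>v\<in>S'. shift_form (\<psi> h) 0 (\<lambda>k. complex_of_real (plateau R (eta h v k))))) UNIV"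
          unfolding shift_form_def
          by (intro has_sum_finite_sum S' has_sum_infsum abs_summable_summable[OF shift_form_summable[OF psiL[OF h], of _ 1]]) (use t01 in auto)
        then show ?thesis unfolding shift_form_def by (simp add: sum_distrib_left sum_distrib_right infsumI)
      qed
      ultimately show ?case using N by simp
    qed
    have "((\<lambda>h. \<Sum>v\<in>S'. shift_form (\<psi> h) 0 (\<lambda>k. complex_of_real (plateau R (eta h v k)))) \<longlongrightarrow> (\<Sum>v\<in>S'. (LINT z|F v. ek 0 (fst z) * complex_of_real (plateau R (snd z))))) (at_right 0)"
      using S' by (intro tendsto_sum shift_form_vanishing_limit vanishing_plateau) (auto simp: par_def)
    then have "cmod (\<Sum>v\<in>S'. (LINT z|F v. ek 0 (fst z) * complex_of_real (plateau R (snd z)))) \<le> 1 + e"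
      using ev by (intro tendsto_upperbound[OF tendsto_norm]) (auto simp: trivial_limit_at_right_real)
    moreover have "(\<Sum>v\<in>S'. (LINT z|F v. ek 0 (fst z) * complex_of_real (plateau R (snd z)))) = complex_of_real (\<Sum>v\<in>S'. (LINT z|F v. plateau R (snd z)))"
      by simp
    ultimately show "(\<Sum>v\<in>S'. (LINT z|F v. plateau R (snd z))) \<le> 1 + e" by (simp only: norm_of_real)
  qed
  have lim: "(\<lambda>n. LINT z|F v. plateau (real n) (snd z)) \<longlonglongrightarrow> measure (F v) UNIV" if v: "v \<in> S" for v
  proof -
    interpret finite_measure "F v" using F_finite v by blast
    have "(\<lambda>n. LINT z|F v. plateau (real n) (snd z)) \<longlonglongrightarrow> (LINT z|F v. 1)"
    proof (rule integral_dominated_convergence[where w="\<lambda>_. 1"])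
      have "continuous_on UNIV (\<lambda>z::pt\<times>real. plateau (real n) (snd z))" for n
        unfolding plateau_def by (intro continuous_intros)
      then show "(\<lambda>z. plateau (real n) (snd z)) \<in> borel_measurable (F v)" for n
        by (intro F_measurable[OF v])
      show "AE z in F v. (\<lambda>n. plateau (real n) (snd z)) \<longlonglongrightarrow> 1"
      proof (rule AE_I2, rule tendsto_eventually)
        fix z :: "pt \<times> real"
        show "\<forall>\<^sub>F n in sequentially. plateau (real n) (snd z) = 1"
        proof (rule eventually_sequentiallyI[of "nat \<lceil>\<bar>snd z\<bar>\<rceil>"])
          fix n assume "nat \<lceil>\<bar>snd z\<bar>\<rceil> \<le> n"
          then have "\<bar>snd z\<bar> \<le> real n" by linarith
          then show "plateau (real n) (snd z) = 1" by (simp add: plateau_def)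
        qed
      qed
    qed (auto simp: plateau_def)
    then show ?thesis using sp[OF v] by simp
  qed
  have "(\<lambda>n. \<Sum>v\<in>S'. (LINT z|F v. plateau (real n) (snd z))) \<longlonglongrightarrow> (\<Sum>v\<in>S'. measure (F v) UNIV)"
    using S' by (intro tendsto_sum lim) auto
  then show ?thesis
  proof (rule LIMSEQ_le_const2)
    show "\<exists>N. \<forall>n\<ge>N. (\<Sum>v\<in>S'. (LINT z|F v. plateau (real n) (snd z))) \<le> 1"
      using R[OF of_nat_0_le_iff] by blast
  qed
qed

lemma mass_summable: "(\<lambda>v. measure (F v) UNIV) summable_on S" "(\<Sum>\<^sub>\<infinity>v\<in>S. measure (F v) UNIV) \<le> 1"
proof -
  show s: "(\<lambda>v. measure (F v) UNIV) summable_on S"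
    by (rule nonneg_bdd_above_summable_on) (auto intro!: bdd_aboveI2[of _ _ 1] mass_finite)
  show "(\<Sum>\<^sub>\<infinity>v\<in>S. measure (F v) UNIV) \<le> 1"
    by (rule infsum_le_finite_sums[OF s]) (rule mass_finite)
qed

section \<open>Limits of single words\<close>

text \<open>One of the two letters has a product with \<open>k\<close> comparable to the norm of
  \<open>k\<close>. Above a low-frequency cutoff its phase is then at least of order
  \<open>h / \<epsilon> h\<close>, and \<open>osc_lin_decay\<close> needs no other letter.\<close>

lemma word_limit_nonpar:
  assumes T: "T \<noteq> 0" and m: "m \<in> set w" "m' \<in> set w" "\<not> par m m'"
  shows "((\<lambda>h. shift_form (\<psi> h) j (\<lambda>k. osc_int (quantum_phase (T * kap h)) w 1 k)) \<longlongrightarrow> 0) (at_right 0)"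
proof (rule shift_form_tendsto_0)
  show "cmod (osc_int (quantum_phase (T * kap h)) w 1 k) \<le> 1" for h k by (rule norm_osc_int_le) simp
  fix e \<delta> :: real assume e: "e > 0" and d: "\<delta> > 0"
  obtain c where c: "c > 0" "\<And>k. c * norm (zshift k) \<le> max \<bar>zshift k \<bullet> zshift m\<bar> \<bar>zshift k \<bullet> zshift m'\<bar>"
    using nonpar_bound[OF m(3)] by blast
  have "((\<lambda>h. kap h * word_err T w) \<longlongrightarrow> 0 * word_err T w) (at_right 0)" by (intro tendsto_intros kap_tendsto)
  then have "\<forall>\<^sub>F h in at_right 0. kap h * word_err T w < e / 2" using e by (intro order_tendstoD(2)) auto
  \<comment> \<open>The 6 makes the selected phase at least \<open>6 / e\<close>, so that the decay
    bound 3/|phase| is at most \<open>e / 2\<close>; the other half covers the nonlinear part of the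
    phases.\<close>
  moreover have "\<forall>\<^sub>F h in at_right 0. h / \<epsilon> h > 6 / (e * (\<bar>T\<bar> * (2 * pi) * c * sqrt \<delta>))"
    using h_eps_at_top by (simp add: filterlim_at_top_dense)
  ultimately show "\<forall>\<^sub>F h in at_right 0. \<forall>k. k \<notin> low_freq \<delta> h \<longrightarrow> cmod (osc_int (quantum_phase (T * kap h)) w 1 k) \<le> e"
    using ev_h
  proof eventually_elim
    case (elim h)
    then have h: "0 < h" "h \<le> 1" by auto
    have ep: "\<epsilon> h > 0" using eps_pos h by auto
    have kp: "kap h > 0" by (rule kap_pos[OF h])
    show ?case
    proof (intro allI impI)
      fix k assume k: "k \<notin> low_freq \<delta> h"
      obtain u where u: "u \<in> set w" "\<bar>zshift k \<bullet> zshift u\<bar> = max \<bar>zshift k \<bullet> zshift m\<bar> \<bar>zshift k \<bullet> zshift m'\<bar>"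
        using m by (cases "\<bar>zshift k \<bullet> zshift m\<bar> \<le> \<bar>zshift k \<bullet> zshift m'\<bar>") (auto simp: max_def)
      have a: "\<bar>linear_phase (T * kap h) k u\<bar> = \<bar>T\<bar> * kap h * (4 * pi\<^sup>2) * \<bar>zshift k \<bullet> zshift u\<bar>"
        unfolding linear_phase_def using kp by (simp add: abs_mult)
      have "\<bar>T\<bar> * kap h * (4 * pi\<^sup>2) * (c * (sqrt \<delta> / (2 * pi * h))) \<le> \<bar>T\<bar> * kap h * (4 * pi\<^sup>2) * \<bar>zshift k \<bullet> zshift u\<bar>"
      proof (rule mult_left_mono)
        have "c * (sqrt \<delta> / (2 * pi * h)) \<le> c * norm (zshift k)"
          using c(1) not_low_freq[OF k h(1) d] by (intro mult_left_mono) auto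
        then show "c * (sqrt \<delta> / (2 * pi * h)) \<le> \<bar>zshift k \<bullet> zshift u\<bar>" using c(2)[of k] u(2) by simp
      qed (use kp in auto)
      moreover have "\<bar>T\<bar> * kap h * (4 * pi\<^sup>2) * (c * (sqrt \<delta> / (2 * pi * h))) = (h / \<epsilon> h) * (\<bar>T\<bar> * (2 * pi) * c * sqrt \<delta>)"
        using h ep by (simp add: kap_def field_simps power2_eq_square)
      moreover have "(h / \<epsilon> h) * (\<bar>T\<bar> * (2 * pi) * c * sqrt \<delta>) \<ge> 6 / e"
      proof -
        have q: "\<bar>T\<bar> * (2 * pi) * c * sqrt \<delta> > 0" using T c(1) d by simp
        have "6 / e \<le> x * Q" if "6 / (e * Q) < x" "Q > 0" for x Q using that e by (simp add: field_simps)
        from this[OF elim(2) q] show ?thesis .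
      qed
      ultimately have big: "\<bar>linear_phase (T * kap h) k u\<bar> \<ge> 6 / e" unfolding a by linarith
      then have nz: "linear_phase (T * kap h) k u \<noteq> 0" using e by auto
      have "3 / \<bar>linear_phase (T * kap h) k u\<bar> \<le> e / 2" using big e nz by (simp add: field_simps)
      then have "cmod (osc_lin w (linear_phase (T * kap h) k)) \<le> e / 2" using osc_lin_decay[OF u(1), of "linear_phase (T * kap h) k"] nz by simp
      then show "cmod (osc_int (quantum_phase (T * kap h)) w 1 k) \<le> e"
        using osc_int_quantum_phase_osc_lin[of "kap h" T w k] kp elim(1) 
          norm_triangle_sub[of "osc_int (quantum_phase (T * kap h)) w 1 k" "osc_lin w (linear_phase (T * kap h) k)"] by linarith
    qed
  qed
qed

text \<open>Along the orbit x + s \<eta> v/L the argument of \<open>ek m\<close> grows at rate 2 pi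
  \<eta> (v . m)/L, and \<open>T\<close> rescales the time. The quantum word integral therefore
  tends to the Dyson integral of the classical exponential.\<close>

definition osc_profile :: "real \<Rightarrow> int \<times> int \<Rightarrow> (int \<times> int) list \<Rightarrow> real \<Rightarrow> complex" where
  "osc_profile T v w \<eta> = osc_lin w (\<lambda>m. \<eta> * (2 * pi * T / Lv v * (zshift v \<bullet> zshift m)))"

lemma par_inner_mult:
  assumes "par v m" shows "(zshift k \<bullet> zshift v) * (zshift v \<bullet> zshift m) = (zshift k \<bullet> zshift m) * (zshift v \<bullet> zshift v)"
proof -
  obtain v1 v2 m1 m2 k1 k2 where e: "v = (v1, v2)" "m = (m1, m2)" "k = (k1, k2)" by (metis surj_pair)
  have p: "real_of_int v1 * m2 = real_of_int v2 * m1" using assms unfolding par_def e by (simp flip: of_int_mult)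
  \<comment> \<open>The difference of the two sides contains the determinant of \<open>v\<close> and
    \<open>m\<close> as a factor.\<close>
  have "(k1 * v1 + k2 * v2) * (v1 * m1 + v2 * m2) - (k1 * m1 + k2 * m2) * (v1 * v1 + v2 * v2) 
    = (k1 * v2 - k2 * v1) * (v1 * m2 - v2 * m1)" for k1 k2 v1 v2 m1 m2 :: real by (simp add: algebra_simps)
  from this[of k1 v1 k2 v2 m1 m2] show ?thesis using p by (simp add: e zshift_def inner_prod_def)
qed

text \<open>For letters parallel to \<open>v\<close> the linear phases depend on \<open>k\<close>
  only through \<open>eta h v k\<close>. The nonzero letter makes the profile vanish at infinity, so
  its limit is an integral against \<open>F v\<close>; passing from exact to linear phases costs
  O(kap h).\<close>

lemma word_limit_par:
  assumes T: "T \<noteq> 0" and v: "v \<in> S" and w: "\<And>m. m \<in> set w \<Longrightarrow> par v m" and m: "m \<in> set w" "m \<noteq> 0" and j: "par v j"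
  shows "((\<lambda>h. shift_form (\<psi> h) j (\<lambda>k. osc_int (quantum_phase (T * kap h)) w 1 k)) \<longlongrightarrow> (LINT z|F v. ek j (fst z) * osc_profile T v w (snd z))) (at_right 0)"
proof -
  have pv: "primitive v" using v S_prim by blast
  have L: "Lv v > 0" by (rule Lv_pos[OF pv])
  \<comment> \<open>A nonzero vector parallel to \<open>v\<close> is not orthogonal to it; this
    gives the letter a nonzero slope in \<eta>.\<close>
  have vm: "zshift v \<bullet> zshift m \<noteq> 0"
  proof
    assume "zshift v \<bullet> zshift m = 0"
    then have "(zshift m \<bullet> zshift m) * (zshift v \<bullet> zshift v) = 0" using par_inner_mult[OF w[OF m(1)], of m] by simp
    then show False using m(2) primitive_nz[OF pv] by (simp add: zshift_eq_0)
  qed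
  have van: "vanishing (osc_profile T v w)"
    unfolding osc_profile_def using vm T L by (intro vanishing_osc_lin[OF m(1)]) simp
  have lim: "((\<lambda>h. shift_form (\<psi> h) j (\<lambda>k. osc_profile T v w (eta h v k))) \<longlongrightarrow> (LINT z|F v. ek j (fst z) * osc_profile T v w (snd z))) (at_right 0)"
    by (rule shift_form_vanishing_limit[OF van v j])
  have e: "osc_profile T v w (eta h v k) = osc_lin w (linear_phase (T * kap h) k)" for h k
    unfolding osc_profile_def
  proof (rule osc_lin_cong)
    fix n assume "n \<in> set w"
    then have "(zshift k \<bullet> zshift v) * (zshift v \<bullet> zshift n) = (zshift k \<bullet> zshift n) * (Lv v * Lv v)"
      using par_inner_mult[OF w, of n k] by (simp add: Lv_sq[symmetric] power2_eq_square)
    then have "(zshift k \<bullet> zshift v) * (zshift v \<bullet> zshift n) / (Lv v * Lv v) = zshift k \<bullet> zshift n" using L by simp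
    then have "linear_phase (T * kap h) k n = T * kap h * (4 * pi\<^sup>2) * ((zshift k \<bullet> zshift v) * (zshift v \<bullet> zshift n) / (Lv v * Lv v))"
      by (simp only: linear_phase_def)
    then show "eta h v k * (2 * pi * T / Lv v * (zshift v \<bullet> zshift n)) = linear_phase (T * kap h) k n"
      unfolding eta_eq by (simp add: power2_eq_square)
  qed
  have "((\<lambda>h. shift_form (\<psi> h) j (\<lambda>k. osc_int (quantum_phase (T * kap h)) w 1 k) - shift_form (\<psi> h) j (\<lambda>k. osc_profile T v w (eta h v k))) \<longlongrightarrow> 0) (at_right 0)"
  proof (rule Lim_null_comparison)
    show "((\<lambda>h. kap h * word_err T w) \<longlongrightarrow> 0) (at_right 0)" using tendsto_mult_left_zero[OF kap_tendsto] .
    show "\<forall>\<^sub>F h in at_right 0. cmod (shift_form (\<psi> h) j (\<lambda>k. osc_int (quantum_phase (T * kap h)) w 1 k) - shift_form (\<psi> h) j (\<lambda>k. osc_profile T v w (eta h v k))) \<le> kap h * word_err T w"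
      using ev_h
    proof eventually_elim
      case (elim h)
      then have h: "0 < h" "h \<le> 1" by auto
      have kp: "kap h \<ge> 0" using kap_pos[OF h] by simp
      have w0: "word_err T w \<ge> 0" by (induction w) auto
      have "shift_form (\<psi> h) j (\<lambda>k. osc_int (quantum_phase (T * kap h)) w 1 k) - shift_form (\<psi> h) j (\<lambda>k. osc_profile T v w (eta h v k)) = shift_form (\<psi> h) j (\<lambda>k. osc_int (quantum_phase (T * kap h)) w 1 k - osc_profile T v w (eta h v k))"
        by (rule shift_form_diff[OF psiL[OF h], symmetric, of _ 1 _ 1]) (auto simp: e norm_osc_lin_le norm_osc_int_le)
      also have "cmod \<dots> \<le> kap h * word_err T w + 0 * sqrt (\<Sum>\<^sub>\<infinity>k\<in>{}. (cmod (fc (\<psi> h) k))\<^sup>2)"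
        using osc_int_quantum_phase_osc_lin[OF kp, of T w] kp w0 by (intro shift_form_bound[OF psiL[OF h]]) (auto simp: e)
      finally show ?case by simp
    qed
  qed
  from tendsto_add[OF this lim] show ?thesis by simp
qed

text \<open>The letter 0 has phase 0 for every \<open>h\<close>, so the form equals the constant
  times the squared norm of the datum, which is 1.\<close>

lemma word_limit_zero:
  assumes w: "set w \<subseteq> {0}"
  shows "((\<lambda>h. shift_form (\<psi> h) 0 (\<lambda>k. osc_int (quantum_phase (T * kap h)) w 1 k)) \<longlongrightarrow> osc_lin w (\<lambda>_. 0)) (at_right 0)"
proof (rule tendsto_eventually)
  show "\<forall>\<^sub>F h in at_right 0. shift_form (\<psi> h) 0 (\<lambda>k. osc_int (quantum_phase (T * kap h)) w 1 k) = osc_lin w (\<lambda>_. 0)"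
    using ev_h
  proof eventually_elim
    case (elim h)
    then have h: "0 < h" "h \<le> 1" by auto
    have "osc_err (quantum_phase (T * kap h)) k (\<lambda>m k. 0) 0 w = 0" for k using w by (induction w) (auto simp: quantum_phase_def)
    then have "osc_int (quantum_phase (T * kap h)) w 1 k = osc_lin w (\<lambda>_. 0)" for k
      using osc_int_diff_le[of 1 "quantum_phase (T * kap h)" w k "\<lambda>m k. 0" 0] by (simp add: osc_lin_def)
    then have "shift_form (\<psi> h) 0 (\<lambda>k. osc_int (quantum_phase (T * kap h)) w 1 k) = (\<Sum>\<^sub>\<infinity>k. osc_lin w (\<lambda>_. 0) * complex_of_real ((cmod (fc (\<psi> h) k))\<^sup>2))"
      unfolding shift_form_def by (intro infsum_cong) (simp add: complex_norm_square mult_ac del: of_real_power)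
    also have "\<dots> = osc_lin w (\<lambda>_. 0) * complex_of_real ((normT (\<psi> h))\<^sup>2)"
      by (intro infsumI has_sum_cmult_right has_sum_of_real parseval_norm psiL h)
    finally show ?case using psiL(2)[OF h] by simp
  qed
qed

end

section \<open>Dyson expansion of the propagators\<close>

lemma normT_le_iff_partial:
  assumes f: "L2T f" and B: "B \<ge> 0" and b: "\<And>K. finite K \<Longrightarrow> (\<Sum>k\<in>K. (cmod (fc f k))\<^sup>2) \<le> B\<^sup>2"
  shows "normT f \<le> B"
proof -
  have "(normT f)\<^sup>2 \<le> B\<^sup>2"
    by (rule has_sum_le_finite_sums[OF parseval_norm[OF f] b])
  then show ?thesis using B by (rule power2_le_imp_le)
qed

text \<open>Parseval's identity transfers Minkowski's inequality from finite sums of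
  coefficients.\<close>

lemma normT_triangle:
  assumes f: "L2T f" and g: "L2T g" shows "normT (\<lambda>x. f x + g x) \<le> normT f + normT g"
proof (rule normT_le_iff_partial[OF L2T_add[OF f g]])
  fix K :: "(int \<times> int) set" assume K: "finite K"
  have b: "L2_set (\<lambda>k. cmod (fc f k)) K \<le> normT f" if "L2T f" for f
    using bessel[OF that K] unfolding L2_set_def by (simp add: real_le_lsqrt sum_nonneg)
  have "L2_set (\<lambda>k. cmod (fc f k + fc g k)) K \<le> L2_set (\<lambda>k. cmod (fc f k) + cmod (fc g k)) K"
    by (intro L2_set_mono norm_triangle_ineq) simp
  also have "\<dots> \<le> L2_set (\<lambda>k. cmod (fc f k)) K + L2_set (\<lambda>k. cmod (fc g k)) K" by (rule L2_set_triangle_ineq)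
  also have "\<dots> \<le> normT f + normT g" by (intro add_mono b f g)
  finally have "(L2_set (\<lambda>k. cmod (fc f k + fc g k)) K)\<^sup>2 \<le> (normT f + normT g)\<^sup>2"
    by (intro power_mono) (auto simp: L2_set_nonneg)
  then show "(\<Sum>k\<in>K. (cmod (fc (\<lambda>x. f x + g x) k))\<^sup>2) \<le> (normT f + normT g)\<^sup>2"
    by (simp add: fc_add f g L2_set_def sum_nonneg)
qed simp

lemma normT_minus_commute: "normT (\<lambda>x. f x - g x) = normT (\<lambda>x. g x - f x)"
  unfolding normT_def by (simp add: norm_minus_commute)

lemma normT_diff_le:
  assumes f: "L2T f" and g: "L2T g" shows "\<bar>normT f - normT g\<bar> \<le> normT (\<lambda>x. f x - g x)"
proof -
  have "normT (\<lambda>x. (f x - g x) + g x) \<le> normT (\<lambda>x. f x - g x) + normT g"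
    by (intro normT_triangle L2T_diff f g)
  moreover have "normT (\<lambda>x. (g x - f x) + f x) \<le> normT (\<lambda>x. g x - f x) + normT f"
    by (intro normT_triangle L2T_diff f g)
  ultimately show ?thesis using normT_minus_commute[of f g] by simp
qed

text \<open>Supplies the bound on compact time intervals required as the a priori input of
  \<open>dyson\<close>.\<close>

lemma schr_sol_continuous_norm:
  assumes s: "schr_sol h c V u" shows "continuous_on A (\<lambda>t. normT (u t))"
proof -
  have L: "L2T (u t)" for t using s unfolding schr_sol_def by blast
  have "((\<lambda>s. normT (u s)) \<longlongrightarrow> normT (u t)) (at t)" for t
  proof -
    have "((\<lambda>s. normT (\<lambda>x. u s x - u t x)) \<longlongrightarrow> 0) (at t)" using s unfolding schr_sol_def by blast
    then have "((\<lambda>s. normT (u s) - normT (u t)) \<longlongrightarrow> 0) (at t)"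
      by (rule Lim_null_comparison[rotated]) (auto intro!: always_eventually normT_diff_le L)
    then show ?thesis by (rule LIM_zero_cancel)
  qed
  then show ?thesis by (auto simp: continuous_on_def intro: tendsto_within_subset)
qed

section \<open>The quantum expansion\<close>

text \<open>The finitely supported part of the unit ball of the dual, so that
  \<open>test_bound\<close> expresses a bound on the l2 norm.\<close>

definition ell2_tests :: "((int\<times>int) set \<times> (int\<times>int \<Rightarrow> complex)) set" where
  "ell2_tests = {(K,\<phi>). finite K \<and> (\<Sum>k\<in>K. (cmod (\<phi> k))\<^sup>2) \<le> 1}"

lemma test_family_ell2_tests: "test_family ell2_tests"
  unfolding test_family_def ell2_tests_def by (auto simp: sum.reindex inj_on_def norm_mult)

lemma test_bound_ell2_tests:
  assumes f: "L2T f" shows "test_bound ell2_tests (\<lambda>k. cis (\<alpha> k) * fc f k) (normT f)"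
  unfolding test_bound_def ell2_tests_def
proof safe
  fix K and \<phi> :: "int \<times> int \<Rightarrow> complex" assume K: "finite K" "(\<Sum>k\<in>K. (cmod (\<phi> k))\<^sup>2) \<le> 1"
  have "cmod (\<Sum>k\<in>K. \<phi> k * (cis (\<alpha> k) * fc f k)) \<le> sqrt (\<Sum>k\<in>K. (cmod (\<phi> k))\<^sup>2) * sqrt (\<Sum>k\<in>K. (cmod (cis (\<alpha> k) * fc f k))\<^sup>2)"
    by (rule norm_sum_L2)
  also have "\<dots> \<le> 1 * normT f"
    using K bessel[OF f K(1)] by (intro mult_mono) (auto simp: norm_mult real_le_lsqrt sum_nonneg)
  finally show "cmod (\<Sum>k\<in>K. \<phi> k * (cis (\<alpha> k) * fc f k)) \<le> normT f" by simp
qed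

text \<open>The equation contributes -\<i> \<epsilon>/h, and the rescaling of the time interval of
  length T h/\<epsilon> to [0,1] cancels everything but \<open>T\<close>.\<close>

definition coupling :: "real \<Rightarrow> (pt \<Rightarrow> real) \<Rightarrow> int \<times> int \<Rightarrow> complex" where
  "coupling T V m = - \<i> * complex_of_real T * fc (\<lambda>x. complex_of_real (V x)) m"

definition dyson_error :: "real \<Rightarrow> (int \<times> int \<Rightarrow> complex) \<Rightarrow> (int\<times>int) set \<Rightarrow> nat \<Rightarrow> real" where
  "dyson_error A c M n = dyson_const A * A ^ n / fact n + (A - (\<Sum>m\<in>M. cmod (c m))) * exp A * exp (A + 1)"

lemma norm_has_sum_le_partial:
  fixes f :: "'a \<Rightarrow> 'b::real_normed_vector"
  assumes "(f has_sum S) UNIV" "\<And>K. finite K \<Longrightarrow> norm (sum f K) \<le> B"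
  shows "norm S \<le> B"
proof (rule tendsto_upperbound)
  show "((\<lambda>K. norm (sum f K)) \<longlongrightarrow> norm S) (finite_subsets_at_top UNIV)"
    using assms(1) unfolding has_sum_def by (rule tendsto_norm)
  show "\<forall>\<^sub>F K in finite_subsets_at_top UNIV. norm (sum f K) \<le> B"
    using assms(2) by (intro eventually_finite_subsets_at_top_weakI)
qed simp

lemma cis_has_vector_derivative:
  "((\<lambda>s. cis (s * a)) has_vector_derivative \<i> * complex_of_real a * cis (s * a)) (at s within B)"
proof -
  have "((\<lambda>z. exp (\<i> * (z * complex_of_real a))) has_field_derivative \<i> * complex_of_real a * exp (\<i> * (complex_of_real s * complex_of_real a))) (at (complex_of_real s))"
    by (auto intro!: derivative_eq_intros)
  from has_vector_derivative_real_field[OF this, of B] show ?thesis by (simp add: cis_conv_exp)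
qed

text \<open>The algebra of the interaction picture: the kinetic term of the equation cancels the
  derivative of the phase, and the potential term remains.\<close>

lemma interaction_identity:
  fixes t :: complex
  assumes 1: "t * z = - \<i> * q" and 2: "q * P = a" and 3: "q * r = b"
  shows "C * (t * (z * (P * f + r * g))) + \<i> * a * C * f = C * (- \<i> * b * g)"
proof -
  have "t * (z * (P * f + r * g)) = (t * z) * (P * f + r * g)" by simp
  also have "\<dots> = - \<i> * ((q * P) * f + (q * r) * g)" unfolding 1 by (simp add: algebra_simps)
  finally have e: "t * (z * (P * f + r * g)) = - \<i> * (a * f + b * g)" unfolding 2 3 .
  show ?thesis unfolding e by (simp add: algebra_simps)
qed

text \<open>Stated for a general coupling \<open>c\<close>, so that \<open>c = 0\<close> treats the
  free solution and \<open>c = \<epsilon>\<close> the perturbed one.\<close>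

lemma schr_sol_interaction_picture:
  assumes sol: "schr_sol h c V u" and h: "h \<noteq> 0" and \<epsilon>: "\<epsilon> \<noteq> 0"
  shows "deriv01 (\<lambda>s. cis (s * (T * (h\<^sup>2 / \<epsilon>) * (2 * pi\<^sup>2) * knorm2 k)) * fc (u (s * (T * (h / \<epsilon>)))) k)
    (\<lambda>s. cis (s * (T * (h\<^sup>2 / \<epsilon>) * (2 * pi\<^sup>2) * knorm2 k)) * 
      (- \<i> * complex_of_real (T * (c / \<epsilon>)) * fc (\<lambda>x. complex_of_real (V x) * u (s * (T * (h / \<epsilon>))) x) k))"
proof
  fix s :: real
  let ?a = "T * (h\<^sup>2 / \<epsilon>) * (2 * pi\<^sup>2) * knorm2 k" and ?\<tau> = "T * (h / \<epsilon>)"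
  let ?D = "\<lambda>t. (- \<i> / complex_of_real h) * (complex_of_real (2 * pi^2 * h^2 * knorm2 k) * fc (u t) k
             + complex_of_real c * fc (\<lambda>x. complex_of_real (V x) * u t x) k)"
  have D: "((\<lambda>t. fc (u t) k) has_vector_derivative ?D t) (at t)" for t
    using sol unfolding schr_sol_def by blast
  have "((\<lambda>s. s * ?\<tau>) has_vector_derivative ?\<tau>) (at s within {0..1})"
    unfolding has_real_derivative_iff_has_vector_derivative[symmetric] by (rule DERIV_cmult_Id[of ?\<tau>, unfolded mult.commute[of ?\<tau>]])
  from vector_diff_chain_within[OF this has_vector_derivative_at_within[OF D]]
  have "((\<lambda>s. fc (u (s * ?\<tau>)) k) has_vector_derivative complex_of_real ?\<tau> * ?D (s * ?\<tau>)) (at s within {0..1})"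
    by (simp add: o_def scaleR_conv_of_real)
  from has_vector_derivative_mult[OF cis_has_vector_derivative[of ?a s] this]
  have "((\<lambda>s. cis (s * ?a) * fc (u (s * ?\<tau>)) k) has_vector_derivative
    cis (s * ?a) * (complex_of_real ?\<tau> * ?D (s * ?\<tau>)) + \<i> * complex_of_real ?a * cis (s * ?a) * fc (u (s * ?\<tau>)) k) (at s within {0..1})" .
  moreover have e1: "complex_of_real ?\<tau> * (- \<i> / complex_of_real h) = - \<i> * complex_of_real (T / \<epsilon>)"
    using h by simp
  have r2: "T / \<epsilon> * (2 * pi^2 * h^2 * knorm2 k) = ?a" and r3: "T / \<epsilon> * c = T * (c / \<epsilon>)" by simp_all
  have e2: "complex_of_real (T / \<epsilon>) * complex_of_real (2 * pi^2 * h^2 * knorm2 k) = complex_of_real ?a"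
    unfolding of_real_mult[symmetric] r2 ..
  have e3: "complex_of_real (T / \<epsilon>) * complex_of_real c = complex_of_real (T * (c / \<epsilon>))"
    unfolding of_real_mult[symmetric] r3 ..
  have "cis (s * ?a) * (complex_of_real ?\<tau> * ?D (s * ?\<tau>)) + \<i> * complex_of_real ?a * cis (s * ?a) * fc (u (s * ?\<tau>)) k
    = cis (s * ?a) * (- \<i> * complex_of_real (T * (c / \<epsilon>)) * fc (\<lambda>x. complex_of_real (V x) * u (s * ?\<tau>) x) k)"
    by (rule interaction_identity[OF e1 e2 e3])
  ultimately show "((\<lambda>s. cis (s * ?a) * fc (u (s * ?\<tau>)) k) has_vector_derivative
     cis (s * ?a) * (- \<i> * complex_of_real (T * (c / \<epsilon>)) * fc (\<lambda>x. complex_of_real (V x) * u (s * ?\<tau>) x) k)) (at s within {0..1})"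
    by (simp only:)
qed

text \<open>In the interaction picture the free solution is constant, so the inner product becomes
  that of the datum with \<open>W\<close> at time 1. The conjugate of the datum is itself a test of
  norm at most 1, which converts the l2 bound on the remainder into a scalar one.\<close>

lemma quantum_dyson:
  fixes V :: "pt \<Rightarrow> real"
  assumes V: "continuous_on usq V" and A: "((\<lambda>m. cmod (coupling T V m)) has_sum A) UNIV"
    and h: "0 < h" and \<epsilon>: "0 < \<epsilon>" and M: "finite M"
    and psi: "L2T \<psi>" "normT \<psi> = 1"
    and u: "schr_sol h 0 V u" "u 0 = \<psi>" and uE: "schr_sol h \<epsilon> V uE" "uE 0 = \<psi>"
  shows "cmod (innerT (u (T * (h / \<epsilon>))) (uE (T * (h / \<epsilon>)))
    - (\<Sum>w\<in>words M n. word_coeff (coupling T V) w * shift_form \<psi> (sum_list w) (\<lambda>k. osc_int (quantum_phase (T * (h\<^sup>2 / \<epsilon>))) w 1 k)))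
    \<le> dyson_error A (coupling T V) M n"
proof -
  define \<tau> where "\<tau> = T * (h / \<epsilon>)"
  define a where "a = (\<lambda>k. T * (h\<^sup>2 / \<epsilon>) * (2 * pi\<^sup>2) * knorm2 k)"
  define W where "W = (\<lambda>k s. cis (s * a k) * fc (uE (s * \<tau>)) k)"
  define W' where "W' = (\<lambda>k s. cis (s * a k) * (- \<i> * complex_of_real T * fc (\<lambda>x. complex_of_real (V x) * uE (s * \<tau>) x) k))"
  let ?c = "coupling T V" and ?\<theta> = "quantum_phase (T * (h\<^sup>2 / \<epsilon>))" and ?D = "dyson_sum (quantum_phase (T * (h\<^sup>2 / \<epsilon>))) (coupling T V) M (fc \<psi>) n 1"
  have Lu: "L2T (u t)" "L2T (uE t)" for t using u uE unfolding schr_sol_def by blast+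
  have W: "deriv01 (W k) (W' k)" for k
    using schr_sol_interaction_picture[OF uE(1), of \<epsilon> T k] h \<epsilon> by (simp add: W_def W'_def a_def \<tau>_def)
  have W0: "W k 0 = fc \<psi> k" for k by (simp add: W_def uE(2))
  have "test_bound ell2_tests (\<lambda>k. W k 1 - ?D k) (dyson_const A * A ^ n / fact n + (A - (\<Sum>m\<in>M. cmod (?c m))) * exp A * exp (A + 1))"
  proof (rule dyson[OF test_family_ell2_tests M A _ W W0])
    show "test_bound ell2_tests (fc \<psi>) 1" using test_bound_ell2_tests[OF psi(1), of "\<lambda>_. 0"] psi(2) by simp
    fix k and s :: real assume s: "s \<in> {0..1}"
    have "((\<lambda>m. (cis (s * a k) * (- \<i> * complex_of_real T)) * (fc (\<lambda>x. complex_of_real (V x)) m * fc (uE (s * \<tau>)) (k - m))) has_sum 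
      (cis (s * a k) * (- \<i> * complex_of_real T)) * fc (\<lambda>x. complex_of_real (V x) * uE (s * \<tau>) x) k) UNIV"
      by (intro has_sum_cmult_right fc_product V Lu)
    moreover have "?c m * (cis (s * ?\<theta> m (k - m)) * W (k - m) s) = 
      (cis (s * a k) * (- \<i> * complex_of_real T)) * (fc (\<lambda>x. complex_of_real (V x)) m * fc (uE (s * \<tau>)) (k - m))" for m
    proof -
      \<comment> \<open>The phase of the jump from \<open>k - m\<close> to \<open>k\<close> is the
        difference of the phases of the two frequencies, so only that of \<open>k\<close> is
        left.\<close>
      have "cis (s * ?\<theta> m (k - m)) * cis (s * a (k - m)) = cis (s * a k)"
        unfolding cis_mult by (rule arg_cong[of _ _ cis]) (simp add: quantum_phase_def a_def right_diff_distrib)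
      then show ?thesis unfolding W_def coupling_def by (simp add: mult_ac)
    qed
    ultimately show "((\<lambda>m. ?c m * (cis (s * ?\<theta> m (k - m)) * W (k - m) s)) has_sum W' k s) UNIV"
      unfolding W'_def by (simp add: mult.assoc)
  next
    have "compact ((\<lambda>s. normT (uE (s * \<tau>))) ` {0..1})"
      by (intro compact_continuous_image continuous_on_compose2[OF schr_sol_continuous_norm[OF uE(1), of UNIV]] continuous_intros) auto
    then obtain C where C: "\<And>s. s \<in> {0..1} \<Longrightarrow> normT (uE (s * \<tau>)) \<le> C"
      using compact_imp_bounded[of "(\<lambda>s. normT (uE (s * \<tau>))) ` {0..1}"] unfolding bounded_iff by fastforce
    show "\<exists>C. \<forall>s\<in>{0..1}. test_bound ell2_tests (\<lambda>k. W k s) C"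
      unfolding W_def using C by (intro exI[of _ C] ballI test_bound_mono[OF test_bound_ell2_tests[OF Lu(2)]]) auto
  qed
  then have test_bound: "test_bound ell2_tests (\<lambda>k. W k 1 - ?D k) (dyson_error A ?c M n)" by (simp add: dyson_error_def)
  have U: "fc (u \<tau>) k = cis (- a k) * fc \<psi> k" for k
  proof -
    have d: "deriv01 (\<lambda>s. cis (s * a k) * fc (u (s * \<tau>)) k) (\<lambda>s. 0)"
      using schr_sol_interaction_picture[OF u(1), of \<epsilon> T k] h \<epsilon> by (simp add: a_def \<tau>_def)
    have "norm (cis (1 * a k) * fc (u (1 * \<tau>)) k - cis (0 * a k) * fc (u (0 * \<tau>)) k) \<le> (\<lambda>s. 0 * s) 1 - (\<lambda>s. 0 * s) (0::real)"
      by (rule deriv01_bound[OF d deriv01_linear]) auto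
    then have "cis (a k) * fc (u \<tau>) k = fc \<psi> k" by (simp add: u(2))
    then have "cis (- a k) * (cis (a k) * fc (u \<tau>) k) = cis (- a k) * fc \<psi> k" by simp
    then show ?thesis by (simp add: mult.assoc[symmetric] cis_mult)
  qed
  have 1: "((\<lambda>k. cnj (fc \<psi> k) * W k 1) has_sum innerT (u \<tau>) (uE \<tau>)) UNIV"
    using parseval[OF Lu(1)[of \<tau>] Lu(2)[of \<tau>]] by (simp add: U W_def cis_cnj mult_ac)
  have qs: "((\<lambda>k. cnj (fc \<psi> k) * (word_coeff ?c w * osc_int ?\<theta> w 1 (k - sum_list w) * fc \<psi> (k - sum_list w))) has_sum 
    word_coeff ?c w * shift_form \<psi> (sum_list w) (\<lambda>k. osc_int ?\<theta> w 1 k)) UNIV" for w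
  proof -
    have "((\<lambda>k. word_coeff ?c w * (cnj (fc \<psi> (k + sum_list w)) * osc_int ?\<theta> w 1 k * fc \<psi> k)) has_sum 
      word_coeff ?c w * shift_form \<psi> (sum_list w) (\<lambda>k. osc_int ?\<theta> w 1 k)) UNIV"
      unfolding shift_form_def
      by (intro has_sum_cmult_right has_sum_infsum abs_summable_summable[OF shift_form_summable[OF psi, of _ 1]] norm_osc_int_le) simp
    then show ?thesis
      \<comment> \<open>The Dyson sum is indexed by the final frequency of a word,
        \<open>shift_form\<close> by its initial one.\<close>
      by (subst has_sum_reindex_bij_witness[of UNIV "\<lambda>k. k + sum_list w" "\<lambda>k. k - sum_list w" UNIV]) (auto simp: mult_ac)
  qed
  have 2: "((\<lambda>k. cnj (fc \<psi> k) * ?D k) has_sum (\<Sum>w\<in>words M n. word_coeff ?c w * shift_form \<psi> (sum_list w) (\<lambda>k. osc_int ?\<theta> w 1 k))) UNIV"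
    unfolding dyson_sum_def sum_distrib_left by (intro has_sum_finite_sum finite_words M qs)
  have "cmod (innerT (u \<tau>) (uE \<tau>) - (\<Sum>w\<in>words M n. word_coeff ?c w * shift_form \<psi> (sum_list w) (\<lambda>k. osc_int ?\<theta> w 1 k))) \<le> dyson_error A ?c M n"
  proof (rule norm_has_sum_le_partial[OF has_sum_minus_diff[OF 1 2]])
    fix K :: "(int\<times>int) set" assume K: "finite K"
    have "(K, \<lambda>k. cnj (fc \<psi> k)) \<in> ell2_tests" using bessel[OF psi(1) K] psi(2) K by (simp add: ell2_tests_def)
    then have "cmod (\<Sum>k\<in>K. cnj (fc \<psi> k) * (W k 1 - ?D k)) \<le> dyson_error A ?c M n" using test_bound unfolding test_bound_def by fastforce
    then show "cmod (\<Sum>k\<in>K. cnj (fc \<psi> k) * W k 1 - cnj (fc \<psi> k) * ?D k) \<le> dyson_error A ?c M n" by (simp add: right_diff_distrib)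
  qed
  then show ?thesis by (simp add: \<tau>_def)
qed

section \<open>The classical expansion\<close>

definition point_tests :: "((int\<times>int) set \<times> (int\<times>int \<Rightarrow> complex)) set" where
  "point_tests = {(K,\<phi>). \<exists>k. K = {k} \<and> cmod (\<phi> k) \<le> 1}"

lemma test_family_point_tests: "test_family point_tests"
  unfolding test_family_def point_tests_def by (auto simp: norm_mult)

lemma test_bound_point_tests: assumes "\<And>k. cmod (f k) \<le> B" shows "test_bound point_tests f B"
proof -
  have "cmod (\<Sum>k\<in>K. \<phi> k * f k) \<le> B" if K: "(K, \<phi>) \<in> point_tests" for K \<phi>
  proof -
    obtain k where k: "K = {k}" "cmod (\<phi> k) \<le> 1" using K unfolding point_tests_def by blast
    have "cmod (\<phi> k) * cmod (f k) \<le> 1 * B" using k assms by (intro mult_mono) auto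
    then show ?thesis by (simp add: k norm_mult)
  qed
  then show ?thesis unfolding test_bound_def by blast
qed

text \<open>Setting some coefficients to zero does not increase the error, so a single bound serves
  all directions at once.\<close>

lemma dyson_error_mono:
  assumes c: "((\<lambda>m. cmod (c m)) has_sum A) UNIV" and c': "((\<lambda>m. cmod (c' m)) has_sum A') UNIV"
    and le: "\<And>m. cmod (c' m) \<le> cmod (c m)" and M: "finite M"
  shows "dyson_error A' c' M n \<le> dyson_error A c M n"
proof -
  have A: "0 \<le> A'" "A' \<le> A" using has_sum_mono[OF c' c] le has_sum_nonneg[OF c'] by auto
  have s': "((\<lambda>m. cmod (c' m)) has_sum (A' - (\<Sum>m\<in>M. cmod (c' m)))) (UNIV - M)"
    by (intro has_sum_Diff c' has_sum_finite M) auto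
  have s: "((\<lambda>m. cmod (c m)) has_sum (A - (\<Sum>m\<in>M. cmod (c m)))) (UNIV - M)"
    by (intro has_sum_Diff c has_sum_finite M) auto
  have t: "A' - (\<Sum>m\<in>M. cmod (c' m)) \<le> A - (\<Sum>m\<in>M. cmod (c m))"
    by (rule has_sum_mono[OF s' s le])
  have t': "0 \<le> A' - (\<Sum>m\<in>M. cmod (c' m))"
    by (rule has_sum_nonneg[OF s']) simp
  have "dyson_const A' \<le> dyson_const A" unfolding dyson_const_def using A by (intro add_mono mult_mono) auto
  moreover have "0 \<le> dyson_const A'" using A by (simp add: dyson_const_def)
  ultimately show ?thesis unfolding dyson_error_def using A t t'
    by (intro add_mono divide_right_mono mult_mono power_mono) auto
qed

text \<open>The scalar equation y' = g y is lifted to the lattice by putting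
  \<open>ek (- k) x\<close> times \<open>y\<close> at the site \<open>k\<close>: multiplication by
  the character \<open>ek m\<close> becomes the translation from \<open>k\<close> to
  \<open>k - m\<close>, with position-independent phases, and \<open>dyson\<close> applies in the
  sup norm. The site 0 gives back \<open>y\<close>.\<close>

lemma classical_dyson:
  assumes A: "((\<lambda>m. cmod (c m)) has_sum A) UNIV" and M: "finite M"
    and g: "\<And>s. s \<in> {0..1} \<Longrightarrow> ((\<lambda>m. if Q m then c m * (ek m x * cis (s * p m)) else 0) has_sum g s) UNIV"
    and y: "deriv01 y (\<lambda>s. g s * y s)" and mean_osc: "y 0 = 1" and y1: "\<And>s. s \<in> {0..1} \<Longrightarrow> cmod (y s) \<le> 1"
  shows "cmod (y 1 - (\<Sum>w\<in>words M n. word_coeff (\<lambda>m. if Q m then c m else 0) w * (ek (sum_list w) x * osc_lin w p))) \<le> dyson_error A c M n"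
proof -
  let ?c = "\<lambda>m. if Q m then c m else 0"
  have "(\<lambda>m. cmod (c m)) summable_on UNIV" using A by (auto simp: summable_on_def)
  then have "(\<lambda>m. cmod (?c m)) summable_on UNIV"
    by (rule Infinite_Sum.abs_summable_on_comparison_test') simp
  then obtain A' where A': "((\<lambda>m. cmod (?c m)) has_sum A') UNIV" by (auto simp: summable_on_def)
  have EE: "dyson_error A' ?c M n \<le> dyson_error A c M n" by (rule dyson_error_mono[OF A A' _ M]) auto
  let ?D = "dyson_sum (\<lambda>m k. p m) ?c M (\<lambda>k. ek (- k) x) n 1"
  have "test_bound point_tests (\<lambda>k. ek (- k) x * y 1 - ?D k) (dyson_const A' * A' ^ n / fact n + (A' - (\<Sum>m\<in>M. cmod (?c m))) * exp A' * exp (A' + 1))"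
  proof (rule dyson[OF test_family_point_tests M A', where W="\<lambda>k s. ek (- k) x * y s" and W'="\<lambda>k s. ek (- k) x * (g s * y s)"])
    show "test_bound point_tests (\<lambda>k. ek (- k) x) 1" by (rule test_bound_point_tests) simp
    show "deriv01 (\<lambda>s. ek (- k) x * y s) (\<lambda>s. ek (- k) x * (g s * y s))" for k
      using y by (auto intro!: has_vector_derivative_mult_right)
    show "ek (- k) x * y 0 = ek (- k) x" for k by (simp add: mean_osc)
    show "\<exists>C. \<forall>s\<in>{0..1}. test_bound point_tests (\<lambda>k. ek (- k) x * y s) C"
      using y1 by (intro exI[of _ 1] ballI test_bound_point_tests) (auto simp: norm_mult)
    fix k and s :: real assume s: "s \<in> {0..1}"
    have H: "((\<lambda>m. (ek (- k) x * y s) * (if Q m then c m * (ek m x * cis (s * p m)) else 0)) has_sum (ek (- k) x * y s) * g s) UNIV"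
      by (intro has_sum_cmult_right g s)
    have E: "(ek (- k) x * y s) * (if Q m then c m * (ek m x * cis (s * p m)) else 0) = ?c m * (cis (s * p m) * (ek (- (k - m)) x * y s))" for m
    proof -
      have "ek (- (k - m)) x = ek m x * ek (- k) x" using ek_add[of m "- k" x] by simp
      then show ?thesis by simp
    qed
    have S: "(ek (- k) x * y s) * g s = ek (- k) x * (g s * y s)" by simp
    show "((\<lambda>m. ?c m * (cis (s * p m) * (ek (- (k - m)) x * y s))) has_sum ek (- k) x * (g s * y s)) UNIV"
      using H unfolding E S .
  qed
  then have "test_bound point_tests (\<lambda>k. ek (- k) x * y 1 - ?D k) (dyson_error A c M n)" using EE test_bound_mono unfolding dyson_error_def by blast
  moreover have "({0}, \<lambda>_. 1) \<in> point_tests"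
    unfolding point_tests_def mem_Collect_eq prod.case by (intro exI[of _ 0] conjI) simp_all
  ultimately have "cmod (y 1 - ?D 0) \<le> dyson_error A c M n" unfolding test_bound_def by fastforce
  moreover have "?D 0 = (\<Sum>w\<in>words M n. word_coeff ?c w * (ek (sum_list w) x * osc_lin w p))"
    unfolding dyson_sum_def by (simp add: osc_int_osc_lin mult_ac)
  ultimately show ?thesis by simp
qed

lemma dyson_error_small:
  assumes A: "((\<lambda>m. cmod (c m)) has_sum A) UNIV" and e: "e > 0"
  obtains M n where "finite M" "dyson_error A c M n < e"
proof -
  have "(\<lambda>n. dyson_const A * (A ^ n / fact n)) \<longlonglongrightarrow> dyson_const A * 0" by (intro tendsto_intros power_over_fact_tendsto_0)
  then have "\<forall>\<^sub>F n in sequentially. dyson_const A * (A ^ n / fact n) < e / 2" using e by (intro order_tendstoD(2)) auto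
  then obtain n where n: "dyson_const A * (A ^ n / fact n) < e / 2"
    using eventually_happens[of _ sequentially] by auto
  have "((\<lambda>K. (A - (\<Sum>m\<in>K. cmod (c m))) * exp A * exp (A + 1)) \<longlongrightarrow> (A - A) * exp A * exp (A + 1)) (finite_subsets_at_top UNIV)"
    using A unfolding has_sum_def by (intro tendsto_intros)
  then have "\<forall>\<^sub>F K in finite_subsets_at_top UNIV. (A - (\<Sum>m\<in>K. cmod (c m))) * exp A * exp (A + 1) < e / 2"
    using e by (intro order_tendstoD(2)) auto
  then obtain M where M: "finite M" "(A - (\<Sum>m\<in>M. cmod (c m))) * exp A * exp (A + 1) < e / 2"
    unfolding eventually_finite_subsets_at_top by blast
  have "dyson_error A c M n < e" unfolding dyson_error_def using n M(2) unfolding times_divide_eq_right by linarith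
  then show ?thesis by (rule that[OF M(1)])
qed

section \<open>The limit of the fidelity\<close>

lemma continuous_Iv0:
  assumes V: "continuous_on UNIV V" and v: "primitive v" shows "continuous_on UNIV (Iv0 v V)"
proof -
  have L: "Lv v > 0" by (rule Lv_pos[OF v])
  have c: "continuous_on UNIV (\<lambda>x. integral (cbox 0 (Lv v)) (\<lambda>t. V (x + (t / Lv v) *\<^sub>R zshift (vperp v))))"
    using L by (intro integral_continuous_on_param) 
      (auto simp: split_beta intro!: continuous_on_compose2[OF V] continuous_intros)
  have e: "Iv0 v V x = (1 / Lv v) * integral (cbox 0 (Lv v)) (\<lambda>t. V (x + (t / Lv v) *\<^sub>R zshift (vperp v)))" for x
  proof -
    have "continuous_on {0..Lv v} (\<lambda>t. V (x + (t / Lv v) *\<^sub>R zshift (vperp v)))"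
      using L by (intro continuous_on_compose2[OF V] continuous_intros) auto
    then show ?thesis unfolding Iv0_def
      using interval_integral_continuous[of 0 "Lv v"] L by (simp add: zero_ereal_def)
  qed
  show ?thesis unfolding ext[of "Iv0 v V", OF e] by (intro continuous_intros c)
qed

lemma continuous_interval_integral_param:
  fixes f :: "'a::topological_space \<Rightarrow> real \<Rightarrow> real" and T :: real
  assumes f: "continuous_on UNIV (\<lambda>(z, r). f z r)"
  shows "continuous_on UNIV (\<lambda>z. LBINT r=0..T. f z r)"
proof -
  have fz: "continuous_on A (f z)" for z A
  proof -
    have "continuous_on A (\<lambda>r. (z, r))" by (intro continuous_intros)
    from continuous_on_compose2[OF f this] show ?thesis by simp
  qed
  have c: "continuous_on UNIV (\<lambda>z. integral (cbox a b) (f z))" for a b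
    by (rule integral_continuous_on_param) (rule continuous_on_subset[OF f], simp)
  show ?thesis
  proof (cases "T \<ge> 0")
    case True
    then have "(LBINT r=0..T. f z r) = integral (cbox 0 T) (f z)" for z
      using interval_integral_continuous[OF True fz] by (simp add: zero_ereal_def)
    then show ?thesis using c by simp
  next
    case False
    then have T: "T \<le> 0" by simp
    have "(LBINT r=0..T. f z r) = - integral (cbox T 0) (f z)" for z
      using interval_integral_continuous[OF T fz] by (subst interval_integral_endpoints_reverse) (simp add: zero_ereal_def)
    then show ?thesis using c by (simp add: continuous_on_minus)
  qed
qed

lemma interval_integral_has_derivative:
  fixes f :: "real \<Rightarrow> real"
  assumes f: "continuous_on UNIV f"
  shows "((\<lambda>u. LBINT r=0..u. f r) has_real_derivative f u) (at u)"
proof -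
  define B where "B = \<bar>u\<bar> + 1"
  define \<Phi> where "\<Phi> = (\<lambda>w. integral {-B..w} f)"
  have d: "(\<Phi> has_vector_derivative f w) (at w within {-B..B})" if "w \<in> {-B..B}" for w
    unfolding \<Phi>_def by (rule integral_has_vector_derivative[OF continuous_on_subset[OF f] that]) simp
  have e: "(LBINT r=0..w. f r) = \<Phi> w - \<Phi> 0" if w: "w \<in> {-B<..<B}" for w
  proof -
    have s: "{min 0 w..max 0 w} \<subseteq> {-B..B}" using w by auto
    have "(LBINT r=ereal 0..ereal w. f r) = \<Phi> w - \<Phi> 0"
      by (rule interval_integral_FTC_finite)
        (use s in \<open>auto intro!: continuous_on_subset[OF f] has_vector_derivative_within_subset[OF d _]\<close>)
    then show ?thesis by (simp add: zero_ereal_def)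
  qed
  have u: "u \<in> {-B<..<B}" by (auto simp: B_def)
  have "(\<Phi> has_real_derivative f u) (at u)"
    using d[of u] u at_within_Icc_at[of "-B" u B] by (simp add: has_real_derivative_iff_has_vector_derivative)
  then have "((\<lambda>w. \<Phi> w - \<Phi> 0) has_real_derivative f u) (at u)" by (auto intro!: derivative_eq_intros)
  moreover have "\<forall>\<^sub>F w in nhds u. (LBINT r=0..w. f r) = \<Phi> w - \<Phi> 0"
    using eventually_nhds_in_open[of "{-B<..<B}" u] u by (auto elim!: eventually_mono intro: e)
  ultimately show ?thesis by (subst DERIV_cong_ev[OF refl _ refl])
qed

lemma sum_list_par: "(\<And>m. m \<in> set w \<Longrightarrow> par v m) \<Longrightarrow> par v (sum_list w)"
  by (induction w) (auto simp: par_def algebra_simps)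

lemma word_coeff_restrict: "word_coeff (\<lambda>m. if Q m then c m else 0) w = (if \<forall>m\<in>set w. Q m then word_coeff c w else 0)"
  by (induction w) auto

text \<open>Parallelism is transitive through a nonzero vector only: the determinant of
  \<open>v\<close> and \<open>v'\<close> is killed by both coordinates of \<open>m\<close>.\<close>

lemma par_common:
  assumes "par v m" "par v' m" "m \<noteq> 0" shows "par v v'"
proof -
  obtain v1 v2 u1 u2 m1 m2 where e: "v = (v1,v2)" "v' = (u1,u2)" "m = (m1,m2)" by (metis surj_pair)
  have a: "v1 * m2 = v2 * m1" "u1 * m2 = u2 * m1" using assms by (simp_all add: par_def e)
  have "m1 * (v1 * u2 - v2 * u1) = v1 * (u2 * m1) - u1 * (v2 * m1)" by (simp add: algebra_simps)
  also have "\<dots> = 0" unfolding a[symmetric] by simp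
  finally have 1: "m1 * (v1 * u2 - v2 * u1) = 0" .
  have "m2 * (v1 * u2 - v2 * u1) = u2 * (v1 * m2) - v2 * (u1 * m2)" by (simp add: algebra_simps)
  also have "\<dots> = 0" unfolding a by simp
  finally have 2: "m2 * (v1 * u2 - v2 * u1) = 0" .
  show ?thesis using 1 2 assms(3) by (auto simp: par_def e zero_prod_def)
qed

lemma par_zero [simp]: "par v 0"
  by (simp add: par_def)

definition phase :: "real \<Rightarrow> (pt \<Rightarrow> real) \<Rightarrow> int \<times> int \<Rightarrow> pt \<times> real \<Rightarrow> real" where
  "phase T V v z = (LBINT s=0..T. Iv0 v V (fst z + (s * snd z / Lv v) *\<^sub>R zshift v))"

section \<open>Resummation along each direction\<close>

locale semiclassical_potential = semiclassical +
  fixes V :: "pt \<Rightarrow> real" and T :: real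
  assumes V_smooth: "smooth V" and V_per: "periodic V" and T: "T \<noteq> 0"
begin

lemma V_cont: "continuous_on X V"
  using continuous_dd[OF V_smooth, of X "[]"] by simp

abbreviation c :: "int \<times> int \<Rightarrow> complex" where "c \<equiv> coupling T V"

definition Atot :: real where "Atot = (\<Sum>\<^sub>\<infinity>m. cmod (c m))"

lemma A: "((\<lambda>m. cmod (c m)) has_sum Atot) UNIV"
proof -
  have "(\<lambda>m. \<bar>T\<bar> * cmod (fc (\<lambda>x. complex_of_real (V x)) m)) summable_on UNIV"
    by (intro summable_on_cmult_right smooth_fc_summable V_smooth V_per)
  then have "(\<lambda>m. cmod (c m)) summable_on UNIV" by (simp add: coupling_def norm_mult)
  then show ?thesis unfolding Atot_def by (rule has_sum_infsum)
qed

abbreviation err where "err M n \<equiv> dyson_error Atot c M n"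

text \<open>The sign is opposite to that of the final formula because the expansion concerns the
  inner product with the free solution on the left.\<close>

definition limit_osc :: "int \<times> int \<Rightarrow> pt \<times> real \<Rightarrow> complex" where
  "limit_osc v z = exp (- \<i> * complex_of_real (phase T V v z))"

definition mean_osc :: complex where "mean_osc = exp (- \<i> * complex_of_real (T * (LINT x | MT. V x)))"

text \<open>The truncated Dyson series of \<open>limit_osc v z\<close>; \<open>D0\<close> below is
  the one of \<open>mean_osc\<close>. Both use the words of the quantum expansion, with the other
  letters suppressed through their coefficients.\<close>

definition Dv :: "(int\<times>int) set \<Rightarrow> nat \<Rightarrow> int \<times> int \<Rightarrow> pt \<times> real \<Rightarrow> complex" where
  "Dv M n v z = (\<Sum>w\<in>words M n. word_coeff (\<lambda>m. if par v m then c m else 0) w * (ek (sum_list w) (fst z) * osc_profile T v w (snd z)))"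

definition D0 :: "(int\<times>int) set \<Rightarrow> nat \<Rightarrow> complex" where
  "D0 M n = (\<Sum>w\<in>words M n. word_coeff (\<lambda>m. if m = 0 then c m else 0) w * osc_lin w (\<lambda>_. 0))"

lemma continuous_orbit:
  assumes v: "primitive v"
  shows "continuous_on UNIV (\<lambda>(z, s). Iv0 v V (fst z + (s * snd z / Lv v) *\<^sub>R zshift v))"
  unfolding split_beta
  using Lv_pos[OF v] by (intro continuous_on_compose2[OF continuous_Iv0[OF V_cont v]] continuous_intros) auto

text \<open>The exponential solves a scalar equation whose coefficient is the averaged potential
  along the orbit, and by \<open>Iv0_has_sum\<close> its Fourier modes are those of \<open>V\<close>
  parallel to \<open>v\<close>. The bound is uniform in \<open>v\<close> and in the point.\<close>

lemma limit_osc_Dv: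
  assumes v: "primitive v" and M: "finite M"
  shows "cmod (limit_osc v z - Dv M n v z) \<le> err M n"
proof -
  define p where "p = (\<lambda>m. snd z * (2 * pi * T / Lv v * (zshift v \<bullet> zshift m)))"
  define f where "f = (\<lambda>s. Iv0 v V (fst z + (s * snd z / Lv v) *\<^sub>R zshift v))"
  define y where "y = (\<lambda>s. exp (- \<i> * complex_of_real (LBINT r=0..s * T. f r)))"
  have fcont: "continuous_on UNIV f"
  proof -
    have "continuous_on UNIV (\<lambda>s. (z, s))" by (intro continuous_intros)
    from continuous_on_compose2[OF continuous_orbit[OF v] this] show ?thesis by (simp add: f_def)
  qed
  have L: "Lv v > 0" by (rule Lv_pos[OF v])
  have "cmod (y 1 - (\<Sum>w\<in>words M n. word_coeff (\<lambda>m. if par v m then c m else 0) w * (ek (sum_list w) (fst z) * osc_lin w p))) \<le> err M n"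
  proof (rule classical_dyson[OF A M, where g="\<lambda>s. - \<i> * complex_of_real T * complex_of_real (f (s * T))"])
    fix s :: real
    have "((\<lambda>m. - \<i> * complex_of_real T * (if par v m then fc (\<lambda>x. complex_of_real (V x)) m * ek m (fst z + (s * T * snd z / Lv v) *\<^sub>R zshift v) else 0)) has_sum
      - \<i> * complex_of_real T * complex_of_real (f (s * T))) UNIV"
      unfolding f_def by (intro has_sum_cmult_right Iv0_has_sum V_cont V_per smooth_fc_summable V_smooth v)
    moreover have "ek m (fst z + (s * T * snd z / Lv v) *\<^sub>R zshift v) = ek m (fst z) * cis (s * p m)" for m
      unfolding ek_shift by (simp add: ek_cis[of m "_ *\<^sub>R _"] p_def inner_commute mult_ac)
    ultimately show "((\<lambda>m. if par v m then c m * (ek m (fst z) * cis (s * p m)) else 0) has_sum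
      - \<i> * complex_of_real T * complex_of_real (f (s * T))) UNIV"
      by (simp add: coupling_def if_distrib mult.assoc cong: if_cong)
  next
    show "deriv01 y (\<lambda>s. - \<i> * complex_of_real T * complex_of_real (f (s * T)) * y s)"
    proof
      fix s :: real
      have "((\<lambda>s. LBINT r=0..s * T. f r) has_real_derivative f (s * T) * T) (at s within {0..1})"
        by (rule DERIV_chain2[OF interval_integral_has_derivative[OF fcont]]) (auto intro!: derivative_eq_intros)
      then have "((\<lambda>s. complex_of_real (LBINT r=0..s * T. f r)) has_vector_derivative complex_of_real (f (s * T) * T)) (at s within {0..1})"
        by (rule has_vector_derivative_of_real)
      then have "((\<lambda>s. - \<i> * complex_of_real (LBINT r=0..s * T. f r)) has_vector_derivative - \<i> * complex_of_real (f (s * T) * T)) (at s within {0..1})"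
        by (rule has_vector_derivative_mult_right)
      from field_vector_diff_chain_within[OF this DERIV_exp[THEN has_field_derivative_at_within]]
      show "(y has_vector_derivative - \<i> * complex_of_real T * complex_of_real (f (s * T)) * y s) (at s within {0..1})"
        by (simp add: y_def o_def mult_ac)
    qed
    show "y 0 = 1" by (simp add: y_def zero_ereal_def[symmetric])
    show "cmod (y s) \<le> 1" for s by (simp add: y_def norm_exp_eq_Re)
  qed
  moreover have "y 1 = limit_osc v z" by (simp add: y_def limit_osc_def phase_def f_def)
  ultimately show ?thesis unfolding Dv_def osc_profile_def p_def by simp
qed

lemma mean_osc_D0:
  assumes M: "finite M" shows "cmod (mean_osc - D0 M n) \<le> err M n"
proof -
  define b where "b = T * (LINT x | MT. V x)"
  have c0: "c 0 = - \<i> * complex_of_real b"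
    by (simp add: coupling_def fc_def innerT_def ek_0[abs_def] b_def)
  define y where "y = (\<lambda>s. cis (s * (- b)))"
  have "cmod (y 1 - (\<Sum>w\<in>words M n. word_coeff (\<lambda>m. if m = 0 then c m else 0) w * (ek (sum_list w) 0 * osc_lin w (\<lambda>_. 0)))) \<le> err M n"
  proof (rule classical_dyson[OF A M, where g="\<lambda>s. c 0"])
    show "((\<lambda>m. if m = 0 then c m * (ek m 0 * cis (s * 0)) else 0) has_sum c 0) UNIV" for s
      using has_sum_if_finite[of "{0}" c] by (simp add: ek_cis cong: if_cong)
    show "deriv01 y (\<lambda>s. c 0 * y s)"
      using cis_has_vector_derivative[of "- b"] by (simp add: y_def c0)
  qed (auto simp: y_def)
  moreover have "y 1 = mean_osc" by (simp add: y_def mean_osc_def b_def cis_conv_exp)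
  ultimately show ?thesis by (simp add: D0_def ek_cis)
qed

lemma limit_osc_integrable:
  assumes v: "v \<in> S" shows "integrable (F v) (limit_osc v)"
proof -
  interpret finite_measure "F v" using F_finite v by blast
  have pv: "primitive v" using S_prim v by blast
  have "continuous_on UNIV (limit_osc v)"
    unfolding limit_osc_def phase_def
    by (intro continuous_intros continuous_interval_integral_param continuous_orbit pv)
  then have "limit_osc v \<in> borel_measurable (F v)" by (rule F_measurable[OF v])
  then show ?thesis by (intro integrable_const_bound[of _ 1]) (auto simp: limit_osc_def norm_exp_eq_Re)
qed

lemma continuous_osc_profile: "continuous_on X (osc_profile T v w)"
proof -
  have "(\<Sum>m\<leftarrow>w. \<bar>2 * pi * T / Lv v * (zshift v \<bullet> zshift m)\<bar>)-lipschitz_on UNIV (osc_profile T v w)"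
    by (rule lipschitz_onI)
      (use osc_lin_linear_lipschitz[of w _ "\<lambda>m. 2 * pi * T / Lv v * (zshift v \<bullet> zshift m)"] in 
        \<open>auto simp: osc_profile_def dist_norm mult.commute[of "sum_list _"] intro!: sum_list_nonneg\<close>)
  then show ?thesis by (rule lipschitz_on_continuous_on[OF lipschitz_on_subset]) simp
qed

lemma word_integrable:
  assumes v: "v \<in> S" shows "integrable (F v) (\<lambda>z. ek j (fst z) * osc_profile T v w (snd z))"
proof -
  interpret finite_measure "F v" using F_finite v by blast
  have "continuous_on UNIV (\<lambda>z::pt\<times>real. ek j (fst z) * osc_profile T v w (snd z))"
    by (intro continuous_intros continuous_on_compose2[OF continuous_ek[of UNIV]] continuous_on_compose2[OF continuous_osc_profile[of UNIV]]) auto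
  then have "(\<lambda>z. ek j (fst z) * osc_profile T v w (snd z)) \<in> borel_measurable (F v)" by (rule F_measurable[OF v])
  then show ?thesis by (intro integrable_const_bound[of _ 1]) (auto simp: norm_mult osc_profile_def norm_osc_lin_le)
qed

lemma Dv_integrable: "v \<in> S \<Longrightarrow> integrable (F v) (Dv M n v)"
  unfolding Dv_def by (intro Bochner_Integration.integrable_sum integrable_mult_right word_integrable)

text \<open>In the second case a letter is nonzero, so that \<open>v\<close> is unique.\<close>

definition word_lim :: "(int \<times> int) list \<Rightarrow> complex" where
  "word_lim w = (if set w \<subseteq> {0} then osc_lin w (\<lambda>_. 0) else 
     if \<exists>v\<in>S. \<forall>m\<in>set w. par v m then (let v = (THE v. v \<in> S \<and> (\<forall>m\<in>set w. par v m)) in LINT z|F v. ek (sum_list w) (fst z) * osc_profile T v w (snd z)) else 0)"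

lemma word_lim_par:
  assumes v: "v \<in> S" "\<forall>m\<in>set w. par v m" and w: "\<not> set w \<subseteq> {0}"
  shows "word_lim w = (LINT z|F v. ek (sum_list w) (fst z) * osc_profile T v w (snd z))"
proof -
  obtain m where m: "m \<in> set w" "m \<noteq> 0" using w by blast
  have "(THE v. v \<in> S \<and> (\<forall>m\<in>set w. par v m)) = v"
    by (rule the_equality) (use v m S_par_unique par_common in blast)+
  then show ?thesis using v w by (auto simp: word_lim_def)
qed

text \<open>Division by the gcd gives a primitive vector, and \<open>S\<close> contains it or its
  opposite.\<close>

lemma exists_direction:
  assumes "m \<noteq> 0" obtains v where "v \<in> S" "par v m"
proof -
  define d where "d = gcd (fst m) (snd m)"
  have d: "d \<noteq> 0" using assms by (auto simp: d_def prod_eq_iff)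
  define v where "v = (fst m div d, snd m div d)"
  have m: "fst m = d * fst v" "snd m = d * snd v" by (auto simp: v_def d_def)
  have pv: "primitive v" using d unfolding primitive_def v_def d_def fst_conv snd_conv by (intro div_gcd_coprime[unfolded coprime_iff_gcd_eq_1]) auto
  have p: "par v m" "par (- v) m" by (auto simp: par_def m)
  show ?thesis using S_choice pv p that by blast
qed

text \<open>If some letter \<open>m\<close> is nonzero, its direction is the only candidate for
  \<open>v\<close>: either all letters are parallel to it, or one of them is not parallel to
  \<open>m\<close> and the word disappears.\<close>

lemma word_limit:
  "((\<lambda>h. shift_form (\<psi> h) (sum_list w) (\<lambda>k. osc_int (quantum_phase (T * kap h)) w 1 k)) \<longlongrightarrow> word_lim w) (at_right 0)"
proof (cases "set w \<subseteq> {0}")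
  case True
  then have "sum_list w = 0" by (induction w) auto
  then show ?thesis using word_limit_zero[OF True] True by (simp add: word_lim_def)
next
  case False
  then obtain m where m: "m \<in> set w" "m \<noteq> 0" by blast
  show ?thesis
  proof (cases "\<exists>v\<in>S. \<forall>m\<in>set w. par v m")
    case True
    then obtain v where v: "v \<in> S" "\<forall>m\<in>set w. par v m" by blast
    show ?thesis unfolding word_lim_par[OF v False]
      using v m by (intro word_limit_par[OF T v(1) _ m] sum_list_par) auto
  next
    case no: False
    obtain v where v: "v \<in> S" "par v m" using exists_direction[OF m(2)] .
    then obtain m' where m': "m' \<in> set w" "\<not> par v m'" using no by blast
    have "\<not> par m m'"
    proof
      assume a: "par m m'"
      have "par m v" using v(2) by (simp add: par_def mult.commute)
      obtain v1 v2 m1 m2 n1 n2 where e: "v = (v1,v2)" "m = (m1,m2)" "m' = (n1,n2)" by (metis surj_pair)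
      have 1: "v1 * m2 = v2 * m1" "m1 * n2 = m2 * n1" using a v(2) by (simp_all add: par_def e)
      have "m1 * (v1 * n2 - v2 * n1) = v1 * (m1 * n2) - (v2 * m1) * n1" by (simp add: algebra_simps)
      also have "\<dots> = 0" unfolding 1(2) 1(1)[symmetric] by (simp add: algebra_simps)
      finally have "m1 * (v1 * n2 - v2 * n1) = 0" .
      moreover have "m2 * (v1 * n2 - v2 * n1) = (v1 * m2) * n2 - v2 * (m2 * n1)" by (simp add: algebra_simps)
      then have "m2 * (v1 * n2 - v2 * n1) = 0" unfolding 1(1) 1(2)[symmetric] by (simp add: algebra_simps)
      ultimately have "v1 * n2 - v2 * n1 = 0" using m(2) by (auto simp: e zero_prod_def)
      then show False using m'(2) by (simp add: par_def e)
    qed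
    moreover have "word_lim w = 0" unfolding word_lim_def using False no by (simp only: if_False)
    ultimately show ?thesis by (simp only:) (rule word_limit_nonpar[OF T m(1) m'(1)])
  qed
qed

definition directions :: "(int \<times> int) set \<Rightarrow> (int \<times> int) set" where
  "directions M = {v\<in>S. \<exists>m\<in>M. m \<noteq> 0 \<and> par v m}"

lemma finite_directions: assumes "finite M" shows "finite (directions M)"
proof -
  have "finite {v\<in>S. par v m}" if nz: "m \<noteq> 0" for m
  proof -
    obtain v where v: "v \<in> S" "par v m" using exists_direction[OF nz] .
    then have "{v\<in>S. par v m} \<subseteq> {v}" using S_par_unique par_common[OF _ _ nz] by blast
    then show ?thesis using finite_subset by blast
  qed
  then have "finite (\<Union>m\<in>M - {0}. {v\<in>S. par v m})" using assms by auto
  then show ?thesis by (rule finite_subset[rotated]) (auto simp: directions_def)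
qed

definition words_along :: "(int \<times> int) set \<Rightarrow> nat \<Rightarrow> int \<times> int \<Rightarrow> (int \<times> int) list set" where
  "words_along M n v = {w\<in>words M n. (\<forall>m\<in>set w. par v m) \<and> \<not> set w \<subseteq> {0}}"

text \<open>Words of zero letters have the same term in both sums and cancel; those left have
  profiles that vanish at infinity and can be integrated against \<open>F v\<close>.\<close>

lemma Dv_minus_D0:
  assumes M: "finite M"
  shows "Dv M n v z - D0 M n = (\<Sum>w\<in>words_along M n v. word_coeff c w * (ek (sum_list w) (fst z) * osc_profile T v w (snd z)))"
proof -
  let ?t = "\<lambda>w. word_coeff c w * (ek (sum_list w) (fst z) * osc_profile T v w (snd z))"
  have fW: "finite (words M n)" by (rule finite_words[OF M])
  have z: "ek (sum_list w) (fst z) * osc_profile T v w (snd z) = osc_lin w (\<lambda>_. 0)" if "set w \<subseteq> {0}" for w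
  proof -
    have "sum_list w = 0" using that by (induction w) auto
    moreover have "osc_profile T v w (snd z) = osc_lin w (\<lambda>_. 0)" unfolding osc_profile_def by (rule osc_lin_cong) (use that in auto)
    ultimately show ?thesis by simp
  qed
  have "Dv M n v z = (\<Sum>w\<in>words M n. if \<forall>m\<in>set w. par v m then ?t w else 0)"
    unfolding Dv_def word_coeff_restrict by (intro sum.cong) auto
  moreover have "D0 M n = (\<Sum>w\<in>words M n. if set w \<subseteq> {0} then ?t w else 0)"
    unfolding D0_def word_coeff_restrict by (intro sum.cong) (auto simp: z)
  ultimately have "Dv M n v z - D0 M n = (\<Sum>w\<in>words M n. (if \<forall>m\<in>set w. par v m then ?t w else 0) - (if set w \<subseteq> {0} then ?t w else 0))"
    by (simp add: sum_subtractf)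
  also have "\<dots> = (\<Sum>w\<in>words M n. if (\<forall>m\<in>set w. par v m) \<and> \<not> set w \<subseteq> {0} then ?t w else 0)"
  proof (rule sum.cong[OF refl])
    fix w
    have "set w \<subseteq> {0} \<Longrightarrow> \<forall>m\<in>set w. par v m" using par_zero by blast
    then show "(if \<forall>m\<in>set w. par v m then ?t w else 0) - (if set w \<subseteq> {0} then ?t w else 0)
      = (if (\<forall>m\<in>set w. par v m) \<and> \<not> set w \<subseteq> {0} then ?t w else 0)" by auto
  qed
  also have "\<dots> = (\<Sum>w\<in>words_along M n v. ?t w)" unfolding words_along_def using fW by (subst sum.inter_filter) auto
  finally show ?thesis .
qed

lemma words_along_empty: "v \<in> S \<Longrightarrow> v \<notin> directions M \<Longrightarrow> words_along M n v = {}"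
  unfolding words_along_def directions_def words_def by blast

text \<open>A nonzero letter determines its direction, so the words with nonzero limit split
  disjointly into words of zeros and, for finitely many directions, the words along each.\<close>

lemma sum_word_lim:
  assumes M: "finite M"
  shows "(\<Sum>w\<in>words M n. word_coeff c w * word_lim w) = D0 M n + (\<Sum>v\<in>directions M. LINT z|F v. Dv M n v z - D0 M n)"
proof -
  have fW: "finite (words M n)" by (rule finite_words[OF M])
  let ?Z = "{w\<in>words M n. set w \<subseteq> {0}}" and ?U = "\<Union>v\<in>directions M. words_along M n v"
  have Z: "(\<Sum>w\<in>?Z. word_coeff c w * word_lim w) = D0 M n"
    unfolding D0_def word_coeff_restrict using fW by (subst sum.inter_filter) (auto intro!: sum.cong simp: word_lim_def)
  have "(\<Sum>w\<in>?U. word_coeff c w * word_lim w) = (\<Sum>v\<in>directions M. \<Sum>w\<in>words_along M n v. word_coeff c w * word_lim w)"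
  proof (rule sum.UNION_disjoint[OF finite_directions[OF M]])
    show "\<forall>v\<in>directions M. finite (words_along M n v)" using fW by (simp add: words_along_def)
    show "\<forall>v\<in>directions M. \<forall>v'\<in>directions M. v \<noteq> v' \<longrightarrow> words_along M n v \<inter> words_along M n v' = {}"
      unfolding words_along_def directions_def using S_par_unique par_common by blast
  qed
  also have "\<dots> = (\<Sum>v\<in>directions M. LINT z|F v. Dv M n v z - D0 M n)"
  proof (rule sum.cong[OF refl])
    fix v assume v: "v \<in> directions M"
    then have vS: "v \<in> S" by (simp add: directions_def)
    have "(LINT z|F v. Dv M n v z - D0 M n) = (\<Sum>w\<in>words_along M n v. word_coeff c w * (LINT z|F v. ek (sum_list w) (fst z) * osc_profile T v w (snd z)))"
      unfolding Dv_minus_D0[OF M] by (simp add: Bochner_Integration.integral_sum integrable_mult_right word_integrable[OF vS])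
    also have "\<dots> = (\<Sum>w\<in>words_along M n v. word_coeff c w * word_lim w)"
      by (rule sum.cong[OF refl]) (use word_lim_par[OF vS] in \<open>auto simp: words_along_def\<close>)
    finally show "(\<Sum>w\<in>words_along M n v. word_coeff c w * word_lim w) = (LINT z|F v. Dv M n v z - D0 M n)" ..
  qed
  finally have U: "(\<Sum>w\<in>?U. word_coeff c w * word_lim w) = (\<Sum>v\<in>directions M. LINT z|F v. Dv M n v z - D0 M n)" .
  have "(\<Sum>w\<in>words M n. word_coeff c w * word_lim w) = (\<Sum>w\<in>?Z \<union> ?U. word_coeff c w * word_lim w)"
  proof (rule sum.mono_neutral_right[OF fW])
    show "?Z \<union> ?U \<subseteq> words M n" by (auto simp: words_along_def)
    show "\<forall>w\<in>words M n - (?Z \<union> ?U). word_coeff c w * word_lim w = 0"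
    proof
      fix w assume w: "w \<in> words M n - (?Z \<union> ?U)"
      have "\<not> (\<exists>v\<in>S. \<forall>m\<in>set w. par v m)"
      proof
        assume "\<exists>v\<in>S. \<forall>m\<in>set w. par v m"
        then obtain v where v: "v \<in> S" "\<forall>m\<in>set w. par v m" by blast
        have nz: "\<not> set w \<subseteq> {0}" and wM: "set w \<subseteq> M" using w by (auto simp: words_def)
        then have "v \<in> directions M" using v by (auto simp: directions_def)
        moreover have "w \<in> words_along M n v" using w v nz by (auto simp: words_along_def)
        ultimately show False using w by blast
      qed
      then show "word_coeff c w * word_lim w = 0" using w by (auto simp: word_lim_def)
    qed
  qed
  also have "\<dots> = (\<Sum>w\<in>?Z. word_coeff c w * word_lim w) + (\<Sum>w\<in>?U. word_coeff c w * word_lim w)"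
  proof (rule sum.union_disjoint)
    show "finite ?U" using finite_subset[OF _ fW, of ?U] by (auto simp: words_along_def)
    show "?Z \<inter> ?U = {}" by (auto simp: words_along_def)
  qed (use fW in auto)
  finally show ?thesis unfolding Z U .
qed

definition limit_value :: complex where
  "limit_value = mean_osc * complex_of_real (1 - (\<Sum>\<^sub>\<infinity>v\<in>S. measure (F v) UNIV)) + (\<Sum>\<^sub>\<infinity>v\<in>S. \<integral>z. limit_osc v z \<partial>F v)"

lemma space_F: "v \<in> S \<Longrightarrow> space (F v) = UNIV"
  using F_borel sets_eq_imp_space_eq[of "F v" borel] by simp

lemma norm_LINT_F_le:
  assumes v: "v \<in> S" and f: "integrable (F v) f" and b: "\<And>z. cmod (f z) \<le> b"
  shows "cmod (LINT z|F v. f z) \<le> b * measure (F v) UNIV"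
proof -
  interpret finite_measure "F v" using F_finite v by blast
  have "cmod (LINT z|F v. f z) \<le> (LINT z|F v. cmod (f z))" by (rule integral_norm_bound)
  also have "\<dots> \<le> (LINT z|F v. b)" using f b by (intro integral_mono) auto
  finally show ?thesis by (simp add: space_F[OF v] mult.commute)
qed

text \<open>The limit is rewritten as \<open>mean_osc\<close> plus the sum over directions of the
  integrals of \<open>limit_osc v\<close> minus \<open>mean_osc\<close>, and matched term by term
  with \<open>sum_word_lim\<close>. The factor 3 is one error for the mean and two per unit of mass,
  the total mass being at most 1.\<close>

lemma limit_value_approx:
  assumes M: "finite M"
  shows "cmod (limit_value - (\<Sum>w\<in>words M n. word_coeff c w * word_lim w)) \<le> 3 * err M n"
proof -
  let ?m = "\<lambda>v. measure (F v) UNIV"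
  have E0: "0 \<le> err M n" using mean_osc_D0[OF M, of n] norm_ge_zero order_trans by blast
  have fin: "finite_measure (F v)" if "v \<in> S" for v using F_finite that by blast
  have ms: "(?m has_sum (\<Sum>\<^sub>\<infinity>v\<in>S. ?m v)) S" by (rule has_sum_infsum[OF mass_summable(1)])
  have Ys: "(\<lambda>v. \<integral>z. limit_osc v z \<partial>F v) summable_on S"
  proof -
    have "(\<lambda>v. cmod (\<integral>z. limit_osc v z \<partial>F v)) summable_on S"
    proof (rule Infinite_Sum.abs_summable_on_comparison_test'[OF mass_summable(1)])
      fix v assume v: "v \<in> S"
      show "cmod (\<integral>z. limit_osc v z \<partial>F v) \<le> ?m v"
        using norm_LINT_F_le[OF v limit_osc_integrable[OF v], of 1] by (simp add: limit_osc_def norm_exp_eq_Re)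
    qed
    then show ?thesis by (rule abs_summable_summable)
  qed
  have 1: "((\<lambda>v. (\<integral>z. limit_osc v z \<partial>F v) - mean_osc * complex_of_real (?m v)) has_sum (\<Sum>\<^sub>\<infinity>v\<in>S. \<integral>z. limit_osc v z \<partial>F v) - mean_osc * complex_of_real (\<Sum>\<^sub>\<infinity>v\<in>S. ?m v)) S"
    by (intro has_sum_minus_diff has_sum_infsum Ys has_sum_cmult_right has_sum_of_real ms)
  \<comment> \<open>For directions met by no letter of \<open>M\<close> the integrand is zero, so
    the finite sum is a sum over all of \<open>S\<close>.\<close>
  have 2: "((\<lambda>v. (LINT z|F v. Dv M n v z - D0 M n)) has_sum (\<Sum>v\<in>directions M. LINT z|F v. Dv M n v z - D0 M n)) S"
  proof -
    have "((\<lambda>v. (LINT z|F v. Dv M n v z - D0 M n)) has_sum (\<Sum>v\<in>directions M. LINT z|F v. Dv M n v z - D0 M n)) (directions M)"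
      by (rule has_sum_finite[OF finite_directions[OF M]])
    then show ?thesis
    proof (rule has_sum_cong_neutral[THEN iffD1, rotated 3])
      show "(LINT z|F v. Dv M n v z - D0 M n) = 0" if "v \<in> S - directions M" for v
        using that words_along_empty[of v M n] by (simp add: Dv_minus_D0[OF M])
    qed (auto simp: directions_def)
  qed
  have "cmod ((\<Sum>\<^sub>\<infinity>v\<in>S. \<integral>z. limit_osc v z \<partial>F v) - mean_osc * complex_of_real (\<Sum>\<^sub>\<infinity>v\<in>S. ?m v) - (\<Sum>v\<in>directions M. LINT z|F v. Dv M n v z - D0 M n)) \<le> 2 * err M n * (\<Sum>\<^sub>\<infinity>v\<in>S. ?m v)"
  proof (rule norm_infsum_le[OF has_sum_minus_diff[OF 1 2] has_sum_cmult_right[OF ms]])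
    fix v assume v: "v \<in> S"
    interpret finite_measure "F v" by (rule fin[OF v])
    have pv: "primitive v" using S_prim v by blast
    note int = limit_osc_integrable[OF v] Dv_integrable[OF v, of M n]
    have i: "integrable (F v) (\<lambda>z. (limit_osc v z - Dv M n v z) - (mean_osc - D0 M n))"
      by (intro Bochner_Integration.integrable_diff int integrable_const)
    have "(LINT z|F v. (limit_osc v z - Dv M n v z) - (mean_osc - D0 M n)) = (\<integral>z. limit_osc v z \<partial>F v) - mean_osc * complex_of_real (?m v) - (LINT z|F v. Dv M n v z - D0 M n)"
      using int by (simp add: space_F[OF v] scaleR_conv_of_real algebra_simps)
    moreover have "cmod (LINT z|F v. (limit_osc v z - Dv M n v z) - (mean_osc - D0 M n)) \<le> 2 * err M n * ?m v"
    proof (rule norm_LINT_F_le[OF v i])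
      show "cmod (limit_osc v z - Dv M n v z - (mean_osc - D0 M n)) \<le> 2 * err M n" for z
        using norm_triangle_ineq4[of "limit_osc v z - Dv M n v z" "mean_osc - D0 M n"] limit_osc_Dv[OF pv M, of z n] mean_osc_D0[OF M, of n] by simp
    qed
    ultimately show "cmod ((\<integral>z. limit_osc v z \<partial>F v) - mean_osc * complex_of_real (?m v) - (LINT z|F v. Dv M n v z - D0 M n)) \<le> 2 * err M n * ?m v" by simp
  qed
  also have "\<dots> \<le> 2 * err M n * 1" using mass_summable(2) E0 by (intro mult_left_mono) auto
  finally have 3: "cmod ((\<Sum>\<^sub>\<infinity>v\<in>S. \<integral>z. limit_osc v z \<partial>F v) - mean_osc * complex_of_real (\<Sum>\<^sub>\<infinity>v\<in>S. ?m v) - (\<Sum>v\<in>directions M. LINT z|F v. Dv M n v z - D0 M n)) \<le> 2 * err M n" by simp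
  have "limit_value - (\<Sum>w\<in>words M n. word_coeff c w * word_lim w) = (mean_osc - D0 M n) + ((\<Sum>\<^sub>\<infinity>v\<in>S. \<integral>z. limit_osc v z \<partial>F v) - mean_osc * complex_of_real (\<Sum>\<^sub>\<infinity>v\<in>S. ?m v) - (\<Sum>v\<in>directions M. LINT z|F v. Dv M n v z - D0 M n))"
    unfolding sum_word_lim[OF M] limit_value_def by (simp add: algebra_simps)
  also have "cmod \<dots> \<le> err M n + 2 * err M n" by (intro order_trans[OF norm_triangle_ineq] add_mono mean_osc_D0 M 3)
  finally show ?thesis by simp
qed

lemma cnj_limit_value:
  "cnj limit_value = exp (\<i> * complex_of_real (T * (LINT x | MT. V x))) * complex_of_real (1 - (\<Sum>\<^sub>\<infinity>v\<in>S. measure (F v) UNIV))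
    + (\<Sum>\<^sub>\<infinity>v\<in>S. \<integral>z. exp (\<i> * complex_of_real (phase T V v z)) \<partial>F v)"
proof -
  have e: "cnj (exp (- \<i> * complex_of_real r)) = exp (\<i> * complex_of_real r)" for r
    by (simp add: exp_cnj)
  have "cnj (\<Sum>\<^sub>\<infinity>v\<in>S. \<integral>z. limit_osc v z \<partial>F v) = (\<Sum>\<^sub>\<infinity>v\<in>S. cnj (\<integral>z. limit_osc v z \<partial>F v))" by (rule infsum_cnj[symmetric])
  also have "\<dots> = (\<Sum>\<^sub>\<infinity>v\<in>S. \<integral>z. exp (\<i> * complex_of_real (phase T V v z)) \<partial>F v)"
    unfolding Bochner_Integration.integral_cnj[symmetric] limit_osc_def e ..
  finally show ?thesis unfolding limit_value_def complex_cnj_add complex_cnj_mult mean_osc_def e by simp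
qed

section \<open>Convergence of the inner products\<close>

lemma main_limit:
  fixes u uE :: "real \<Rightarrow> real \<Rightarrow> pt \<Rightarrow> complex"
  assumes u_sol: "\<forall>h. 0 < h \<and> h \<le> 1 \<longrightarrow> schr_sol h 0 V (u h) \<and> u h 0 = \<psi> h"
    and uE_sol: "\<forall>h. 0 < h \<and> h \<le> 1 \<longrightarrow> schr_sol h (\<epsilon> h) V (uE h) \<and> uE h 0 = \<psi> h"
  shows "((\<lambda>h. innerT (uE h (T * (h / \<epsilon> h))) (u h (T * (h / \<epsilon> h)))) \<longlongrightarrow> cnj limit_value) (at_right 0)"
proof -
  have "((\<lambda>h. innerT (u h (T * (h / \<epsilon> h))) (uE h (T * (h / \<epsilon> h)))) \<longlongrightarrow> limit_value) (at_right 0)"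
  proof (rule tendstoI)
    fix e :: real assume e: "e > 0"
    \<comment> \<open>The error occurs four times, once on the quantum side and three times on the
      classical side; the remaining \<open>e / 2\<close> is for the convergence of finitely many
      words.\<close>
    obtain M n where M: "finite M" and En: "err M n < e / 8" using dyson_error_small[OF A, of "e / 8"] e by auto
    let ?Q = "\<lambda>h. \<Sum>w\<in>words M n. word_coeff c w * shift_form (\<psi> h) (sum_list w) (\<lambda>k. osc_int (quantum_phase (T * kap h)) w 1 k)"
    let ?L = "\<Sum>w\<in>words M n. word_coeff c w * word_lim w"
    have "(?Q \<longlongrightarrow> ?L) (at_right 0)" by (intro tendsto_intros word_limit)
    then have "\<forall>\<^sub>F h in at_right 0. dist (?Q h) ?L < e / 2" by (rule tendstoD) (use e in simp)
    then show "\<forall>\<^sub>F h in at_right 0. dist (innerT (u h (T * (h / \<epsilon> h))) (uE h (T * (h / \<epsilon> h)))) limit_value < e"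
      using ev_h
    proof eventually_elim
      case (elim h)
      then have h: "0 < h" "h \<le> 1" by auto
      have ep: "\<epsilon> h > 0" using eps_pos h by auto
      let ?I = "innerT (u h (T * (h / \<epsilon> h))) (uE h (T * (h / \<epsilon> h)))"
      have 1: "cmod (?I - ?Q h) \<le> err M n"
        unfolding kap_def
        by (rule quantum_dyson[OF V_cont A h(1) ep M psiL[OF h]]) (use u_sol uE_sol h in auto)
      have 2: "cmod (?Q h - ?L) < e / 2" using elim(1) by (simp add: dist_norm)
      have 3: "cmod (limit_value - ?L) \<le> 3 * err M n" by (rule limit_value_approx[OF M])
      have "cmod (?I - limit_value) \<le> cmod (?I - ?Q h) + cmod (?Q h - ?L) + cmod (limit_value - ?L)"
        using norm_triangle_ineq[of "?I - ?Q h" "?Q h - ?L"] norm_triangle_ineq4[of "?I - ?L" "limit_value - ?L"] by simp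
      also have "\<dots> < e" using 1 2 3 En by linarith
      finally show ?case by (simp add: dist_norm)
    qed
  qed
  from tendsto_cnj[OF this] show ?thesis by (simp only: innerT_commute[symmetric])
qed

end

theorem theorem2p1:
  fixes V :: "pt \<Rightarrow> real"
    and \<epsilon> :: "real \<Rightarrow> real"
    and \<psi> :: "real \<Rightarrow> pt \<Rightarrow> complex"
    and S :: "(int \<times> int) set"
    and F :: "int \<times> int \<Rightarrow> (pt \<times> real) measure"
    and u uE :: "real \<Rightarrow> real \<Rightarrow> pt \<Rightarrow> complex"
  assumes V_smooth: "smooth V" and V_per: "periodic V"
    and eps_pos: "\<forall>h. 0 < h \<and> h \<le> 1 \<longrightarrow> 0 < \<epsilon> h"
    and eps_big: "filterlim (\<lambda>h. \<epsilon> h / h\<^sup>2) at_top (at_right 0)"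
    and eps_small: "((\<lambda>h. \<epsilon> h / h) \<longlongrightarrow> 0) (at_right 0)"
    and psi_L2: "\<forall>h. 0 < h \<and> h \<le> 1 \<longrightarrow> L2T (\<psi> h) \<and> normT (\<psi> h) = 1"
    and psi_low: "((\<lambda>\<delta>. Limsup (at_right 0) (\<lambda>h. ereal (spec_norm h {0..\<delta>} (\<psi> h)))) \<longlongrightarrow> 0) (at_right 0)"
    and psi_high: "((\<lambda>R. Limsup (at_right 0) (\<lambda>h. ereal (spec_norm h {R..} (\<psi> h)))) \<longlongrightarrow> 0) at_top"
    and S_prim: "\<forall>v\<in>S. primitive v"
    and S_choice: "\<forall>v. primitive v \<longrightarrow> (v \<in> S \<longleftrightarrow> - v \<notin> S)"
    and F_borel: "\<forall>v\<in>S. sets (F v) = sets borel"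
    and F_finite: "\<forall>v\<in>S. finite_measure (F v)"
    and F_conc: "\<forall>v\<in>S. emeasure (F v) (- (({0..<1::real} \<times> {0..<1::real}) \<times> (UNIV::real set))) = 0"
    and F_lim: "\<forall>v\<in>S. \<forall>a :: pt \<times> real \<Rightarrow> complex.
        smooth a \<and> (\<forall>x m \<eta>. a (x + zshift m, \<eta>) = a (x, \<eta>)) \<and>
        (\<exists>R. \<forall>x \<eta>. R < \<bar>\<eta>\<bar> \<longrightarrow> a (x, \<eta>) = 0) \<longrightarrow>
        ((\<lambda>h. op_quad h (\<lambda>x \<xi>. Iv v (\<lambda>y \<eta>. a (y, \<eta>)) x (h * Hv v \<xi> / \<epsilon> h)) (\<psi> h))
           \<longlongrightarrow> integral\<^sup>L (F v) a) (at_right 0)"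
    and u_sol: "\<forall>h. 0 < h \<and> h \<le> 1 \<longrightarrow> schr_sol h 0 V (u h) \<and> u h 0 = \<psi> h"
    and uE_sol: "\<forall>h. 0 < h \<and> h \<le> 1 \<longrightarrow> schr_sol h (\<epsilon> h) V (uE h) \<and> uE h 0 = \<psi> h"
  shows "(\<lambda>v. measure (F v) UNIV) summable_on S \<and>
    (\<forall>t::real.
      ((\<lambda>h. innerT (uE h (t * (h / \<epsilon> h))) (u h (t * (h / \<epsilon> h))))
        \<longlongrightarrow> exp (\<i> * complex_of_real (t * (LINT x | lebesgue_on usq. V x)))
              * complex_of_real (1 - (\<Sum>\<^sub>\<infinity>v\<in>S. measure (F v) UNIV))
            + (\<Sum>\<^sub>\<infinity>v\<in>S. \<integral>z. exp (\<i> * complex_of_real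
                 (LBINT s=0..t. Iv0 v V (fst z + (s * snd z / Lv v) *\<^sub>R zshift v))) \<partial>F v))
      (at_right 0))"
proof (intro conjI allI)
  interpret semiclassical \<epsilon> \<psi> S F
    by unfold_locales (fact eps_pos eps_big eps_small psi_L2 psi_low S_prim S_choice F_borel F_finite F_lim)+
  show "(\<lambda>v. measure (F v) UNIV) summable_on S" by (rule mass_summable(1))
  fix t :: real
  let ?L = "exp (\<i> * complex_of_real (t * (LINT x | lebesgue_on usq. V x)))
              * complex_of_real (1 - (\<Sum>\<^sub>\<infinity>v\<in>S. measure (F v) UNIV))
            + (\<Sum>\<^sub>\<infinity>v\<in>S. \<integral>z. exp (\<i> * complex_of_real
                 (LBINT s=0..t. Iv0 v V (fst z + (s * snd z / Lv v) *\<^sub>R zshift v))) \<partial>F v)"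
  show "((\<lambda>h. innerT (uE h (t * (h / \<epsilon> h))) (u h (t * (h / \<epsilon> h)))) \<longlongrightarrow> ?L) (at_right 0)"
  \<comment> \<open>At t = 0 every phase is zero and the words have no decay. Both sides equal 1
    there: the total mass added by the integrals cancels the mass subtracted from 1.\<close>
  proof (cases "t = 0")
    case True
    have space: "space (F v) = UNIV" if "v \<in> S" for v
      using F_borel that sets_eq_imp_space_eq[of "F v" borel] by simp
    have "(\<Sum>\<^sub>\<infinity>v\<in>S. \<integral>z. exp (\<i> * complex_of_real
        (LBINT s=0..t. Iv0 v V (fst z + (s * snd z / Lv v) *\<^sub>R zshift v))) \<partial>F v) = (\<Sum>\<^sub>\<infinity>v\<in>S. complex_of_real (measure (F v) UNIV))"
      using True by (intro infsum_cong) (simp add: space scaleR_conv_of_real flip: zero_ereal_def)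
    also have "\<dots> = complex_of_real (\<Sum>\<^sub>\<infinity>v\<in>S. measure (F v) UNIV)"
      by (intro infsumI has_sum_of_real has_sum_infsum mass_summable(1))
    finally have "?L = 1" using True by simp
    moreover have "\<forall>\<^sub>F h in at_right 0. innerT (uE h (t * (h / \<epsilon> h))) (u h (t * (h / \<epsilon> h))) = 1"
      using ev_h
    proof eventually_elim
      case (elim h)
      then have "uE h 0 = \<psi> h" "u h 0 = \<psi> h" "normT (\<psi> h) = 1" using u_sol uE_sol psi_L2 by auto
      then show ?case using True by (simp add: innerT_self_normT)
    qed
    ultimately show ?thesis by (simp only:) (rule tendsto_eventually)
  next
    case False
    interpret semiclassical_potential \<epsilon> \<psi> S F V t
      by unfold_locales (fact V_smooth V_per False)+
    show ?thesis using main_limit[OF u_sol uE_sol] unfolding cnj_limit_value phase_def .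
  qed
qed

end
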